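(* Let $K$ be a field of positive characteristic $p$, let $n\ge2$, let $a_0,a_1,\dots,a_n$ be non-zero elements of $K$, and let $H\subset\mathbf{P}_n$ be defined by $a_0X_0+a_1X_1+\cdots+a_nX_n=0$. Let $G$ be a subgroup of $K^*$ with $\sqrt{G}$ finitely generated, and write $H^*(G)$ for the set of points in $\mathbf{P}_n(G)$ lying on $H$ and satisfying $\sum_{i\in I}a_iX_i\neq0$ for every non-empty proper subset $I$ of $\{0,1,\dots,n\}$. Then there is a power $q$ of $p$ such that $H^*(G)$ is contained both in (1) an effectively computable finite union of sets $[\psi_1,\dots,\psi_h]_q\{\tau\}$, each contained in $H(G)$, with $\sqrt{G}$-automorphisms $\psi_1,\dots,\psi_h$ ($0\le h\le n-1$) and points $\tau$, and in (2) an effectively computable finite union of sets $(\pi_0,\pi_1,\dots,\pi_h)_q$, each contained in $H(G)$, with points $\pi_0,\pi_1,\dots,\pi_h$ ($0\le h\le n-1$) having homogeneous coordinates in $K^*$.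
   Context: For a subgroup $G\subseteq K^*$, $\sqrt{G}$ is the set of $\gamma\in K$ with $\gamma^s\in G$ for some positive integer $s$. $\mathbf{P}_n(G)$ is the set of points of $\mathbf{P}_n$ having homogeneous coordinates all in $G$, and $H(G)=H\cap\mathbf{P}_n(G)$. A $\sqrt{G}$-automorphism is a map $\psi(X_0,\dots,X_n)=(g_0X_0,\dots,g_nX_n)$ with $g_i\in\sqrt{G}$. Let $\varphi$ denote the map raising every homogeneous coordinate to the $q$-th power. Define $[\psi_1,\dots,\psi_h]_q\Sigma=\bigcup_{e_1,\dots,e_h\ge0}(\psi_1^{-1}\varphi^{e_1}\psi_1)\cdots(\psi_h^{-1}\varphi^{e_h}\psi_h)(\Sigma)$ (composition; $\Sigma$ itself if $h=0$), and $(\pi_0,\dots,\pi_h)_q=\bigcup_{l_1,\dots,l_h\ge0}\pi_0(\varphi^{l_1}\pi_1)\cdots(\varphi^{l_h}\pi_h)$ with coordinatewise multiplication of homogeneous coordinates ($\{\pi_0\}$ if $h=0$). *)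

theory Defs
  imports Complex_Main "HOL-Library.Nat_Bijection"
begin

subsection \<open>Subgroups of the multiplicative group of a field\<close>

definition mult_subgroup :: "'a::field set \<Rightarrow> bool" where
  "mult_subgroup G \<longleftrightarrow>
     0 \<notin> G \<and> 1 \<in> G \<and> (\<forall>x\<in>G. \<forall>y\<in>G. x * y \<in> G) \<and> (\<forall>x\<in>G. inverse x \<in> G)"

definition radical :: "'a::field set \<Rightarrow> 'a set" where
  "radical G = {\<gamma>. \<exists>s>0. \<gamma> ^ s \<in> G}"

subsection \<open>Projective space\<close>

text \<open>A point of $n$-dimensional projective space is the set of all its vectors of homogeneous
  coordinates \<open>[x\<^sub>0, \<dots>, x\<^sub>n]\<close>.\<close>

type_synonym 'a point = "'a list set"

definition hpoint :: "'a::field list \<Rightarrow> 'a point" where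
  "hpoint xs = {map ((*) c) xs | c. c \<noteq> 0}"

definition proj_space :: "nat \<Rightarrow> 'a::field point set" where
  "proj_space n = {hpoint xs | xs. length xs = Suc n \<and> (\<exists>x\<in>set xs. x \<noteq> 0)}"

definition proj_space_over :: "nat \<Rightarrow> 'a::field set \<Rightarrow> 'a point set" where
  "proj_space_over n G = {hpoint xs | xs. length xs = Suc n \<and> set xs \<subseteq> G} \<inter> proj_space n"

definition hyperplane :: "nat \<Rightarrow> 'a::field list \<Rightarrow> 'a point set" where
  "hyperplane n a = {P \<in> proj_space n. \<forall>xs\<in>P. (\<Sum>i\<le>n. a ! i * xs ! i) = 0}"

definition hyperplane_over :: "nat \<Rightarrow> 'a::field list \<Rightarrow> 'a set \<Rightarrow> 'a point set" where
  "hyperplane_over n a G = hyperplane n a \<inter> proj_space_over n G"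

definition nondegenerate_over :: "nat \<Rightarrow> 'a::field list \<Rightarrow> 'a set \<Rightarrow> 'a point set" where
  "nondegenerate_over n a G =
     {P \<in> hyperplane_over n a G.
        \<forall>I. I \<noteq> {} \<longrightarrow> I \<subset> {..n} \<longrightarrow> (\<forall>xs\<in>P. (\<Sum>i\<in>I. a ! i * xs ! i) \<noteq> 0)}"

definition diag_map :: "'a::field list \<Rightarrow> 'a point \<Rightarrow> 'a point" where
  "diag_map g P = map2 (*) g ` P"

text \<open>The coordinatewise powers of the elements of a point need not exhaust a point (the field
  need not be perfect), hence the rescaling by \<^const>\<open>hpoint\<close>.\<close>

definition frob :: "nat \<Rightarrow> 'a::field point \<Rightarrow> 'a point" where
  "frob q P = (\<Union>xs\<in>P. hpoint (map (\<lambda>x. x ^ q) xs))"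

definition pmult :: "'a::field point \<Rightarrow> 'a point \<Rightarrow> 'a point" where
  "pmult P Q = (\<Union>xs\<in>P. \<Union>ys\<in>Q. hpoint (map2 (*) xs ys))"

lemma hpoint_scale: "c \<noteq> 0 \<Longrightarrow> hpoint (map ((*) c) xs) = hpoint xs"
  unfolding hpoint_def
proof safe
  fix d :: 'a assume "c \<noteq> 0" "d \<noteq> 0"
  then show "\<exists>e. map ((*) d) (map ((*) c) xs) = map ((*) e) xs \<and> e \<noteq> 0"
    by (intro exI[of _ "d * c"]) (auto simp: mult.assoc)
  show "\<exists>e. map ((*) d) xs = map ((*) e) (map ((*) c) xs) \<and> e \<noteq> 0"
    using \<open>c \<noteq> 0\<close> \<open>d \<noteq> 0\<close> by (intro exI[of _ "d / c"]) auto
qed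

lemma hpoint_refl: "xs \<in> hpoint xs"
proof -
  have "xs = map ((*) 1) xs" by (rule nth_equalityI) simp_all
  then show ?thesis unfolding hpoint_def using one_neq_zero by blast
qed

lemma hpoint_UN_const:
  assumes "\<And>c. c \<noteq> 0 \<Longrightarrow> f (map ((*) c) xs) = f xs"
  shows "(\<Union>zs\<in>hpoint xs. f zs) = f xs"
proof -
  have "f zs = f xs" if "zs \<in> hpoint xs" for zs
  proof -
    from that obtain c where "zs = map ((*) c) xs" "c \<noteq> 0" unfolding hpoint_def by blast
    then show ?thesis using assms by simp
  qed
  then show ?thesis using hpoint_refl[of xs] by blast
qed

lemma diag_map_hpoint: "diag_map g (hpoint xs) = hpoint (map2 (*) g xs)"
proof -
  have "map2 (*) g (map ((*) c) xs) = map ((*) c) (map2 (*) g xs)" for c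
    by (rule nth_equalityI) auto
  moreover have "hpoint zs = (\<lambda>c. map ((*) c) zs) ` {c. c \<noteq> 0}" for zs :: "'a list"
    unfolding hpoint_def by blast
  ultimately show ?thesis by (simp only: diag_map_def image_image)
qed

lemma frob_hpoint: "frob q (hpoint xs) = hpoint (map (\<lambda>x. x ^ q) xs)"
  unfolding frob_def
proof (rule hpoint_UN_const)
  fix c :: 'a assume "c \<noteq> 0"
  then show "hpoint (map (\<lambda>x. x ^ q) (map ((*) c) xs)) = hpoint (map (\<lambda>x. x ^ q) xs)"
    using hpoint_scale[of "c ^ q" "map (\<lambda>x. x ^ q) xs"]
    by (simp add: o_def power_mult_distrib)
qed

lemma pmult_hpoint: "pmult (hpoint xs) (hpoint ys) = hpoint (map2 (*) xs ys)"
proof -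
  have 1: "hpoint (map2 (*) xs (map ((*) c) ys)) = hpoint (map2 (*) xs ys)"
    if "c \<noteq> 0" for c and xs ys :: "'a list"
  proof -
    have "map2 (*) xs (map ((*) c) ys) = map ((*) c) (map2 (*) xs ys)"
      by (rule nth_equalityI) auto
    then show ?thesis using that hpoint_scale by metis
  qed
  have 2: "hpoint (map2 (*) (map ((*) c) xs) ys) = hpoint (map2 (*) xs ys)"
    if "c \<noteq> 0" for c and xs ys :: "'a list"
  proof -
    have "map2 (*) (map ((*) c) xs) ys = map ((*) c) (map2 (*) xs ys)"
      by (rule nth_equalityI) auto
    then show ?thesis using that hpoint_scale by metis
  qed
  have "(\<Union>zs\<in>hpoint ys. hpoint (map2 (*) us zs)) = hpoint (map2 (*) us ys)" for us
    by (rule hpoint_UN_const) (rule 1)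
  then show ?thesis
    unfolding pmult_def by (simp only:) (rule hpoint_UN_const, rule 2)
qed

subsection \<open>The sets \<open>[\<psi>\<^sub>1, \<dots>, \<psi>\<^sub>h]\<^sub>q \<Sigma>\<close> and \<open>(\<pi>\<^sub>0, \<dots>, \<pi>\<^sub>h)\<^sub>q\<close>\<close>

text \<open>An automorphism is given by its vector of multipliers; \<^term>\<open>map inverse g\<close> is the vector
  of multipliers of the inverse.\<close>

definition conj_frob :: "nat \<Rightarrow> 'a::field list \<Rightarrow> nat \<Rightarrow> 'a point \<Rightarrow> 'a point" where
  "conj_frob q g e = diag_map (map inverse g) \<circ> (frob q ^^ e) \<circ> diag_map g"

definition frob_orbit :: "nat \<Rightarrow> 'a::field list list \<Rightarrow> 'a point set \<Rightarrow> 'a point set" where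
  "frob_orbit q gs \<Sigma> =
     (\<Union>es\<in>{es. length es = length gs}. foldr (\<circ>) (map2 (conj_frob q) gs es) id ` \<Sigma>)"

definition frob_product :: "nat \<Rightarrow> 'a::field point \<Rightarrow> 'a point list \<Rightarrow> 'a point set" where
  "frob_product q \<pi>\<^sub>0 \<pi>s =
     {foldl pmult \<pi>\<^sub>0 (map2 (\<lambda>l. frob q ^^ l) ls \<pi>s) | ls. length ls = length \<pi>s}"

text \<open>Finite unions are given by lists: an entry \<open>(gs, t)\<close> of \<open>U\<close> consists of the multipliers of
  \<open>\<psi>\<^sub>1, \<dots>, \<psi>\<^sub>h\<close> and of coordinates of \<open>\<tau>\<close>, an entry \<open>(x, xs)\<close> of \<open>V\<close> of coordinates of
  \<open>\<pi>\<^sub>0\<close> and of \<open>\<pi>\<^sub>1, \<dots>, \<pi>\<^sub>h\<close>.\<close>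

definition orbit_cover ::
  "nat \<Rightarrow> 'a::field list \<Rightarrow> 'a set \<Rightarrow> nat \<Rightarrow> ('a list list \<times> 'a list) list \<Rightarrow> bool" where
  "orbit_cover n a G q U \<longleftrightarrow>
     (\<forall>(gs, t)\<in>set U.
        length gs \<le> n - 1 \<and>
        (\<forall>g\<in>set gs. length g = Suc n \<and> set g \<subseteq> radical G) \<and>
        hpoint t \<in> proj_space n \<and>
        frob_orbit q gs {hpoint t} \<subseteq> hyperplane_over n a G) \<and>
     nondegenerate_over n a G \<subseteq> (\<Union>(gs, t)\<in>set U. frob_orbit q gs {hpoint t})"

definition product_cover ::
  "nat \<Rightarrow> 'a::field list \<Rightarrow> 'a set \<Rightarrow> nat \<Rightarrow> ('a list \<times> 'a list list) list \<Rightarrow> bool" where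
  "product_cover n a G q V \<longleftrightarrow>
     (\<forall>(x, xs)\<in>set V.
        length xs \<le> n - 1 \<and>
        (\<forall>y\<in>set (x # xs). length y = Suc n \<and> 0 \<notin> set y) \<and>
        frob_product q (hpoint x) (map hpoint xs) \<subseteq> hyperplane_over n a G) \<and>
     nondegenerate_over n a G \<subseteq> (\<Union>(x, xs)\<in>set V. frob_product q (hpoint x) (map hpoint xs))"

subsection \<open>Partial recursive functions\<close>

datatype recf = Zr | Sc | Pj nat | Cn recf "recf list" | Pr recf recf | Mn recf

text \<open>\<open>computes f xs y\<close>: on the argument tuple \<open>xs\<close>, the program \<open>f\<close> halts with result \<open>y\<close>.\<close>

inductive computes :: "recf \<Rightarrow> nat list \<Rightarrow> nat \<Rightarrow> bool" where
  zero: "computes Zr xs 0"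
| succ: "computes Sc [x] (Suc x)"
| proj: "i < length xs \<Longrightarrow> computes (Pj i) xs (xs ! i)"
| comp: "length ys = length gs \<Longrightarrow> (\<forall>i<length gs. computes (gs ! i) xs (ys ! i)) \<Longrightarrow>
     computes f ys z \<Longrightarrow> computes (Cn f gs) xs z"
| prim_0: "computes f xs y \<Longrightarrow> computes (Pr f g) (0 # xs) y"
| prim_Suc: "computes (Pr f g) (m # xs) r \<Longrightarrow> computes g (m # r # xs) y \<Longrightarrow>
     computes (Pr f g) (Suc m # xs) y"
| mu: "computes f (m # xs) 0 \<Longrightarrow> (\<forall>k<m. \<exists>r. computes f (k # xs) (Suc r)) \<Longrightarrow>
     computes (Mn f) xs m"

lemma computes_deterministic: "computes f xs y \<Longrightarrow> computes f xs z \<Longrightarrow> y = z"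
proof (induction arbitrary: z rule: computes.induct)
  case (zero xs)
  then show ?case by (cases rule: computes.cases) auto
next
  case (succ x)
  then show ?case by (cases rule: computes.cases) auto
next
  case (proj i xs)
  from proj.prems show ?case by (cases rule: computes.cases) auto
next
  case (prim_0 f xs y g)
  from prim_0.prems have "computes f xs z" by (cases rule: computes.cases) auto
  then show ?case by (rule prim_0.IH)
next
  case (comp ys gs xs f w)
  from comp.prems obtain ys' where ys': "length ys' = length gs"
    "\<forall>i<length gs. computes (gs ! i) xs (ys' ! i)" "computes f ys' z"
    by (cases rule: computes.cases) auto
  have "ys' ! i = ys ! i" if "i < length gs" for i
    using comp.IH(1) ys'(2) that by metis
  then have "ys' = ys" using comp.hyps(1) ys'(1) by (intro nth_equalityI) simp_all
  then show ?case using comp.IH(2) ys'(3) by blast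
next
  case (prim_Suc f g m xs r y)
  from prim_Suc.prems obtain r' where
    "computes (Pr f g) (m # xs) r'" "computes g (m # r' # xs) z"
    by (cases rule: computes.cases) auto
  then show ?case using prim_Suc.IH by blast
next
  case (mu f m xs)
  from mu.prems have "computes f (z # xs) 0 \<and> (\<forall>k<z. \<exists>r. computes f (k # xs) (Suc r))"
    by (cases rule: computes.cases) auto
  then have z: "computes f (z # xs) 0" "\<forall>k<z. \<exists>r. computes f (k # xs) (Suc r)"
    by simp_all
  show ?case
  proof (rule linorder_cases[of m z])
    assume "m < z"
    then obtain r where "computes f (m # xs) (Suc r)" using z(2) by blast
    from mu.IH(1)[OF this] show ?thesis by simp
  next
    assume "z < m"
    with mu.IH(2) obtain r where "\<forall>w. computes f (z # xs) w \<longrightarrow> Suc r = w" by metis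
    from this[rule_format, OF z(1)] show ?thesis by simp
  qed simp
qed

subsection \<open>Representation of field elements\<close>

text \<open>The elements of the subfield generated by \<open>ys\<close> are the values at \<open>ys\<close> of field
  expressions, and field expressions have numerical codes.\<close>

datatype fexpr = Gen nat | One | Neg fexpr | Inv fexpr | Add fexpr fexpr | Mul fexpr fexpr

primrec fval :: "'a::field list \<Rightarrow> fexpr \<Rightarrow> 'a" where
  "fval ys (Gen i) = (if i < length ys then ys ! i else 0)"
| "fval ys One = 1"
| "fval ys (Neg s) = - fval ys s"
| "fval ys (Inv s) = inverse (fval ys s)"
| "fval ys (Add s t) = fval ys s + fval ys t"
| "fval ys (Mul s t) = fval ys s * fval ys t"

primrec fcode :: "fexpr \<Rightarrow> nat" where
  "fcode (Gen i) = list_encode [0, i]"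
| "fcode One = list_encode [1]"
| "fcode (Neg s) = list_encode [2, fcode s]"
| "fcode (Inv s) = list_encode [3, fcode s]"
| "fcode (Add s t) = list_encode [4, fcode s, fcode t]"
| "fcode (Mul s t) = list_encode [5, fcode s, fcode t]"

lemma fcode_eq_iff: "fcode s = fcode t \<longleftrightarrow> s = t"
proof (induction s arbitrary: t)
  case (Gen i) show ?case by (cases t) (auto simp: list_encode_eq)
next
  case One show ?case by (cases t) (auto simp: list_encode_eq)
next
  case (Neg s) then show ?case by (cases t) (auto simp: list_encode_eq)
next
  case (Inv s) then show ?case by (cases t) (auto simp: list_encode_eq)
next
  case (Add s1 s2) then show ?case by (cases t) (auto simp: list_encode_eq)
next
  case (Mul s1 s2) then show ?case by (cases t) (auto simp: list_encode_eq)
qed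

abbreviation vec_val :: "'a::field list \<Rightarrow> fexpr list \<Rightarrow> 'a list" where
  "vec_val ys \<equiv> map (fval ys)"

definition list_code :: "('b \<Rightarrow> nat) \<Rightarrow> 'b list \<Rightarrow> nat" where
  "list_code c xs = list_encode (map c xs)"

definition pair_code :: "('b \<Rightarrow> nat) \<Rightarrow> ('c \<Rightarrow> nat) \<Rightarrow> 'b \<times> 'c \<Rightarrow> nat" where
  "pair_code c d = (\<lambda>(x, y). prod_encode (c x, d y))"

abbreviation vec_code :: "fexpr list \<Rightarrow> nat" where
  "vec_code \<equiv> list_code fcode"

definition output_code ::
  "nat \<Rightarrow> (fexpr list list \<times> fexpr list) list \<Rightarrow> (fexpr list \<times> fexpr list list) list \<Rightarrow> nat" where
  "output_code k U V =
     list_encode [k,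
       list_code (pair_code (list_code vec_code) vec_code) U,
       list_code (pair_code vec_code (list_code vec_code)) V]"

end

theory Submission
  imports Defs "HOL-Computational_Algebra.Primes" "HOL-Library.Function_Algebras"
begin

text \<open>Write a solution as \<open>x = \<gamma> y\<^sup>p\<close> where the coordinates of \<open>\<gamma>\<close> are monomials in the generators of
  \<open>G\<close> with exponents below \<open>p\<close>. Expanding \<open>a\<^sub>i \<gamma>\<^sub>i\<close> in a basis of the field over its \<open>p\<close>-th powers turns
  one linear equation for \<open>x\<close> into a space of linear equations for \<open>y\<close>, whose coefficients can be
  chosen in a fixed finite set \<open>W\<close> closed under taking digits. Thus the equations that occur are the
  states of a finite automaton reading the base \<open>p\<close> digits of the exponents of \<open>x\<close>. The dimension of
  the space of equations does not decrease along a walk, and it stays below \<open>n + 1\<close>.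

  When a state recurs, the step around the cycle is a Frobenius twist preserving the space of
  equations. By nondegeneracy a diagonal map preserving such a space is scalar, so the twist is
  determined by the state and equals \<open>\<psi>\<^sup>-\<^sup>1 \<phi>\<^sup>e \<psi>\<close>, where the multipliers of \<open>\<psi>\<close> are ratios of
  coefficients of forms of minimal support. Every walk therefore has bounded stretches and at most
  one twist per dimension, which gives the bound \<open>n - 1\<close> on their number.

  For the algorithm, \<open>W\<close> is found by unbounded search. It bounds all remaining data, so the
  candidates can be enumerated, and a candidate is kept if its orbit lies on \<open>H\<close>. By linear
  dependence of the Frobenius images of a point, this needs to be tested for exponents at most \<open>n\<close>
  only.\<close>

subsection \<open>Total recursive functions of several arguments\<close>

text \<open>A single digit of an equation may have vanishing subsums, so one equation cannot be
  followed along the expansion. All digits together inherit nondegeneracy, because a non-zero subsum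
  has a non-zero digit; hence the states are spaces of forms.

  One \<open>q\<close> has to serve all points, although cycles at different states have different
  lengths. The lengths used are at most a bound \<open>N\<close> for the number of states, so
  \<open>K = fact N\<close> is a common multiple and \<open>q = p ^ K\<close> works for every twist.
  The multipliers are \<open>(q - 1)\<close>-st roots of elements of \<open>G\<close>, which is how
  \<open>radical G\<close> enters.

  Bounds must not depend on the point. A walk of any length to a recurring state is replaced by a
  short one, and triviality of the stabilizer shows that the removed part is a power of the twist at
  that state.

  In the products the exponents are independent, whereas an orbit yields partial sums, which
  increase. Equations known for all large exponents must therefore be carried back to small ones;
  this rests on Frobenius not raising dimensions.\<close>

definition total_rec :: "nat \<Rightarrow> (nat list \<Rightarrow> nat) \<Rightarrow> bool" where
  "total_rec k f \<longleftrightarrow> (\<exists>r. \<forall>xs. length xs = k \<longrightarrow> computes r xs (f xs))"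

lemma total_rec_cong:
  assumes "total_rec k f" "\<And>xs. length xs = k \<Longrightarrow> f xs = g xs"
  shows "total_rec k g"
  using assms unfolding total_rec_def by metis

lemma total_rec_proj: "i < k \<Longrightarrow> total_rec k (\<lambda>xs. xs ! i)"
  unfolding total_rec_def using computes.proj by blast

lemma total_rec_zero: "total_rec k (\<lambda>xs. 0)"
  unfolding total_rec_def using computes.zero by blast

lemma total_rec_comp:
  assumes f: "total_rec (length gs) f" and gs: "\<forall>g\<in>set gs. total_rec k g"
  shows "total_rec k (\<lambda>xs. f (map (\<lambda>g. g xs) gs))"
proof -
  obtain r where r: "\<And>xs. length xs = length gs \<Longrightarrow> computes r xs (f xs)"
    using f unfolding total_rec_def by blast
  have "\<exists>s. \<forall>xs. length xs = k \<longrightarrow> computes s xs (g xs)" if "g \<in> set gs" for g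
    using gs that unfolding total_rec_def by blast
  then obtain s where s: "\<And>g xs. g \<in> set gs \<Longrightarrow> length xs = k \<Longrightarrow> computes (s g) xs (g xs)"
    by metis
  have "computes (Cn r (map s gs)) xs (f (map (\<lambda>g. g xs) gs))" if "length xs = k" for xs
    by (rule computes.comp[where ys = "map (\<lambda>g. g xs) gs"]) (auto intro!: r s that)
  then show ?thesis unfolding total_rec_def by blast
qed

lemma total_rec_comp1:
  assumes "total_rec 1 (\<lambda>xs. f (xs ! 0))" "total_rec k g"
  shows "total_rec k (\<lambda>xs. f (g xs))"
  using total_rec_comp[of "[g]" "\<lambda>xs. f (xs ! 0)" k] assms by simp

lemma total_rec_comp2:
  assumes "total_rec 2 (\<lambda>xs. f (xs ! 0) (xs ! 1))" "total_rec k g" "total_rec k h"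
  shows "total_rec k (\<lambda>xs. f (g xs) (h xs))"
  using total_rec_comp[of "[g, h]" "\<lambda>xs. f (xs ! 0) (xs ! 1)" k] assms by (simp add: numeral_2_eq_2)

lemma total_rec_Suc:
  assumes "total_rec k g" shows "total_rec k (\<lambda>xs. Suc (g xs))"
proof (rule total_rec_comp1[OF _ assms])
  have "computes Sc xs (Suc (xs ! 0))" if "length xs = 1" for xs
    using that computes.succ[of "xs ! 0"] by (cases xs) auto
  then show "total_rec 1 (\<lambda>xs. Suc (xs ! 0))" unfolding total_rec_def by blast
qed

lemma total_rec_const: "total_rec k (\<lambda>xs. c)"
  by (induction c) (auto intro: total_rec_zero total_rec_Suc)

lemma total_rec_prim:
  assumes f: "total_rec k f" and g: "total_rec (Suc (Suc k)) g"
  shows "total_rec (Suc k) (\<lambda>xs. rec_nat (f (tl xs)) (\<lambda>m r. g (m # r # tl xs)) (hd xs))"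
proof -
  obtain r s where r: "\<And>xs. length xs = k \<Longrightarrow> computes r xs (f xs)"
    and s: "\<And>xs. length xs = Suc (Suc k) \<Longrightarrow> computes s xs (g xs)"
    using f g unfolding total_rec_def by blast
  have "computes (Pr r s) (m # xs) (rec_nat (f xs) (\<lambda>m r. g (m # r # xs)) m)"
    if "length xs = k" for m xs
  proof (induction m)
    case 0
    show ?case by (simp add: computes.prim_0 r that)
  next
    case (Suc m)
    have "computes s (m # rec_nat (f xs) (\<lambda>m r. g (m # r # xs)) m # xs)
      (g (m # rec_nat (f xs) (\<lambda>m r. g (m # r # xs)) m # xs))"
      using that by (intro s) simp
    then show ?case using computes.prim_Suc[OF Suc] by simp
  qed
  then have "computes (Pr r s) xs (rec_nat (f (tl xs)) (\<lambda>m r. g (m # r # tl xs)) (hd xs))"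
    if "length xs = Suc k" for xs
    using that by (cases xs) auto
  then show ?thesis unfolding total_rec_def by blast
qed

text \<open>Primitive recursion consumes its first argument. Composing with projections puts
  \<open>n xs\<close> in front of the unchanged arguments, so the counter may be any recursive
  function of them.\<close>

lemma total_rec_prim1:
  assumes f: "total_rec k f" and n: "total_rec k n"
    and g: "total_rec (Suc (Suc k)) (\<lambda>xs. g (xs ! 0) (xs ! 1) (tl (tl xs)))"
  shows "total_rec k (\<lambda>xs. rec_nat (f xs) (\<lambda>m r. g m r xs) (n xs))"
proof -
  let ?gs = "n # map (\<lambda>i xs. xs ! i) [0..<k]"
  have "total_rec (length ?gs) (\<lambda>xs. rec_nat (f (tl xs)) (\<lambda>m r. g m r (tl xs)) (hd xs))"
    using total_rec_prim[OF f g] by simp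
  moreover have "\<forall>g\<in>set ?gs. total_rec k g"
    using n by (auto intro: total_rec_proj)
  ultimately have "total_rec k (\<lambda>xs. rec_nat (f (tl (map (\<lambda>g. g xs) ?gs)))
      (\<lambda>m r. g m r (tl (map (\<lambda>g. g xs) ?gs))) (hd (map (\<lambda>g. g xs) ?gs)))"
    by (rule total_rec_comp)
  then have "total_rec k (\<lambda>xs. rec_nat (f (map (\<lambda>i. xs ! i) [0..<k]))
      (\<lambda>m r. g m r (map (\<lambda>i. xs ! i) [0..<k])) (n xs))"
    by (simp add: o_def)
  then show ?thesis by (rule total_rec_cong) (auto simp: map_nth)
qed

lemma nth_tl_tl: "length xs = Suc (Suc k) \<Longrightarrow> i < k \<Longrightarrow> tl (tl xs) ! i = xs ! (Suc (Suc i))"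
  by (simp add: nth_tl)

lemma total_rec_add:
  assumes "total_rec k g" "total_rec k h" shows "total_rec k (\<lambda>xs. g xs + h xs)"
proof (rule total_rec_comp2[OF _ assms])
  have "total_rec 2 (\<lambda>xs. rec_nat (xs ! 0) (\<lambda>m r. Suc r) (xs ! 1))"
    by (intro total_rec_prim1 total_rec_proj total_rec_Suc) auto
  moreover have "rec_nat a (\<lambda>m r. Suc r) b = a + b" for a b by (induction b) auto
  ultimately show "total_rec 2 (\<lambda>xs. xs ! 0 + xs ! 1)" by simp
qed

lemma total_rec_pred:
  assumes "total_rec k g" shows "total_rec k (\<lambda>xs. g xs - 1)"
proof (rule total_rec_comp1[OF _ assms])
  have "total_rec 1 (\<lambda>xs. rec_nat 0 (\<lambda>m r. m) (xs ! 0))"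
    by (intro total_rec_prim1 total_rec_proj total_rec_zero) auto
  moreover have "rec_nat 0 (\<lambda>m r. m) b = b - 1" for b by (cases b) auto
  ultimately show "total_rec 1 (\<lambda>xs. xs ! 0 - 1)" by simp
qed

lemma total_rec_diff:
  assumes "total_rec k g" "total_rec k h" shows "total_rec k (\<lambda>xs. g xs - h xs)"
proof (rule total_rec_comp2[OF _ assms])
  have "total_rec 2 (\<lambda>xs. rec_nat (xs ! 0) (\<lambda>m r. r - 1) (xs ! 1))"
    by (intro total_rec_prim1 total_rec_proj total_rec_pred) auto
  moreover have "rec_nat a (\<lambda>m r. r - 1) b = a - b" for a b :: nat by (induction b) auto
  ultimately show "total_rec 2 (\<lambda>xs. xs ! 0 - xs ! 1)" by simp
qed

lemma total_rec_mult:
  assumes "total_rec k g" "total_rec k h" shows "total_rec k (\<lambda>xs. g xs * h xs)"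
proof (rule total_rec_comp2[OF _ assms])
  have "total_rec (Suc (Suc 2)) (\<lambda>xs. xs ! 1 + xs ! 2)"
    by (intro total_rec_add total_rec_proj) auto
  then have "total_rec (Suc (Suc 2)) (\<lambda>xs. xs ! 1 + tl (tl xs) ! 0)"
    by (rule total_rec_cong) (auto simp: nth_tl_tl numeral_2_eq_2)
  then have "total_rec 2 (\<lambda>xs. rec_nat 0 (\<lambda>m r. r + xs ! 0) (xs ! 1))"
    by (intro total_rec_prim1 total_rec_proj total_rec_zero) auto
  moreover have "rec_nat 0 (\<lambda>m r. r + a) b = a * b" for a b :: nat by (induction b) auto
  ultimately show "total_rec 2 (\<lambda>xs. xs ! 0 * xs ! 1)" by simp
qed

lemma total_rec_if:
  assumes "total_rec k c" "total_rec k f" "total_rec k g"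
  shows "total_rec k (\<lambda>xs. if c xs = 0 then f xs else g xs)"
proof -
  \<comment> \<open>With truncated subtraction, \<open>1 - c\<close> is the indicator of
    \<open>c = 0\<close>, and \<open>1 - (1 - c)\<close> that of \<open>c > 0\<close>.\<close>
  have "total_rec k (\<lambda>xs. f xs * (1 - c xs) + g xs * (1 - (1 - c xs)))"
    by (intro total_rec_add total_rec_mult total_rec_diff total_rec_const assms)
  then show ?thesis by (rule total_rec_cong) auto
qed

lemma total_rec_triangle:
  assumes "total_rec k g" shows "total_rec k (\<lambda>xs. triangle (g xs))"
proof (rule total_rec_comp1[OF _ assms])
  have "total_rec 1 (\<lambda>xs. rec_nat 0 (\<lambda>m r. r + Suc m) (xs ! 0))"
    by (intro total_rec_prim1 total_rec_proj total_rec_zero total_rec_add total_rec_Suc) auto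
  moreover have "rec_nat 0 (\<lambda>m r. r + Suc m) b = triangle b" for b by (induction b) auto
  ultimately show "total_rec 1 (\<lambda>xs. triangle (xs ! 0))" by simp
qed

lemma total_rec_prod_encode:
  assumes "total_rec k g" "total_rec k h" shows "total_rec k (\<lambda>xs. prod_encode (g xs, h xs))"
proof -
  have "total_rec k (\<lambda>xs. triangle (g xs + h xs) + g xs)"
    by (intro total_rec_add total_rec_triangle assms)
  then show ?thesis by (simp add: prod_encode_def)
qed

text \<open>The sum of the two components of \<^term>\<open>prod_decode n\<close>.\<close>

definition triangle_root :: "nat \<Rightarrow> nat" where
  "triangle_root n = rec_nat 0 (\<lambda>m r. if triangle (Suc r) - Suc m = 0 then Suc r else r) n"

lemma triangle_root_bounds:
  "triangle (triangle_root n) \<le> n \<and> n < triangle (Suc (triangle_root n))"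
  by (induction n) (auto simp: triangle_root_def)

text \<open>\<open>prod_encode (a, b)\<close> is \<open>triangle (a + b) + a\<close>, so the largest
  triangular number not exceeding \<open>n\<close> determines \<open>a + b\<close>, and the
  remainder is \<open>a\<close>.\<close>

lemma prod_decode_triangle_root:
  "prod_decode n = (n - triangle (triangle_root n), triangle_root n - (n - triangle (triangle_root n)))"
proof -
  let ?r = "triangle_root n" let ?a = "n - triangle ?r"
  have "?a \<le> ?r" "n = triangle ?r + ?a" using triangle_root_bounds[of n] by auto
  then have "prod_encode (?a, ?r - ?a) = n" by (simp add: prod_encode_def)
  then show ?thesis by (metis prod_encode_inverse)
qed

lemma total_rec_triangle_root:
  assumes "total_rec k g" shows "total_rec k (\<lambda>xs. triangle_root (g xs))"
  by (rule total_rec_comp1[OF _ assms], unfold triangle_root_def)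
    (intro total_rec_prim1 total_rec_proj total_rec_zero total_rec_if total_rec_diff
      total_rec_triangle total_rec_Suc; simp)

lemma total_rec_fst: "total_rec k g \<Longrightarrow> total_rec k (\<lambda>xs. fst (prod_decode (g xs)))"
  by (simp only: prod_decode_triangle_root fst_conv)
    (intro total_rec_diff total_rec_triangle total_rec_triangle_root)

lemma total_rec_snd: "total_rec k g \<Longrightarrow> total_rec k (\<lambda>xs. snd (prod_decode (g xs)))"
  by (simp only: prod_decode_triangle_root snd_conv)
    (intro total_rec_diff total_rec_triangle total_rec_triangle_root)

subsection \<open>Computable functions on encoded types\<close>

text \<open>On vectors of expressions and on the output lists these codes agree with those in the
  statement of the theorem, so no translation between codings is required.\<close>

class encoded =
  fixes enc :: "'a \<Rightarrow> nat"
  assumes inj_enc: "inj enc"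
begin

lemma enc_eq_iff [simp]: "enc x = enc y \<longleftrightarrow> x = y"
  using inj_enc by (auto dest: injD)

end

instantiation nat :: encoded begin
definition "enc (n :: nat) = n"
instance by standard (rule injI, simp add: enc_nat_def)
end

instantiation bool :: encoded begin
definition "enc (b :: bool) = (if b then 1 else 0 :: nat)"
instance by standard (rule injI, simp add: enc_bool_def split: if_splits)
end

instantiation prod :: (encoded, encoded) encoded begin
definition "enc (x :: 'a \<times> 'b) = prod_encode (enc (fst x), enc (snd x))"
instance by standard (rule injI, simp add: enc_prod_def prod_eq_iff)
end

instantiation list :: (encoded) encoded begin
definition "enc (xs :: 'a list) = list_encode (map enc xs)"
instance
proof
  show "inj (enc :: 'a list \<Rightarrow> nat)"
    by (rule injI) (simp add: enc_list_def list_encode_eq inj_enc inj_map_eq_map)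
qed
end

instantiation fexpr :: encoded begin
definition "enc (s :: fexpr) = fcode s"
instance by standard (rule injI, simp add: enc_fexpr_def fcode_eq_iff)
end

lemma enc_Nil [simp]: "enc [] = 0"
  and enc_Cons: "enc (x # xs) = Suc (prod_encode (enc x, enc xs))"
  by (simp_all add: enc_list_def)

lemma map_enc_nat [simp]: "map enc (l :: nat list) = l"
  by (induction l) (simp_all add: enc_nat_def)

text \<open>The numerical function is total, also on numbers that code nothing, so composition
  carries no side conditions. Several arguments are passed as nested pairs.\<close>

definition computable :: "('a::encoded \<Rightarrow> 'b::encoded) \<Rightarrow> bool" where
  "computable f \<longleftrightarrow> (\<exists>g. total_rec 1 (\<lambda>xs. g (xs ! 0)) \<and> (\<forall>x. g (enc x) = enc (f x)))"

named_theorems comp_intro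

lemma computableI:
  "total_rec 1 (\<lambda>xs. g (xs ! 0)) \<Longrightarrow> (\<And>x. g (enc x) = enc (f x)) \<Longrightarrow> computable f"
  unfolding computable_def by blast

lemma computable_id [comp_intro]: "computable (\<lambda>x. x)"
  by (rule computableI[where g = "\<lambda>x. x"]) (auto intro: total_rec_proj)

lemma computable_const [comp_intro]: "computable (\<lambda>x. c)"
  by (rule computableI[where g = "\<lambda>x. enc c"]) (auto intro: total_rec_const)

lemma computable_comp:
  assumes "computable f" "computable g" shows "computable (\<lambda>x. f (g x))"
proof -
  obtain f' g' where "total_rec 1 (\<lambda>xs. f' (xs ! 0))" "\<And>x. f' (enc x) = enc (f x)"
    "total_rec 1 (\<lambda>xs. g' (xs ! 0))" "\<And>x. g' (enc x) = enc (g x)"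
    using assms unfolding computable_def by blast
  then show ?thesis
    by (intro computableI[where g = "\<lambda>x. f' (g' x)"]) (auto intro: total_rec_comp1)
qed

lemma computable_lift1:
  assumes "\<And>k u. total_rec k u \<Longrightarrow> total_rec k (\<lambda>xs. h (u xs))"
    and "computable f" and "\<And>x. h (enc x) = enc (h' x)"
  shows "computable (\<lambda>x. h' (f x))"
proof -
  obtain f' where "total_rec 1 (\<lambda>xs. f' (xs ! 0))" "\<And>x. f' (enc x) = enc (f x)"
    using assms unfolding computable_def by blast
  then show ?thesis
    by (intro computableI[where g = "\<lambda>x. h (f' x)"]) (auto intro: assms)
qed

lemma computable_lift2:
  assumes "\<And>k u v. total_rec k u \<Longrightarrow> total_rec k v \<Longrightarrow> total_rec k (\<lambda>xs. h (u xs) (v xs))"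
    and "computable f" "computable g" and "\<And>x y. h (enc x) (enc y) = enc (h' x y)"
  shows "computable (\<lambda>x. h' (f x) (g x))"
proof -
  obtain f' g' where "total_rec 1 (\<lambda>xs. f' (xs ! 0))" "\<And>x. f' (enc x) = enc (f x)"
    "total_rec 1 (\<lambda>xs. g' (xs ! 0))" "\<And>x. g' (enc x) = enc (g x)"
    using assms unfolding computable_def by blast
  then show ?thesis
    by (intro computableI[where g = "\<lambda>x. h (f' x) (g' x)"]) (auto intro: assms)
qed

lemma computable_Pair [comp_intro]:
  "computable f \<Longrightarrow> computable g \<Longrightarrow> computable (\<lambda>x. (f x, g x))"
  by (rule computable_lift2[OF total_rec_prod_encode]) (auto simp: enc_prod_def)

lemma computable_fst [comp_intro]: "computable f \<Longrightarrow> computable (\<lambda>x. fst (f x))"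
  by (rule computable_lift1[OF total_rec_fst]) (auto simp: enc_prod_def)

lemma computable_snd [comp_intro]: "computable f \<Longrightarrow> computable (\<lambda>x. snd (f x))"
  by (rule computable_lift1[OF total_rec_snd]) (auto simp: enc_prod_def)

lemma computable_app2:
  assumes "computable (\<lambda>p. f (fst p) (snd p))" "computable a" "computable b"
  shows "computable (\<lambda>x. f (a x) (b x))"
  using computable_comp[OF assms(1) computable_Pair[OF assms(2,3)]] by simp

lemma computable_app3:
  assumes "computable (\<lambda>p. f (fst p) (fst (snd p)) (snd (snd p)))"
    "computable a" "computable b" "computable c"
  shows "computable (\<lambda>x. f (a x) (b x) (c x))"
  using computable_comp[OF assms(1) computable_Pair[OF assms(2) computable_Pair[OF assms(3,4)]]]
  by simp

lemma computable_enc [comp_intro]: "computable f \<Longrightarrow> computable (\<lambda>x. enc (f x))"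
  by (rule computable_lift1[where h = "\<lambda>x. x"]) (auto simp: enc_nat_def)

lemma computable_Suc [comp_intro]: "computable f \<Longrightarrow> computable (\<lambda>x. Suc (f x))"
  by (rule computable_lift1[OF total_rec_Suc]) (auto simp: enc_nat_def)

lemma computable_add [comp_intro]:
  "computable f \<Longrightarrow> computable g \<Longrightarrow> computable (\<lambda>x. f x + g x :: nat)"
  by (rule computable_lift2[OF total_rec_add]) (auto simp: enc_nat_def)

lemma computable_diff [comp_intro]:
  "computable f \<Longrightarrow> computable g \<Longrightarrow> computable (\<lambda>x. f x - g x :: nat)"
  by (rule computable_lift2[OF total_rec_diff]) (auto simp: enc_nat_def)

lemma computable_mult [comp_intro]:
  "computable f \<Longrightarrow> computable g \<Longrightarrow> computable (\<lambda>x. f x * g x :: nat)"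
  by (rule computable_lift2[OF total_rec_mult]) (auto simp: enc_nat_def)

lemma computable_less [comp_intro]:
  "computable f \<Longrightarrow> computable g \<Longrightarrow> computable (\<lambda>x. f x < (g x :: nat))"
  by (rule computable_lift2[where h = "\<lambda>m n. 1 - (Suc m - n)"])
    (auto simp: enc_nat_def enc_bool_def intro!: total_rec_diff total_rec_const total_rec_Suc)

lemma computable_eq [comp_intro]:
  fixes f g :: "'a::encoded \<Rightarrow> 'b::encoded"
  assumes "computable f" "computable g" shows "computable (\<lambda>x. f x = g x)"
proof -
  have "1 - ((enc x - enc y) + (enc y - enc x)) = enc (x = y)" for x y :: 'b
  proof (cases "x = y")
    case False
    then have "1 \<le> (enc x - enc y) + (enc y - enc x)" using enc_eq_iff[of x y] by arith
    then show ?thesis using False by (simp add: enc_bool_def)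
  qed (simp add: enc_bool_def)
  then show ?thesis
    by (intro computable_lift2[where h = "\<lambda>m n. 1 - ((m - n) + (n - m))", OF _ assms])
      (auto intro!: total_rec_diff total_rec_const total_rec_add)
qed

lemma computable_If [comp_intro]:
  assumes "computable P" "computable f" "computable g"
  shows "computable (\<lambda>x. if P x then f x else g x)"
proof -
  obtain P' f' g' where "total_rec 1 (\<lambda>xs. P' (xs ! 0))" "\<And>x. P' (enc x) = enc (P x)"
    "total_rec 1 (\<lambda>xs. f' (xs ! 0))" "\<And>x. f' (enc x) = enc (f x)"
    "total_rec 1 (\<lambda>xs. g' (xs ! 0))" "\<And>x. g' (enc x) = enc (g x)"
    using assms unfolding computable_def by metis
  then show ?thesis
    by (intro computableI[where g = "\<lambda>x. if P' x = 0 then g' x else f' x"])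
      (auto intro: total_rec_if simp: enc_bool_def)
qed

lemma computable_not [comp_intro]:
  assumes "computable P" shows "computable (\<lambda>x. \<not> P x)"
proof -
  have "computable (\<lambda>x. if P x then False else True)" by (intro comp_intro assms)
  moreover have "(if P x then False else True) = (\<not> P x)" for x by simp
  ultimately show ?thesis by simp
qed

lemma computable_conj [comp_intro]:
  assumes "computable P" "computable Q" shows "computable (\<lambda>x. P x \<and> Q x)"
proof -
  have "computable (\<lambda>x. if P x then Q x else False)" by (intro comp_intro assms)
  moreover have "(if P x then Q x else False) = (P x \<and> Q x)" for x by simp
  ultimately show ?thesis by simp
qed

lemma computable_rec_nat [comp_intro]:
  assumes n: "computable n" and a: "computable a"
    and b: "computable (\<lambda>p. b (fst p) (fst (snd p)) (snd (snd p)))"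
  shows "computable (\<lambda>x. rec_nat (a x) (b x) (n x))"
proof -
  obtain n' a' b' where n': "total_rec 1 (\<lambda>xs. n' (xs ! 0))" "\<And>x. n' (enc x) = enc (n x)"
    and a': "total_rec 1 (\<lambda>xs. a' (xs ! 0))" "\<And>x. a' (enc x) = enc (a x)"
    and b': "total_rec 1 (\<lambda>xs. b' (xs ! 0))"
      "\<And>p. b' (enc p) = enc (b (fst p) (fst (snd p)) (snd (snd p)))"
    using assms unfolding computable_def by metis
  let ?g = "\<lambda>x. rec_nat (a' x) (\<lambda>m r. b' (prod_encode (x, prod_encode (m, r)))) (n' x)"
  have "total_rec (Suc (Suc 1)) (\<lambda>xs. b' (prod_encode (xs ! 2, prod_encode (xs ! 0, xs ! 1))))"
    by (rule total_rec_comp1[OF b'(1)]) (intro total_rec_prod_encode total_rec_proj; simp)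
  then have "total_rec (Suc (Suc 1))
      (\<lambda>xs. b' (prod_encode (tl (tl xs) ! 0, prod_encode (xs ! 0, xs ! 1))))"
    by (rule total_rec_cong) (auto simp: nth_tl_tl numeral_2_eq_2)
  then have "total_rec 1 (\<lambda>xs. ?g (xs ! 0))"
    by (intro total_rec_prim1 n' a') auto
  moreover have "rec_nat (enc (a x)) (\<lambda>m r. b' (prod_encode (enc x, prod_encode (m, r)))) m
     = enc (rec_nat (a x) (b x) m)" for x m
  proof (induction m)
    case (Suc m)
    show ?case using b'(2)[of "(x, m, rec_nat (a x) (b x) m)"]
      by (simp add: enc_prod_def enc_nat_def Suc)
  qed auto
  ultimately show ?thesis
    by (intro computableI[where g = ?g]) (auto simp: n' a' enc_nat_def)
qed

lemma computable_funpow [comp_intro]: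
  fixes f :: "'a::encoded \<Rightarrow> 'b::encoded \<Rightarrow> 'b"
  assumes n: "computable n" and a: "computable a" and f: "computable (\<lambda>p. f (fst p) (snd p))"
  shows "computable (\<lambda>x. (f x ^^ n x) (a x))"
proof -
  have "computable (\<lambda>x. rec_nat (a x) (\<lambda>_ r. f x r) (n x))"
    by (intro comp_intro n a computable_app2[OF f])
  moreover have "rec_nat (a x) (\<lambda>_ r. f x r) m = (f x ^^ m) (a x)" for x m by (induction m) auto
  ultimately show ?thesis by simp
qed

lemma computable_power [comp_intro]:
  assumes "computable f" "computable g" shows "computable (\<lambda>x. (f x :: nat) ^ g x)"
proof -
  have "computable (\<lambda>x. rec_nat 1 (\<lambda>_ r. f x * r) (g x))"
    by (intro comp_intro assms computable_comp[OF assms(1)])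
  moreover have "rec_nat 1 (\<lambda>_ r. a * r) n = a ^ n" for a n :: nat by (induction n) auto
  ultimately show ?thesis by simp
qed

lemma computable_fact [comp_intro]:
  assumes "computable f" shows "computable (\<lambda>x. fact (f x) :: nat)"
proof -
  have "computable (\<lambda>x. rec_nat 1 (\<lambda>m r. Suc m * r) (f x) :: nat)"
    by (intro comp_intro assms)
  moreover have "rec_nat 1 (\<lambda>m r. Suc m * r) n = fact n" for n :: nat
    by (induction n) (simp_all add: fact_Suc)
  ultimately show ?thesis by simp
qed

lemma computable_divmod:
  assumes "computable f" "computable g" shows "computable (\<lambda>x. (f x div g x, f x mod g x :: nat))"
proof -
  \<comment> \<open>The remainder counts up and is reset at \<open>n\<close>. For
    \<open>n = 0\<close> it is never reset, in accordance with \<open>m div 0 = 0\<close> and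
    \<open>m mod 0 = m\<close>.\<close>
  let ?s = "\<lambda>n r. if Suc (snd r) = n then (Suc (fst r), 0) else (fst r, Suc (snd r))"
  have "computable (\<lambda>x. rec_nat (0, 0) (\<lambda>_. ?s (g x)) (f x))"
    by (intro comp_intro assms computable_comp[OF assms(2)])
  moreover have "rec_nat (0, 0) (\<lambda>_. ?s n) m = (m div n, m mod n)" for m n :: nat
    by (induction m) (auto simp: div_Suc mod_Suc)
  ultimately show ?thesis by simp
qed

lemma computable_div [comp_intro]:
  "computable f \<Longrightarrow> computable g \<Longrightarrow> computable (\<lambda>x. f x div g x :: nat)"
  using computable_fst[OF computable_divmod] by fastforce

lemma computable_mod [comp_intro]:
  "computable f \<Longrightarrow> computable g \<Longrightarrow> computable (\<lambda>x. f x mod g x :: nat)"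
  using computable_snd[OF computable_divmod] by fastforce

subsection \<open>Computable functions on lists\<close>

lemma computable_Cons [comp_intro]:
  "computable f \<Longrightarrow> computable g \<Longrightarrow> computable (\<lambda>x. f x # g x)"
  by (rule computable_lift2[where h = "\<lambda>m n. Suc (prod_encode (m, n))"])
    (auto simp: enc_Cons intro: total_rec_Suc total_rec_prod_encode)

lemma computable_case_list [comp_intro]:
  assumes l: "computable l" and a: "computable a"
    and b: "computable (\<lambda>p. b (fst p) (fst (snd p)) (snd (snd p)))"
  shows "computable (\<lambda>x. case l x of [] \<Rightarrow> a x | h # t \<Rightarrow> b x h t)"
proof -
  obtain l' a' b' where l': "total_rec 1 (\<lambda>xs. l' (xs ! 0))" "\<And>x. l' (enc x) = enc (l x)"
    and a': "total_rec 1 (\<lambda>xs. a' (xs ! 0))" "\<And>x. a' (enc x) = enc (a x)"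
    and b': "total_rec 1 (\<lambda>xs. b' (xs ! 0))"
      "\<And>p. b' (enc p) = enc (b (fst p) (fst (snd p)) (snd (snd p)))"
    using assms unfolding computable_def by metis
  let ?g = "\<lambda>x. if l' x = 0 then a' x else b' (prod_encode (x, l' x - 1))"
  have "total_rec 1 (\<lambda>xs. ?g (xs ! 0))"
    by (intro total_rec_if l' a' total_rec_comp1[OF b'(1)] total_rec_prod_encode total_rec_diff
        total_rec_const total_rec_proj) simp
  moreover have "?g (enc x) = enc (case l x of [] \<Rightarrow> a x | h # t \<Rightarrow> b x h t)" for x
  proof (cases "l x")
    case (Cons h t)
    then show ?thesis using b'(2)[of "(x, h, t)"] by (simp add: l' enc_Cons enc_prod_def)
  qed (simp add: l' a')
  ultimately show ?thesis by (intro computableI[where g = ?g])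
qed

text \<open>The state is the unread rest of the list with the accumulator. It is stationary once the
  list is exhausted, so a fold may be iterated too often; the code of the list, which bounds its
  length, serves as the number of rounds.\<close>

definition foldl_step :: "('b \<Rightarrow> 'a \<Rightarrow> 'b) \<Rightarrow> 'a list \<times> 'b \<Rightarrow> 'a list \<times> 'b" where
  "foldl_step f s = (case fst s of [] \<Rightarrow> s | h # t \<Rightarrow> (t, f (snd s) h))"

lemma foldl_step_funpow: "length l \<le> n \<Longrightarrow> (foldl_step f ^^ n) (l, a) = ([], foldl f a l)"
proof (induction n arbitrary: l a)
  case (Suc n)
  then show ?case
    by (cases l) (auto simp: foldl_step_def funpow_swap1 simp del: funpow.simps
        simp add: funpow_Suc_right)
qed simp

lemma length_le_enc: "length (l :: 'a::encoded list) \<le> enc l"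
proof (induction l)
  case (Cons x l)
  then show ?case using le_prod_encode_2[of "enc l" "enc x"] by (simp add: enc_Cons)
qed simp

lemma computable_foldl [comp_intro]:
  fixes l :: "'a::encoded \<Rightarrow> 'b::encoded list"
  assumes l: "computable l" and a: "computable a"
    and f: "computable (\<lambda>p. f (fst p) (fst (snd p)) (snd (snd p)))"
  shows "computable (\<lambda>x. foldl (f x) (a x) (l x))"
proof -
  have "computable (\<lambda>x. snd ((foldl_step (f x) ^^ enc (l x)) (l x, a x)))"
    unfolding foldl_step_def
    by (intro comp_intro l a computable_app3[OF f])
  then show ?thesis by (simp add: foldl_step_funpow length_le_enc)
qed

lemma computable_rev [comp_intro]:
  assumes "computable l" shows "computable (\<lambda>x. rev (l x))"
proof -
  have "computable (\<lambda>x. foldl (\<lambda>acc h. h # acc) [] (l x))" by (intro comp_intro assms)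
  moreover have "foldl (\<lambda>acc h. h # acc) ys xs = rev xs @ ys" for xs ys :: "'b list"
    by (induction xs arbitrary: ys) auto
  ultimately show ?thesis by simp
qed

lemma computable_foldr [comp_intro]:
  assumes "computable l" "computable a"
    and f: "computable (\<lambda>p. f (fst p) (fst (snd p)) (snd (snd p)))"
  shows "computable (\<lambda>x. foldr (f x) (l x) (a x))"
  unfolding foldr_conv_foldl by (intro comp_intro assms computable_app3[OF f])

lemma computable_append [comp_intro]:
  assumes "computable l" "computable m" shows "computable (\<lambda>x. l x @ m x)"
proof -
  have "computable (\<lambda>x. foldr (\<lambda>h t. h # t) (l x) (m x))" by (intro comp_intro assms)
  moreover have "foldr (\<lambda>h t. h # t) xs ys = xs @ ys" for xs ys :: "'b list"
    by (induction xs) auto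
  ultimately show ?thesis by simp
qed

lemma computable_map [comp_intro]:
  fixes f :: "'a::encoded \<Rightarrow> 'b::encoded \<Rightarrow> 'c::encoded"
  assumes "computable l" and f: "computable (\<lambda>p. f (fst p) (snd p))"
  shows "computable (\<lambda>x. map (f x) (l x))"
proof -
  have "computable (\<lambda>x. foldr (\<lambda>h t. f x h # t) (l x) [])"
    by (intro comp_intro assms computable_app2[OF f])
  moreover have "foldr (\<lambda>h t. g h # t) xs [] = map g xs" for xs and g :: "'b \<Rightarrow> 'c"
    by (induction xs) auto
  ultimately show ?thesis by simp
qed

lemma computable_filter [comp_intro]:
  fixes f :: "'a::encoded \<Rightarrow> 'b::encoded \<Rightarrow> bool"
  assumes "computable l" and f: "computable (\<lambda>p. f (fst p) (snd p))"
  shows "computable (\<lambda>x. filter (f x) (l x))"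
proof -
  have "computable (\<lambda>x. foldr (\<lambda>h t. if f x h then h # t else t) (l x) [])"
    by (intro comp_intro assms computable_app2[OF f])
  moreover have "foldr (\<lambda>h t. if g h then h # t else t) xs [] = filter g xs" for xs and g :: "'b \<Rightarrow> bool"
    by (induction xs) auto
  ultimately show ?thesis by simp
qed

lemma computable_concat [comp_intro]:
  assumes "computable l" shows "computable (\<lambda>x. concat (l x))"
  unfolding concat_conv_foldr by (intro comp_intro assms)

lemma computable_list_all [comp_intro]:
  fixes f :: "'a::encoded \<Rightarrow> 'b::encoded \<Rightarrow> bool"
  assumes "computable l" and f: "computable (\<lambda>p. f (fst p) (snd p))"
  shows "computable (\<lambda>x. list_all (f x) (l x))"
proof -
  have "computable (\<lambda>x. foldr (\<lambda>h t. f x h \<and> t) (l x) True)"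
    by (intro comp_intro assms computable_app2[OF f])
  moreover have "foldr (\<lambda>h t. g h \<and> t) xs True = list_all g xs" for xs and g :: "'b \<Rightarrow> bool"
    by (induction xs) auto
  ultimately show ?thesis by simp
qed

lemma computable_list_ex [comp_intro]:
  assumes "computable l" and f: "computable (\<lambda>p. f (fst p) (snd p))"
  shows "computable (\<lambda>x. list_ex (f x) (l x))"
proof -
  have "computable (\<lambda>x. \<not> list_all (\<lambda>h. \<not> f x h) (l x))"
    by (intro comp_intro assms computable_app2[OF f])
  then show ?thesis by (simp add: list_all_iff list_ex_iff)
qed

lemma computable_length [comp_intro]:
  assumes "computable l" shows "computable (\<lambda>x. length (l x))"
proof -
  have "computable (\<lambda>x. foldr (\<lambda>_ n. Suc n) (l x) 0)" by (intro comp_intro assms)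
  moreover have "foldr (\<lambda>_ n. Suc n) xs 0 = length xs" for xs :: "'b list" by (induction xs) auto
  ultimately show ?thesis by simp
qed

lemma computable_tl [comp_intro]: "computable l \<Longrightarrow> computable (\<lambda>x. tl (l x))"
  unfolding tl_def by (intro comp_intro)

lemma computable_upt [comp_intro]:
  assumes "computable n" shows "computable (\<lambda>x. [0..<n x])"
proof -
  have "computable (\<lambda>x. rec_nat [] (\<lambda>m r. r @ [m]) (n x))" by (intro comp_intro assms)
  moreover have "rec_nat [] (\<lambda>m r. r @ [m]) k = [0..<k]" for k by (induction k) auto
  ultimately show ?thesis by simp
qed

text \<open>A total indexing function. The default is 0 for exponents and 1 for coordinates, so
  vectors of any length may be read as exponent vectors or multipliers.\<close>

definition nth_default :: "'a \<Rightarrow> 'a list \<Rightarrow> nat \<Rightarrow> 'a" where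
  "nth_default d l i = (if i < length l then l ! i else d)"

lemma nth_default_eq: "i < length l \<Longrightarrow> nth_default d l i = l ! i"
  by (simp add: nth_default_def)

lemma computable_nth_default [comp_intro]:
  assumes "computable d" "computable l" "computable i"
  shows "computable (\<lambda>x. nth_default (d x) (l x) (i x))"
proof -
  have "computable (\<lambda>x. case (tl ^^ i x) (l x) of [] \<Rightarrow> d x | h # t \<Rightarrow> h)"
    by (intro comp_intro assms computable_comp[OF assms(1)])
  moreover have "(case (tl ^^ i) l of [] \<Rightarrow> d | h # t \<Rightarrow> h) = nth_default d l i"
    for d and l :: "'b list" and i
    by (induction i arbitrary: l)
      (auto simp: nth_default_def nth_tl funpow_Suc_right simp del: funpow.simps split: list.split)
  ultimately show ?thesis by simp
qed

lemma computable_n_lists [comp_intro]: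
  assumes "computable n" "computable l" shows "computable (\<lambda>x. List.n_lists (n x) (l x))"
proof -
  have "computable (\<lambda>x. rec_nat [[]] (\<lambda>_ r. concat (map (\<lambda>ys. map (\<lambda>y. y # ys) (l x)) r)) (n x))"
    by (intro comp_intro assms computable_comp[OF assms(2)])
  moreover have "rec_nat [[]] (\<lambda>_ r. concat (map (\<lambda>ys. map (\<lambda>y. y # ys) xs) r)) k = List.n_lists k xs"
    for k and xs :: "'b list" by (induction k) auto
  ultimately show ?thesis by simp
qed

text \<open>Finite tables can be built into a program. Data that depend on the field alone enter the
  algorithm in this way, without having to be computed.\<close>

lemma computable_finite_support:
  fixes f :: "'a::encoded \<Rightarrow> 'b::encoded"
  assumes "finite {x. f x \<noteq> d}" shows "computable f"
proof -
  have "computable (\<lambda>x. if x \<in> A then f x else d)" if "finite A" for A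
    using that
  proof induction
    case (insert a A)
    have "computable (\<lambda>x. if x = a then f a else if x \<in> A then f x else d)"
      by (intro comp_intro insert.IH)
    then show ?case by (rule back_subst[of computable]) (auto simp: fun_eq_iff)
  qed (auto intro: comp_intro)
  from this[OF assms] show ?thesis by (rule back_subst[of computable]) (auto simp: fun_eq_iff)
qed

lemma computable_finite_set:
  assumes "finite A" "computable f" shows "computable (\<lambda>x. f x \<in> A)"
proof (rule computable_comp[OF _ assms(2)])
  show "computable (\<lambda>y. y \<in> A)"
    by (rule computable_finite_support[where d = False]) (simp add: assms)
qed

subsection \<open>Recursion on field expressions, and unbounded search\<close>

lemma computable_list_decode [comp_intro]: "computable f \<Longrightarrow> computable (\<lambda>x. list_decode (f x))"
  by (rule computable_lift1[where h = "\<lambda>x. x"]) (auto simp: enc_nat_def enc_list_def)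

lemma computable_via_list_encode:
  assumes "computable c" "\<And>x. enc (f x) = list_encode (c x)"
  shows "computable f"
proof -
  have "enc (c x) = enc (f x)" for x using assms(2) by (simp add: enc_list_def enc_nat_def)
  then show ?thesis using assms(1) unfolding computable_def by simp
qed

lemma computable_fexpr [comp_intro]:
  "computable (\<lambda>x. One)"
  "computable i \<Longrightarrow> computable (\<lambda>x. Gen (i x))"
  "computable s \<Longrightarrow> computable (\<lambda>x. Neg (s x))"
  "computable s \<Longrightarrow> computable (\<lambda>x. Inv (s x))"
  "computable s \<Longrightarrow> computable t \<Longrightarrow> computable (\<lambda>x. Add (s x) (t x))"
  "computable s \<Longrightarrow> computable t \<Longrightarrow> computable (\<lambda>x. Mul (s x) (t x))"
proof -
  show "computable (\<lambda>x. One)" by (rule computable_const)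
  show "computable (\<lambda>x. Gen (i x))" if "computable i"
    by (rule computable_via_list_encode[where c = "\<lambda>x. [0, i x]"])
      (intro comp_intro that, simp add: enc_fexpr_def)
  show "computable (\<lambda>x. Neg (s x))" if "computable s"
    by (rule computable_via_list_encode[where c = "\<lambda>x. [2, enc (s x)]"])
      (intro comp_intro that, simp add: enc_fexpr_def)
  show "computable (\<lambda>x. Inv (s x))" if "computable s"
    by (rule computable_via_list_encode[where c = "\<lambda>x. [3, enc (s x)]"])
      (intro comp_intro that, simp add: enc_fexpr_def)
  show "computable (\<lambda>x. Add (s x) (t x))" if "computable s" "computable t"
    by (rule computable_via_list_encode[where c = "\<lambda>x. [4, enc (s x), enc (t x)]"])
      (intro comp_intro that, simp add: enc_fexpr_def)
  show "computable (\<lambda>x. Mul (s x) (t x))" if "computable s" "computable t"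
    by (rule computable_via_list_encode[where c = "\<lambda>x. [5, enc (s x), enc (t x)]"])
      (intro comp_intro that, simp add: enc_fexpr_def)
qed

lemma list_encode_less: "x \<in> set l \<Longrightarrow> x < list_encode l"
proof (induction l)
  case (Cons a l)
  then show ?case
    using le_prod_encode_1[of a "list_encode l"] le_prod_encode_2[of "list_encode l" a] by auto
qed simp

text \<open>Course-of-values recursion: the table of the values at all smaller numbers is built first,
  and the code of a subterm is smaller than the code of the term.\<close>

lemma computable_fexpr_rec:
  fixes e :: "fexpr \<Rightarrow> 'c::encoded"
  assumes "\<And>i. e (Gen i) = gen i" "e One = one" "\<And>s. e (Neg s) = neg (e s)"
    "\<And>s. e (Inv s) = vin (e s)" "\<And>s t. e (Add s t) = add (e s) (e t)"
    "\<And>s t. e (Mul s t) = mul (e s) (e t)"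
    and comp: "computable gen" "computable neg" "computable vin"
    "computable (\<lambda>p. add (fst p) (snd p))" "computable (\<lambda>p. mul (fst p) (snd p))"
  shows "\<exists>F. computable F \<and> (\<forall>s. F (enc s) = e s)"
proof -
  define g where "g n t =
    (let l = list_decode n; tag = nth_default 0 l 0;
         a = nth_default one t (nth_default 0 l 1); b = nth_default one t (nth_default 0 l 2)
     in if tag = 0 then gen (nth_default 0 l 1) else if tag = 1 then one else if tag = 2 then neg a
        else if tag = 3 then vin a else if tag = 4 then add a b else mul a b)"
    for n :: nat and t :: "'c list"
  define tbl where "tbl n = rec_nat [] (\<lambda>m r. r @ [g m r]) n" for n
  define F where "F n = g n (tbl n)" for n
  have tbl: "tbl n = map F [0..<n]" for n
    by (induction n) (auto simp: tbl_def F_def)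
  have look: "nth_default one (tbl (list_encode l)) x = F x" if "x \<in> set l" for x l
    using list_encode_less[OF that] by (simp add: tbl nth_default_def)
  have "F (fcode s) = e s" for s
    by (induction s) (simp_all add: F_def[of "list_encode _"] g_def look assms
        nth_default_def[of 0] Let_def del: list_encode.simps)
  moreover have "computable F"
    unfolding F_def tbl_def g_def Let_def
    by (intro comp_intro comp(1-3)[THEN computable_comp]
        computable_app2[OF comp(4)] computable_app2[OF comp(5)])
  ultimately show ?thesis by (auto simp: enc_fexpr_def)
qed

text \<open>The search runs through numbers, so the expressions that it tries have to be recovered
  from their codes; the recursion rebuilds the term.\<close>

lemma computable_fexpr_decode: "\<exists>F. computable F \<and> (\<forall>s :: fexpr. F (enc s) = s)"
  by (rule computable_fexpr_rec[where e = "\<lambda>s. s"]) (rule refl comp_intro)+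

text \<open>Minimisation finds the least \<open>n\<close> with \<open>P x n\<close>. The program is
  only known to halt where such an \<open>n\<close> exists, hence the formulation with
  \<open>computes\<close> instead of \<open>computable\<close>.\<close>

lemma computable_search:
  fixes P :: "'a::encoded \<Rightarrow> nat \<Rightarrow> bool" and f :: "'a \<Rightarrow> nat \<Rightarrow> 'b::encoded"
  assumes P: "computable (\<lambda>p. P (fst p) (snd p))" and f: "computable (\<lambda>p. f (fst p) (snd p))"
  shows "\<exists>r. \<forall>x. (\<exists>n. P x n) \<longrightarrow> (\<exists>m. P x m \<and> computes r [enc x] (enc (f x m)))"
proof -
  obtain P' f' where P': "total_rec 1 (\<lambda>xs. P' (xs ! 0))" "\<And>p. P' (enc p) = enc (P (fst p) (snd p))"
    and f': "total_rec 1 (\<lambda>xs. f' (xs ! 0))" "\<And>p. f' (enc p) = enc (f (fst p) (snd p))"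
    using assms unfolding computable_def by metis
  have "total_rec 2 (\<lambda>xs. 1 - P' (prod_encode (xs ! 1, xs ! 0)))"
    by (intro total_rec_diff total_rec_const total_rec_comp1[OF P'(1)] total_rec_prod_encode
        total_rec_proj) auto
  then obtain r where r: "\<And>xs. length xs = 2 \<Longrightarrow>
      computes r xs (1 - P' (prod_encode (xs ! 1, xs ! 0)))"
    unfolding total_rec_def by blast
  have "total_rec 2 (\<lambda>xs. f' (prod_encode (xs ! 0, xs ! 1)))"
    by (intro total_rec_comp1[OF f'(1)] total_rec_prod_encode total_rec_proj) auto
  then obtain s where s: "\<And>xs. length xs = 2 \<Longrightarrow>
      computes s xs (f' (prod_encode (xs ! 0, xs ! 1)))"
    unfolding total_rec_def by blast
  have "\<exists>m. P x m \<and> computes (Cn s [Pj 0, Mn r]) [enc x] (enc (f x m))" if "\<exists>n. P x n" for x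
  proof -
    define m where "m = (LEAST n. P x n)"
    have m: "P x m" unfolding m_def using that by (rule LeastI_ex)
    have less: "\<not> P x k" if "k < m" for k
      using that unfolding m_def by (rule not_less_Least)
    have val: "P' (prod_encode (enc x, k)) = (if P x k then 1 else 0)" for k
      using P'(2)[of "(x, k)"] by (simp add: enc_prod_def enc_nat_def enc_bool_def)
    have "computes (Mn r) [enc x] m"
    proof (rule computes.mu)
      show "computes r [m, enc x] 0" using r[of "[m, enc x]"] by (simp add: val m)
      show "\<forall>k<m. \<exists>u. computes r [k, enc x] (Suc u)"
      proof (intro allI impI exI)
        fix k assume "k < m"
        then show "computes r [k, enc x] (Suc 0)"
          using r[of "[k, enc x]"] less[of k] by (simp add: val)
      qed
    qed
    moreover have "computes (Pj 0) [enc x] (enc x)" using computes.proj[of 0 "[enc x]"] by simp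
    moreover have "computes s [enc x, m] (enc (f x m))"
      using s[of "[enc x, m]"] f'(2)[of "(x, m)"] by (simp add: enc_prod_def enc_nat_def)
    ultimately have "computes (Cn s [Pj 0, Mn r]) [enc x] (enc (f x m))"
      by (intro computes.comp[where ys = "[enc x, m]"]) (auto simp: less_Suc_eq)
    then show ?thesis using m by blast
  qed
  then show ?thesis by blast
qed

lemma computes_triple:
  "\<exists>s. \<forall>(a::'a::encoded) (b::'b::encoded) (c::'c::encoded) y.
     computes r [enc (a, b, c)] y \<longrightarrow> computes s [enc a, enc b, enc c] y"
proof -
  have "total_rec 3 (\<lambda>xs. prod_encode (xs ! 0, prod_encode (xs ! 1, xs ! 2)))"
    by (intro total_rec_prod_encode total_rec_proj) auto
  then obtain t where t: "\<And>xs. length xs = 3 \<Longrightarrow>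
      computes t xs (prod_encode (xs ! 0, prod_encode (xs ! 1, xs ! 2)))"
    unfolding total_rec_def by blast
  have "computes (Cn r [t]) [enc a, enc b, enc c] y" if "computes r [enc (a, b, c)] y"
    for a :: 'a and b :: 'b and c :: 'c and y
    by (rule computes.comp[where ys = "[enc (a, b, c)]"])
      (use that t[of "[enc a, enc b, enc c]"] in \<open>auto simp: enc_prod_def\<close>)
  then show ?thesis by blast
qed

subsection \<open>The field generated by \<open>ys\<close> as a vector space over its \<open>Q\<close>-th powers\<close>

definition gen_field :: "'a::field list \<Rightarrow> 'a set" where
  "gen_field ys = range (fval ys)"

lemma gen_field_one: "1 \<in> gen_field ys"
  unfolding gen_field_def by (rule range_eqI[where x = One]) simp

lemma gen_field_add: "x \<in> gen_field ys \<Longrightarrow> y \<in> gen_field ys \<Longrightarrow> x + y \<in> gen_field ys"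
  unfolding gen_field_def by (auto intro: range_eqI[where x = "Add _ _"])

lemma gen_field_mult: "x \<in> gen_field ys \<Longrightarrow> y \<in> gen_field ys \<Longrightarrow> x * y \<in> gen_field ys"
  unfolding gen_field_def by (auto intro: range_eqI[where x = "Mul _ _"])

lemma gen_field_uminus: "x \<in> gen_field ys \<Longrightarrow> - x \<in> gen_field ys"
  unfolding gen_field_def by (auto intro: range_eqI[where x = "Neg _"])

lemma gen_field_inverse: "x \<in> gen_field ys \<Longrightarrow> inverse x \<in> gen_field ys"
  unfolding gen_field_def by (auto intro: range_eqI[where x = "Inv _"])

lemma gen_field_zero: "0 \<in> gen_field ys"
  using gen_field_add[OF gen_field_one gen_field_uminus[OF gen_field_one], of ys] by simp

lemma gen_field_diff: "x \<in> gen_field ys \<Longrightarrow> y \<in> gen_field ys \<Longrightarrow> x - y \<in> gen_field ys"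
  using gen_field_add[OF _ gen_field_uminus] by fastforce

lemma gen_field_divide: "x \<in> gen_field ys \<Longrightarrow> y \<in> gen_field ys \<Longrightarrow> x / y \<in> gen_field ys"
  by (simp add: divide_inverse gen_field_mult gen_field_inverse)

lemma gen_field_power: "x \<in> gen_field ys \<Longrightarrow> x ^ n \<in> gen_field ys"
  by (induction n) (auto intro: gen_field_one gen_field_mult)

lemma gen_field_sum: "(\<And>i. i \<in> A \<Longrightarrow> f i \<in> gen_field ys) \<Longrightarrow> sum f A \<in> gen_field ys"
  by (induction A rule: infinite_finite_induct) (auto intro: gen_field_zero gen_field_add)

lemma gen_field_prod: "(\<And>i. i \<in> A \<Longrightarrow> f i \<in> gen_field ys) \<Longrightarrow> prod f A \<in> gen_field ys"
  by (induction A rule: infinite_finite_induct) (auto intro: gen_field_one gen_field_mult)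

lemma gen_field_nth: "i < length ys \<Longrightarrow> ys ! i \<in> gen_field ys"
  unfolding gen_field_def by (rule range_eqI[where x = "Gen i"]) simp

lemma gen_field_fval [simp]: "fval ys s \<in> gen_field ys"
  by (simp add: gen_field_def)

lemmas gen_field_intros = gen_field_one gen_field_add gen_field_mult gen_field_uminus
  gen_field_inverse gen_field_zero gen_field_diff gen_field_divide gen_field_power gen_field_sum
  gen_field_prod gen_field_fval

section \<open>Monomials, exponent vectors and polynomials over the prime field\<close>

definition mon :: "'a::comm_semiring_1 list \<Rightarrow> nat list \<Rightarrow> 'a" where
  "mon xs e = (\<Prod>i<length xs. xs ! i ^ nth_default 0 e i)"

definition vadd :: "nat \<Rightarrow> nat list \<Rightarrow> nat list \<Rightarrow> nat list" where
  "vadd n d e = map (\<lambda>i. nth_default 0 d i + nth_default 0 e i) [0..<n]"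

definition vdiv :: "nat \<Rightarrow> nat list \<Rightarrow> nat \<Rightarrow> nat list" where
  "vdiv n e q = map (\<lambda>i. nth_default 0 e i div q) [0..<n]"

definition vmod :: "nat \<Rightarrow> nat list \<Rightarrow> nat \<Rightarrow> nat list" where
  "vmod n e q = map (\<lambda>i. nth_default 0 e i mod q) [0..<n]"

lemma nth_default_map_upt: "nth_default d (map f [0..<n]) i = (if i < n then f i else d)"
  by (simp add: nth_default_def)

lemma nth_default_Nil [simp]: "nth_default d [] i = d"
  by (simp add: nth_default_def)

lemma mon_Nil [simp]: "mon xs [] = 1"
  by (simp add: mon_def)

lemma mon_vadd: "mon xs (vadd (length xs) d e) = mon xs d * mon xs e"
  by (simp add: mon_def vadd_def nth_default_map_upt power_add prod.distrib)

lemma mon_divmod: "mon xs e = mon xs (vdiv (length xs) e q) ^ q * mon xs (vmod (length xs) e q)"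
proof -
  have "mon xs (vdiv (length xs) e q) ^ q = (\<Prod>i<length xs. xs ! i ^ (nth_default 0 e i div q * q))"
    by (simp add: mon_def vdiv_def nth_default_map_upt prod_power_distrib power_mult)
  then have "mon xs (vdiv (length xs) e q) ^ q * mon xs (vmod (length xs) e q)
      = (\<Prod>i<length xs. xs ! i ^ (nth_default 0 e i div q * q) * xs ! i ^ (nth_default 0 e i mod q))"
    by (simp add: mon_def vmod_def nth_default_map_upt prod.distrib)
  then show ?thesis by (simp only: div_mult_mod_eq mon_def flip: power_add)
qed

lemma mon_gen_field: "set xs \<subseteq> gen_field ys \<Longrightarrow> mon xs e \<in> gen_field ys"
  unfolding mon_def by (intro gen_field_intros) auto

lemma set_subset_gen_field: "set ys \<subseteq> gen_field ys"
  by (auto simp: in_set_conv_nth intro: gen_field_nth)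

lemma mon_ys_gen_field: "mon ys e \<in> gen_field ys"
  by (rule mon_gen_field[OF set_subset_gen_field])

text \<open>Polynomials over the prime field are lists of exponent vectors, with coefficients as
  multiplicities.\<close>

definition pval :: "'a::comm_semiring_1 list \<Rightarrow> nat list list \<Rightarrow> 'a" where
  "pval xs f = sum_list (map (mon xs) f)"

definition pmul :: "nat \<Rightarrow> nat list list \<Rightarrow> nat list list \<Rightarrow> nat list list" where
  "pmul n f g = concat (map (\<lambda>d. map (\<lambda>e. vadd n d e) g) f)"

lemma pval_simps [simp]:
  "pval xs [] = 0" "pval xs (e # f) = mon xs e + pval xs f" "pval xs (f @ g) = pval xs f + pval xs g"
  by (simp_all add: pval_def)

lemma pval_pmul: "pval xs (pmul (length xs) f g) = pval xs f * pval xs g"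
proof -
  have "pval xs (map (vadd (length xs) d) g) = mon xs d * pval xs g" for d
    by (induction g) (simp_all add: mon_vadd algebra_simps)
  then show ?thesis by (induction f) (simp_all add: pmul_def algebra_simps)
qed

lemma pval_replicate: "pval xs (concat (replicate n f)) = of_nat n * pval xs f"
  by (induction n) (simp_all add: algebra_simps)

definition pbound :: "nat \<Rightarrow> nat list list \<Rightarrow> bool" where
  "pbound m f \<longleftrightarrow> (\<forall>e\<in>set f. \<forall>i. nth_default 0 e i \<le> m)"

lemma pbound_simps [simp]:
  "pbound m []" "pbound m (e # f) \<longleftrightarrow> (\<forall>i. nth_default 0 e i \<le> m) \<and> pbound m f"
  "pbound m (f @ g) \<longleftrightarrow> pbound m f \<and> pbound m g"
  by (auto simp: pbound_def)

lemma pbound_mono: "pbound m f \<Longrightarrow> m \<le> m' \<Longrightarrow> pbound m' f"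
  by (meson pbound_def le_trans)

lemma pbound_pmul: "pbound m f \<Longrightarrow> pbound m' g \<Longrightarrow> pbound (m + m') (pmul n f g)"
  by (auto simp: pbound_def pmul_def vadd_def nth_default_map_upt intro!: add_mono)

lemma pbound_exists: "\<exists>m. pbound m f"
proof (induction f)
  case (Cons e f)
  then obtain m where "pbound m f" by blast
  moreover have "nth_default 0 e i \<le> sum_list e" for i
    by (auto simp: nth_default_def intro: member_le_sum_list)
  ultimately have "pbound (m + sum_list e) (e # f)"
    by (auto intro: pbound_mono le_trans trans_le_add2)
  then show ?case by blast
qed auto

section \<open>Frobenius, and bases of the field over its \<open>Q\<close>-th powers\<close>

locale char_p_field =
  fixes ys :: "'a::field list" and p :: nat
  assumes p_char: "p = CHAR('a)" and p_pos: "p > 0"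
begin

abbreviation "F \<equiv> gen_field ys"

lemma prime_p: "prime p"
  using p_char p_pos prime_CHAR_semidom by metis

lemma p_ge2: "p \<ge> 2"
  using prime_p prime_ge_2_nat by blast

lemma frob_add: "(x + y :: 'a) ^ (p ^ s) = x ^ (p ^ s) + y ^ (p ^ s)"
  using freshmans_dream'[of "p ^ s" s x y] prime_p p_char by simp

lemma frob_sum: "(sum f A :: 'a) ^ (p ^ s) = (\<Sum>i\<in>A. f i ^ (p ^ s))"
  using freshmans_dream_sum'[of "p ^ s" s f A] prime_p p_char by simp

lemma frob_uminus: "(- x :: 'a) ^ (p ^ s) = - (x ^ (p ^ s))"
proof -
  have "(- x) ^ (p ^ s) + x ^ (p ^ s) = 0"
    using frob_add[of "- x" x s] p_pos by (simp add: power_0_left)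
  then show ?thesis by (simp add: eq_neg_iff_add_eq_0)
qed

text \<open>Coefficients are multiplicities and cannot be negative; \<open>p - 1\<close> copies of a
  polynomial serve as its negative.\<close>

lemma pval_uminus: "pval ys (concat (replicate (p - 1) f)) = - pval ys f"
proof -
  have "of_nat p = (0 :: 'a)" using p_char by simp
  then have "of_nat (p - 1) = (-1 :: 'a)" using p_pos by (simp add: of_nat_diff)
  then show ?thesis by (simp add: pval_replicate)
qed

lemma fval_fraction: "\<exists>f g. pval ys g \<noteq> 0 \<and> fval ys s = pval ys f / pval ys g"
proof (induction s)
  case (Gen i)
  show ?case
  proof (cases "i < length ys")
    case True
    have "(\<Prod>j<length ys. ys ! j ^ nth_default 0 (map (\<lambda>j. if j = i then 1 else 0) [0..<length ys]) j)
      = (\<Prod>j<length ys. if j = i then ys ! j else 1)"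
      by (intro prod.cong) (auto simp: nth_default_map_upt)
    then have "pval ys [map (\<lambda>j. if j = i then 1 else 0) [0..<length ys]] = ys ! i"
      using True by (simp add: mon_def prod.delta)
    then show ?thesis using True
      by - (rule exI[of _ "[map (\<lambda>j. if j = i then 1 else 0) [0..<length ys]]"], rule exI[of _ "[[]]"], simp)
  next
    case False
    then show ?thesis by - (rule exI[of _ "[]"], rule exI[of _ "[[]]"], simp)
  qed
next
  case One
  show ?case by - (rule exI[of _ "[[]]"], rule exI[of _ "[[]]"], simp)
next
  case (Neg s)
  then obtain f g where "pval ys g \<noteq> 0" "fval ys s = pval ys f / pval ys g" by blast
  then show ?case
    by - (rule exI[of _ "concat (replicate (p - 1) f)"], rule exI[of _ g], simp add: pval_uminus[unfolded One_nat_def])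
next
  case (Inv s)
  then obtain f g where fg: "pval ys g \<noteq> 0" "fval ys s = pval ys f / pval ys g" by blast
  show ?case
  proof (cases "pval ys f = 0")
    case True
    then show ?thesis using fg by - (rule exI[of _ "[]"], rule exI[of _ "[[]]"], simp)
  next
    case False
    then show ?thesis using fg by - (rule exI[of _ g], rule exI[of _ f], simp)
  qed
next
  case (Add s t)
  then obtain f g f' g' where fg: "pval ys g \<noteq> 0" "fval ys s = pval ys f / pval ys g"
    "pval ys g' \<noteq> 0" "fval ys t = pval ys f' / pval ys g'" by blast
  then show ?case
    by - (rule exI[of _ "pmul (length ys) f g' @ pmul (length ys) f' g"], rule exI[of _ "pmul (length ys) g g'"], simp add: pval_pmul field_simps)
next
  case (Mul s t)
  then obtain f g f' g' where fg: "pval ys g \<noteq> 0" "fval ys s = pval ys f / pval ys g"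
    "pval ys g' \<noteq> 0" "fval ys t = pval ys f' / pval ys g'" by blast
  then show ?case
    by - (rule exI[of _ "pmul (length ys) f f'"], rule exI[of _ "pmul (length ys) g g'"], simp add: pval_pmul)
qed

lemma gen_field_fraction:
  assumes "x \<in> F" obtains f g where "pval ys g \<noteq> 0" "x = pval ys f / pval ys g"
  using assms fval_fraction unfolding gen_field_def by blast

lemma pval_gen_field: "pval ys f \<in> F"
  by (induction f) (auto intro!: gen_field_intros mon_ys_gen_field)

definition q_span :: "nat \<Rightarrow> 'a set \<Rightarrow> 'a set" where
  "q_span Q B = {\<Sum>b\<in>B. u b ^ Q * b | u. \<forall>b\<in>B. u b \<in> F}"

lemma q_spanI: "x = (\<Sum>b\<in>B. u b ^ Q * b) \<Longrightarrow> \<forall>b\<in>B. u b \<in> F \<Longrightarrow> x \<in> q_span Q B"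
  unfolding q_span_def by blast

lemma q_span_add:
  assumes "x \<in> q_span (p ^ s) B" "y \<in> q_span (p ^ s) B" shows "x + y \<in> q_span (p ^ s) B"
proof -
  obtain u v where u: "\<forall>b\<in>B. u b \<in> F" "x = (\<Sum>b\<in>B. u b ^ (p ^ s) * b)"
    and v: "\<forall>b\<in>B. v b \<in> F" "y = (\<Sum>b\<in>B. v b ^ (p ^ s) * b)"
    using assms unfolding q_span_def by blast
  have "x + y = (\<Sum>b\<in>B. (u b + v b) ^ (p ^ s) * b)"
    by (simp add: u v frob_add algebra_simps sum.distrib)
  then show ?thesis unfolding q_span_def using u v
    by (auto intro!: exI[of _ "\<lambda>b. u b + v b"] gen_field_intros)
qed

lemma q_span_scale:
  assumes "x \<in> q_span Q B" "c \<in> F" shows "c ^ Q * x \<in> q_span Q B"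
proof -
  obtain u where u: "\<forall>b\<in>B. u b \<in> F" "x = (\<Sum>b\<in>B. u b ^ Q * b)"
    using assms unfolding q_span_def by blast
  have "c ^ Q * x = (\<Sum>b\<in>B. (c * u b) ^ Q * b)"
    by (simp add: u power_mult_distrib sum_distrib_left mult.assoc)
  then show ?thesis unfolding q_span_def using u assms
    by (auto intro!: exI[of _ "\<lambda>b. c * u b"] gen_field_intros)
qed

lemma q_span_zero: "0 \<in> q_span (p ^ s) B"
  unfolding q_span_def using p_pos
  by (auto intro!: exI[of _ "\<lambda>_. 0"] gen_field_intros simp: power_0_left)

lemma q_span_sum: "(\<And>i. i \<in> A \<Longrightarrow> f i \<in> q_span (p ^ s) B) \<Longrightarrow> sum f A \<in> q_span (p ^ s) B"
  by (induction A rule: infinite_finite_induct) (auto intro: q_span_zero q_span_add)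

lemma q_span_base:
  assumes "finite B" "b \<in> B" shows "b \<in> q_span (p ^ s) B"
proof -
  have "(\<Sum>c\<in>B. (if c = b then 1 else 0 :: 'a) ^ (p ^ s) * c) = (\<Sum>c\<in>B. if c = b then c else 0)"
    using p_pos by (intro sum.cong) (auto simp: power_0_left)
  then have "b = (\<Sum>c\<in>B. (if c = b then 1 else 0 :: 'a) ^ (p ^ s) * c)" using assms by simp
  then show ?thesis unfolding q_span_def
    by (auto intro!: exI[of _ "\<lambda>c. if c = b then 1 else 0"] gen_field_intros)
qed

definition mons :: "nat \<Rightarrow> 'a set" where
  "mons Q = mon ys ` {e. length e = length ys \<and> set e \<subseteq> {..<Q}}"

lemma finite_mons: "finite (mons Q)"
  unfolding mons_def using finite_lists_length_eq[of "{..<Q}" "length ys"]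
  by (auto simp: conj_commute)

lemma mons_subset: "mons Q \<subseteq> F"
  by (auto simp: mons_def intro: mon_ys_gen_field)

lemma vmod_range: "Q > 0 \<Longrightarrow> length (vmod n e Q) = n \<and> set (vmod n e Q) \<subseteq> {..<Q}"
  by (auto simp: vmod_def)

text \<open>A denominator is moved into the scalars by
  \<open>1 / g = (1 / g) ^ Q * g ^ (Q - 1)\<close>, and division of the exponents by
  \<open>Q\<close> with remainder splits each monomial of the numerator.\<close>

lemma q_span_mons: "F \<subseteq> q_span (p ^ s) (mons (p ^ s))"
proof
  fix x assume "x \<in> F"
  then obtain f g where fg: "pval ys g \<noteq> 0" "x = pval ys f / pval ys g" by (rule gen_field_fraction)
  let ?Q = "p ^ s"
  have Q: "?Q > 0" using p_pos by simp
  have "pval ys h \<in> q_span ?Q (mons ?Q)" for h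
  proof (induction h)
    case (Cons e h)
    have "mon ys (vmod (length ys) e ?Q) \<in> q_span ?Q (mons ?Q)"
      using vmod_range[OF Q] by (intro q_span_base finite_mons) (auto simp: mons_def)
    then have "mon ys e \<in> q_span ?Q (mons ?Q)"
      by (subst mon_divmod[of ys e ?Q]) (intro q_span_scale mon_ys_gen_field)
    then show ?case using Cons by (simp add: q_span_add)
  qed (simp add: q_span_zero)
  moreover have "\<exists>h. pval ys h = pval ys g ^ n" for n
  proof (induction n)
    case 0
    show ?case by (rule exI[of _ "[[]]"]) simp
  next
    case (Suc n)
    then show ?case using pval_pmul[of ys g] by (metis power_Suc)
  qed
  then obtain h where h: "pval ys h = pval ys g ^ (?Q - 1)" by blast
  have "pval ys g ^ ?Q = pval ys g * pval ys g ^ (?Q - 1)"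
    using Q by (metis Suc_pred' power_Suc)
  then have "x = (inverse (pval ys g)) ^ ?Q * pval ys (pmul (length ys) f h)"
    using fg by (simp add: pval_pmul h power_inverse field_simps)
  ultimately show "x \<in> q_span ?Q (mons ?Q)"
    by (simp add: q_span_scale gen_field_intros pval_gen_field)
qed

text \<open>Lists rather than sets of basis elements, because the algorithm has to refer to them.\<close>

definition q_basis :: "nat \<Rightarrow> 'a list \<Rightarrow> bool" where
  "q_basis Q bs \<longleftrightarrow> set bs \<subseteq> F \<and>
     (\<forall>x\<in>F. \<exists>u. (\<forall>j. u j \<in> F) \<and> x = (\<Sum>j<length bs. u j ^ Q * bs ! j)) \<and>
     (\<forall>u. (\<forall>j<length bs. u j \<in> F) \<longrightarrow> (\<Sum>j<length bs. u j ^ Q * bs ! j) = 0 \<longrightarrow>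
        (\<forall>j<length bs. u j = 0))"

text \<open>A minimal spanning subset of the monomials with exponents below \<open>Q\<close> is a basis.\<close>

lemma q_basis_exists: "\<exists>bs. q_basis (p ^ s) bs"
proof -
  let ?Q = "p ^ s"
  let ?ok = "\<lambda>n. \<exists>B. finite B \<and> B \<subseteq> F \<and> F \<subseteq> q_span ?Q B \<and> card B = n"
  have ex: "?ok (card (mons ?Q))" by (intro exI[of _ "mons ?Q"] conjI finite_mons mons_subset q_span_mons refl)
  define n where "n = (LEAST n. ?ok n)"
  have "?ok n" unfolding n_def using ex by (rule LeastI)
  then obtain B where B: "finite B" "B \<subseteq> F" "F \<subseteq> q_span ?Q B" "card B = n" by blast
  have indep: "u b0 = 0" if u: "\<forall>b\<in>B. u b \<in> F" "(\<Sum>b\<in>B. u b ^ ?Q * b) = 0" and b0: "b0 \<in> B" for u b0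
  proof (rule ccontr)
    assume nz: "u b0 \<noteq> 0"
    have "u b0 ^ ?Q * b0 + (\<Sum>b\<in>B - {b0}. u b ^ ?Q * b) = 0"
      using u(2) B(1) b0 by (simp add: sum.remove)
    then have "u b0 ^ ?Q * b0 = - (\<Sum>b\<in>B - {b0}. u b ^ ?Q * b)"
      by (simp add: eq_neg_iff_add_eq_0)
    moreover have "u b0 ^ ?Q \<noteq> 0" using nz by simp
    ultimately have "b0 = - (\<Sum>b\<in>B - {b0}. u b ^ ?Q * b) / u b0 ^ ?Q"
      by (metis nonzero_mult_div_cancel_left)
    also have "\<dots> = (\<Sum>b\<in>B - {b0}. - ((u b / u b0) ^ ?Q) * b)"
      by (simp add: sum_negf sum_divide_distrib power_divide)
    also have "\<dots> = (\<Sum>b\<in>B - {b0}. (- (u b / u b0)) ^ ?Q * b)"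
      by (simp only: frob_uminus)
    finally have b0_eq: "b0 = (\<Sum>b\<in>B - {b0}. (- (u b / u b0)) ^ ?Q * b)" .
    moreover have "\<forall>b\<in>B - {b0}. - (u b / u b0) \<in> F"
      using u(1) b0 by (auto intro!: gen_field_uminus gen_field_divide)
    ultimately have b0_in: "b0 \<in> q_span ?Q (B - {b0})"
      by (rule q_spanI)
    have "x \<in> q_span ?Q (B - {b0})" if x: "x \<in> F" for x
    proof -
      obtain v where v: "\<forall>b\<in>B. v b \<in> F" "x = (\<Sum>b\<in>B. v b ^ ?Q * b)"
        using B(3) x unfolding q_span_def by blast
      have "v b ^ ?Q * b \<in> q_span ?Q (B - {b0})" if b: "b \<in> B" for b
      proof (rule q_span_scale)
        show "b \<in> q_span ?Q (B - {b0})"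
        proof (cases "b = b0")
          case False
          then show ?thesis using b B(1) by (intro q_span_base) auto
        qed (simp add: b0_in)
      qed (use v(1) b in blast)
      then show ?thesis unfolding v(2) by (rule q_span_sum)
    qed
    then have "F \<subseteq> q_span ?Q (B - {b0})" by blast
    moreover have "finite (B - {b0})" "B - {b0} \<subseteq> F" "card (B - {b0}) = n - 1"
      using B(1,2,4) b0 by auto
    ultimately have "?ok (n - 1)" by blast
    then have "n \<le> n - 1" unfolding n_def by (rule Least_le)
    moreover have "n > 0" using B(1,4) b0 by (auto simp: card_gt_0_iff)
    ultimately show False by simp
  qed
  obtain bs where bs: "set bs = B" "distinct bs" using finite_distinct_list[OF B(1)] by blast
  have bij: "bij_betw ((!) bs) {..<length bs} B" using bij_betw_nth[of bs] bs by blast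
  have conv: "(\<Sum>b\<in>B. g b) = (\<Sum>j<length bs. g (bs ! j))" for g :: "'a \<Rightarrow> 'a"
    using sum.reindex_bij_betw[OF bij, of g] by simp
  have "\<exists>u. (\<forall>j. u j \<in> F) \<and> x = (\<Sum>j<length bs. u j ^ ?Q * bs ! j)" if x: "x \<in> F" for x
  proof -
    obtain v where v: "\<forall>b\<in>B. v b \<in> F" "x = (\<Sum>b\<in>B. v b ^ ?Q * b)"
      using B(3) x unfolding q_span_def by blast
    then show ?thesis using bs
      by (intro exI[of _ "\<lambda>j. if j < length bs then v (bs ! j) else 0"])
        (auto simp add: conv[of "\<lambda>b. v b ^ ?Q * b"] gen_field_zero)
  qed
  moreover have "u j = 0" if u: "\<forall>j<length bs. u j \<in> F" "(\<Sum>j<length bs. u j ^ ?Q * bs ! j) = 0"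
    and j: "j < length bs" for u j
  proof -
    define w where "w = u \<circ> inv_into {..<length bs} ((!) bs)"
    have w: "w (bs ! j) = u j" if "j < length bs" for j
      using that bij by (simp add: w_def inv_into_f_f bij_betw_def)
    have "(\<Sum>b\<in>B. w b ^ ?Q * b) = 0" using u(2) by (simp add: conv[of "\<lambda>b. w b ^ ?Q * b"] w)
    moreover have "\<forall>b\<in>B. w b \<in> F"
      using u(1) w bs by (metis in_set_conv_nth)
    ultimately show ?thesis using indep[of w "bs ! j"] w[OF j] j bs by auto
  qed
  ultimately have "q_basis ?Q bs" using bs(1) B(2) by (simp add: q_basis_def)
  then show ?thesis ..
qed

lemma common_denominator:
  assumes "finite I" "\<forall>i\<in>I. u i \<in> F"
  shows "\<exists>d n. pval ys d \<noteq> 0 \<and> (\<forall>i\<in>I. pval ys d * u i = pval ys (n i))"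
  using assms
proof (induction I)
  case empty
  show ?case by (rule exI[of _ "[[]]"]) simp
next
  case (insert i I)
  then obtain d n where d: "pval ys d \<noteq> 0" "\<forall>i\<in>I. pval ys d * u i = pval ys (n i)" by auto
  obtain f g where fg: "pval ys g \<noteq> 0" "u i = pval ys f / pval ys g"
    using insert.prems by (auto elim: gen_field_fraction)
  let ?n = "\<lambda>k. if k = i then pmul (length ys) d f else pmul (length ys) g (n k)"
  have "pval ys (pmul (length ys) d g) * u k = pval ys (?n k)" if "k \<in> insert i I" for k
  proof (cases "k = i")
    case True
    then show ?thesis using fg by (simp add: pval_pmul)
  next
    case False
    then have "pval ys d * u k = pval ys (n k)" using d(2) that by blast
    then show ?thesis using False by (simp add: pval_pmul ac_simps)
  qed
  moreover have "pval ys (pmul (length ys) d g) \<noteq> 0" using d(1) fg(1) by (simp add: pval_pmul)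
  ultimately show ?case by (intro exI[of _ "pmul (length ys) d g"] exI[of _ ?n]) blast
qed

definition residues :: "nat list set" where
  "residues = {r. length r = length ys \<and> set r \<subseteq> {..<p}}"

lemma finite_residues: "finite residues"
  using finite_lists_length_eq[of "{..<p}" "length ys"] by (simp add: residues_def conj_commute)

lemma vmod_residues: "vmod (length ys) e p \<in> residues"
  using vmod_range[OF p_pos] by (simp add: residues_def)

end

text \<open>The numerator of the \<open>j\<close>-th digit of \<open>f\<close>: each monomial is a
  \<open>q\<close>-th power times a residue monomial, and \<open>N\<close> tabulates the digits of
  the residue monomials over a common denominator.\<close>

definition reduce :: "nat \<Rightarrow> nat \<Rightarrow> (nat list \<times> nat \<Rightarrow> nat list list) \<Rightarrow> nat list list \<Rightarrow> nat \<Rightarrow> nat list list" where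
  "reduce n q N f j = concat (map (\<lambda>e. map (vadd n (vdiv n e q)) (N (vmod n e q, j))) f)"

locale char_p_basis = char_p_field +
  fixes bs :: "'a list"
  assumes basis: "q_basis p bs"
begin

lemma basis_span: "x \<in> F \<Longrightarrow> \<exists>u. (\<forall>j. u j \<in> F) \<and> x = (\<Sum>j<length bs. u j ^ p * bs ! j)"
  using basis by (simp add: q_basis_def)

lemma basis_indep:
  "\<forall>j<length bs. u j \<in> F \<Longrightarrow> (\<Sum>j<length bs. u j ^ p * bs ! j) = 0 \<Longrightarrow> j < length bs \<Longrightarrow> u j = 0"
  using basis by (simp add: q_basis_def)

text \<open>There are only finitely many residue monomials, so one denominator \<open>d\<close>
  serves for all their digits. Making \<open>N\<close> empty elsewhere turns it into a finite table,
  which is computable.\<close>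

lemma reduce_exists:
  "\<exists>d N c. pval ys d \<noteq> 0 \<and> (\<forall>r\<in>residues. \<forall>j<length bs. pbound c (N (r, j))) \<and>
     finite {x. N x \<noteq> []} \<and>
     (\<forall>f. pval ys d ^ p * pval ys f
        = (\<Sum>j<length bs. pval ys (reduce (length ys) p N f j) ^ p * bs ! j))"
proof -
  have "\<exists>u. (\<forall>j. u j \<in> F) \<and> mon ys r = (\<Sum>j<length bs. u j ^ p * bs ! j)" for r
    by (rule basis_span) (rule mon_ys_gen_field)
  then obtain u where u: "\<And>r j. u r j \<in> F" "\<And>r. mon ys r = (\<Sum>j<length bs. u r j ^ p * bs ! j)"
    by metis
  let ?I = "residues \<times> {..<length bs}"
  have I: "finite ?I" using finite_residues by simp
  obtain d N0 where d: "pval ys d \<noteq> 0"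
    and N0: "\<forall>x\<in>?I. pval ys d * u (fst x) (snd x) = pval ys (N0 x)"
    using common_denominator[OF I, of "\<lambda>x. u (fst x) (snd x)"] u(1) by blast
  define N where "N x = (if x \<in> ?I then N0 x else [])" for x
  have "finite {x. N x \<noteq> []}"
    by (rule finite_subset[OF _ I]) (auto simp: N_def)
  have N: "pval ys (N (r, j)) = pval ys d * u r j" if "r \<in> residues" "j < length bs" for r j
    using bspec[OF N0, of "(r, j)"] that by (simp add: N_def)
  have "\<exists>m. \<forall>x. pbound (m x) (N x)" by (rule choice) (intro allI pbound_exists)
  then obtain m where m: "\<And>x. pbound (m x) (N x)" by blast
  have bnd: "pbound (Max (m ` ?I)) (N (r, j))" if "r \<in> residues" "j < length bs" for r j
    by (rule pbound_mono[OF m]) (use that I in \<open>auto intro!: Max_ge\<close>)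
  have red1: "pval ys (map (vadd (length ys) e) g) = mon ys e * pval ys g" for e g
    by (induction g) (simp_all add: mon_vadd algebra_simps)
  have "pval ys d ^ p * pval ys f = (\<Sum>j<length bs. pval ys (reduce (length ys) p N f j) ^ p * bs ! j)" for f
  proof (induction f)
    case Nil
    show ?case using p_pos by (simp add: reduce_def power_0_left)
  next
    case (Cons e f)
    let ?r = "vmod (length ys) e p" let ?q = "vdiv (length ys) e p"
    have "pval ys d ^ p * mon ys e = pval ys d ^ p * (mon ys ?q ^ p * mon ys ?r)"
      by (subst mon_divmod[of ys e p]) simp
    also have "\<dots> = (\<Sum>j<length bs. (mon ys ?q * (pval ys d * u ?r j)) ^ p * bs ! j)"
      by (subst u(2)) (simp add: sum_distrib_left power_mult_distrib ac_simps)
    also have "\<dots> = (\<Sum>j<length bs. (mon ys ?q * pval ys (N (?r, j))) ^ p * bs ! j)"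
      using vmod_residues by (intro sum.cong refl) (simp add: N)
    finally have e: "pval ys d ^ p * mon ys e
      = (\<Sum>j<length bs. (mon ys ?q * pval ys (N (?r, j))) ^ p * bs ! j)" .
    have "pval ys (reduce (length ys) p N (e # f) j) ^ p * bs ! j
      = (mon ys ?q * pval ys (N (?r, j))) ^ p * bs ! j
        + pval ys (reduce (length ys) p N f j) ^ p * bs ! j" for j
      using frob_add[of _ _ 1] by (simp add: reduce_def red1 algebra_simps)
    then show ?case using e Cons by (simp add: sum.distrib distrib_left)
  qed
  then show ?thesis
    using d bnd \<open>finite {x. N x \<noteq> []}\<close>
    by (intro exI[of _ d] exI[of _ N] exI[of _ "Max (m ` ?I)"]) blast
qed

text \<open>Passing to digits divides the exponents by \<open>p\<close> up to a constant. Both the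
  decision of equality and the finiteness of the set \<open>W\<close> rest on this
  contraction.\<close>

lemma reduce_bound:
  assumes "\<forall>r\<in>residues. \<forall>j<length bs. pbound c (N (r, j))" "pbound m f" "j < length bs"
  shows "pbound (m div p + c) (reduce (length ys) p N f j)"
  unfolding reduce_def pbound_def
proof (intro ballI allI)
  fix g i assume "g \<in> set (concat (map (\<lambda>e. map (vadd (length ys) (vdiv (length ys) e p))
    (N (vmod (length ys) e p, j))) f))"
  then obtain e d where e: "e \<in> set f" and d: "d \<in> set (N (vmod (length ys) e p, j))"
    and g: "g = vadd (length ys) (vdiv (length ys) e p) d" by auto
  have "nth_default 0 d i \<le> c" using assms(1,3) vmod_residues d by (auto simp: pbound_def)
  moreover have "nth_default 0 e i div p \<le> m div p"
    using assms(2) e by (auto simp: pbound_def intro: div_le_mono)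
  ultimately show "nth_default 0 g i \<le> m div p + c"
    by (auto simp: g vadd_def vdiv_def nth_default_map_upt add_mono)
qed

subsection \<open>Deciding equality\<close>

definition iter_reduce :: "(nat list \<times> nat \<Rightarrow> nat list list) \<Rightarrow> nat \<Rightarrow> nat list list \<Rightarrow> nat list list list" where
  "iter_reduce N n f =
     ((\<lambda>L. concat (map (\<lambda>f. map (reduce (length ys) p N f) [0..<length bs]) L)) ^^ n) [f]"

text \<open>A normal form for polynomials with exponents at most \<open>k\<close>: the coefficients
  modulo \<open>p\<close>. Exponent vectors are first brought to the length of \<open>ys\<close>,
  since lists of different lengths may denote the same monomial.\<close>

definition counts :: "nat \<Rightarrow> nat list list \<Rightarrow> nat list" where
  "counts k f = map (\<lambda>e. length (filter (\<lambda>d. map (nth_default 0 d) [0..<length ys] = e) f) mod p)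
     (List.n_lists (length ys) [0..<Suc k])"

lemma mon_normalize: "mon ys (map (nth_default 0 d) [0..<length ys]) = mon ys d"
  by (simp add: mon_def nth_default_map_upt)

lemma distinct_n_lists: "distinct xs \<Longrightarrow> distinct (List.n_lists n xs)"
  by (induction n) (auto simp: distinct_map inj_on_def intro!: distinct_concat)

lemma pval_counts:
  assumes "pbound k f"
  shows "pval ys f = (\<Sum>i<length (List.n_lists (length ys) [0..<Suc k]).
    of_nat (counts k f ! i) * mon ys (List.n_lists (length ys) [0..<Suc k] ! i))"
proof -
  let ?B = "List.n_lists (length ys) [0..<Suc k]" let ?n = "\<lambda>d. map (nth_default 0 d) [0..<length ys]"
  have dist: "distinct ?B" by (intro distinct_n_lists) simp
  have "pval ys f = (\<Sum>e\<in>set ?B. of_nat (length (filter (\<lambda>d. ?n d = e) f)) * mon ys e)"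
    using assms
  proof (induction f)
    case (Cons d f)
    have "\<forall>i. nth_default 0 d i < Suc k" using Cons.prems by (simp add: less_Suc_eq_le)
    then have "?n d \<in> set ?B" by (auto simp: set_n_lists simp del: upt_Suc)
    moreover have "(\<Sum>e\<in>set ?B. of_nat (length (filter (\<lambda>d. ?n d = e) (d # f))) * mon ys e)
      = (\<Sum>e\<in>set ?B. (if ?n d = e then mon ys e else 0)
          + of_nat (length (filter (\<lambda>d. ?n d = e) f)) * mon ys e)"
      by (intro sum.cong) (auto simp: algebra_simps)
    ultimately show ?case using Cons by (simp add: sum.distrib mon_normalize)
  qed simp
  also have "\<dots> = (\<Sum>i<length ?B. of_nat (length (filter (\<lambda>d. ?n d = ?B ! i) f)) * mon ys (?B ! i))"
    using sum.reindex_bij_betw[OF bij_betw_nth[OF dist refl refl],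
        of "\<lambda>e. of_nat (length (filter (\<lambda>d. ?n d = e) f)) * mon ys e"] by simp
  also have "\<dots> = (\<Sum>i<length ?B. of_nat (counts k f ! i) * mon ys (?B ! i))"
  proof (intro sum.cong refl)
    fix i assume "i \<in> {..<length ?B}"
    then have "counts k f ! i = length (filter (\<lambda>d. ?n d = ?B ! i) f) mod p"
      by (simp add: counts_def)
    moreover have "of_nat (m mod p) = (of_nat m :: 'a)" for m
    proof -
      have "(of_nat m :: 'a) = of_nat (m div p * p + m mod p)" by simp
      also have "\<dots> = of_nat (m div p) * of_nat p + of_nat (m mod p)" by (simp only: of_nat_add of_nat_mult)
      also have "of_nat p = (0 :: 'a)" by (simp add: p_char)
      finally show ?thesis by simp
    qed
    ultimately show "of_nat (length (filter (\<lambda>d. ?n d = ?B ! i) f)) * mon ys (?B ! i)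
      = of_nat (counts k f ! i) * mon ys (?B ! i)" by simp
  qed
  finally show ?thesis .
qed

lemma iter_reduce_Suc:
  "iter_reduce N (Suc n) f = concat (map (\<lambda>f. map (reduce (length ys) p N f) [0..<length bs]) (iter_reduce N n f))"
  by (simp add: iter_reduce_def)

text \<open>By independence of the basis an element vanishes exactly if all its digits vanish, and
  multiplication by the non-zero \<open>p\<close>-th power of the denominator does not affect
  this.\<close>

lemma iter_reduce_zero:
  assumes d: "pval ys d \<noteq> 0"
    and red: "\<And>f. pval ys d ^ p * pval ys f
        = (\<Sum>j<length bs. pval ys (reduce (length ys) p N f j) ^ p * bs ! j)"
  shows "(\<forall>g\<in>set (iter_reduce N n f). pval ys g = 0) \<longleftrightarrow> pval ys f = 0"
proof (induction n)
  case 0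
  show ?case by (simp add: iter_reduce_def)
next
  case (Suc n)
  have "(\<forall>j<length bs. pval ys (reduce (length ys) p N g j) = 0) \<longleftrightarrow> pval ys g = 0" for g
  proof
    assume "\<forall>j<length bs. pval ys (reduce (length ys) p N g j) = 0"
    then have "pval ys d ^ p * pval ys g = 0" using red[of g] p_pos by (simp add: power_0_left)
    then show "pval ys g = 0" using d by simp
  next
    assume "pval ys g = 0"
    then have "(\<Sum>j<length bs. pval ys (reduce (length ys) p N g j) ^ p * bs ! j) = 0"
      using red[of g] by simp
    then show "\<forall>j<length bs. pval ys (reduce (length ys) p N g j) = 0"
      using basis_indep[of "\<lambda>j. pval ys (reduce (length ys) p N g j)"] pval_gen_field by blast
  qed
  moreover have "(\<forall>g\<in>set (iter_reduce N (Suc n) f). pval ys g = 0) \<longleftrightarrow>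
      (\<forall>h\<in>set (iter_reduce N n f). \<forall>j<length bs. pval ys (reduce (length ys) p N h j) = 0)"
    by (auto simp: iter_reduce_Suc)
  ultimately show ?case using Suc by simp
qed

text \<open>Since \<open>p \<ge> 2\<close>, the value \<open>M div p + c\<close> is smaller than
  \<open>M\<close> as long as \<open>M > 2 * c\<close>; so each round lowers the bound by at least
  one until \<open>2 * c\<close> is reached.\<close>

lemma iter_reduce_bound:
  assumes "\<forall>r\<in>residues. \<forall>j<length bs. pbound c (N (r, j))" "pbound m f"
    "g \<in> set (iter_reduce N n f)"
  shows "pbound (max (2 * c) (m - n)) g"
  using assms(3)
proof (induction n arbitrary: g)
  case 0
  then show ?case using assms(2) by (auto simp: iter_reduce_def intro: pbound_mono)
next
  case (Suc n)
  let ?M = "max (2 * c) (m - n)"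
  obtain h j where h: "h \<in> set (iter_reduce N n f)" "j < length bs" "g = reduce (length ys) p N h j"
    using Suc.prems by (auto simp: iter_reduce_Suc)
  have "pbound (?M div p + c) g"
    unfolding h(3) by (rule reduce_bound[where N = N]) (use assms(1) Suc.IH h in auto)
  moreover have "?M div p \<le> ?M div 2" by (rule div_le_mono2) (use p_ge2 in auto)
  then have "?M div p + c \<le> max (2 * c) (m - Suc n)" by (auto simp: max_def split: if_splits)
  ultimately show ?case by (rule pbound_mono)
qed

text \<open>This supplies a computable number of rounds: after \<open>enc f\<close> reductions the
  exponents of \<open>f\<close> have shrunk to the fixed bound.\<close>

lemma pbound_enc: "pbound (enc f) f"
  unfolding pbound_def
proof (intro ballI allI)
  fix e i assume "e \<in> set f"
  then have "enc e < enc f" unfolding enc_list_def[of f] by (intro list_encode_less) auto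
  moreover have "nth_default 0 e i \<le> enc e"
  proof (cases "i < length e")
    case True
    then have "e ! i < enc e" by (simp add: enc_list_def list_encode_less)
    then show ?thesis using True by (simp add: nth_default_def)
  qed (simp add: nth_default_def)
  ultimately show "nth_default 0 e i \<le> enc f" by simp
qed

end

section \<open>Computability of the operations on polynomials\<close>

lemma computable_vadd [comp_intro]:
  assumes "computable n" "computable d" "computable e"
  shows "computable (\<lambda>x. vadd (n x) (d x) (e x))"
  unfolding vadd_def by (intro comp_intro assms[THEN computable_comp])

lemma computable_vdiv [comp_intro]:
  assumes "computable n" "computable d" "computable e"
  shows "computable (\<lambda>x. vdiv (n x) (d x) (e x))"
  unfolding vdiv_def by (intro comp_intro assms[THEN computable_comp])

lemma computable_vmod [comp_intro]:
  assumes "computable n" "computable d" "computable e"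
  shows "computable (\<lambda>x. vmod (n x) (d x) (e x))"
  unfolding vmod_def by (intro comp_intro assms[THEN computable_comp])

lemma computable_pmul [comp_intro]:
  assumes "computable n" "computable f" "computable g"
  shows "computable (\<lambda>x. pmul (n x) (f x) (g x))"
  unfolding pmul_def by (intro comp_intro assms[THEN computable_comp])

lemma computable_reduce:
  assumes "computable N" "computable f" "computable j"
  shows "computable (\<lambda>x. reduce n q N (f x) (j x))"
  unfolding reduce_def by (intro comp_intro assms[THEN computable_comp])

lemma computable_replicate [comp_intro]:
  assumes "computable n" "computable f" shows "computable (\<lambda>x. replicate (n x) (f x))"
proof -
  have "computable (\<lambda>x. map (\<lambda>_. f x) [0..<n x])" by (intro comp_intro assms[THEN computable_comp])
  then show ?thesis by (simp add: map_replicate_const)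
qed

context char_p_basis
begin

text \<open>Iterated reduction shrinks all exponents below a fixed bound, where a finite table of
  coefficient vectors decides.\<close>

lemma computable_pval_zero: "computable (\<lambda>f. pval ys f = 0)"
proof -
  obtain d N c where d: "pval ys d \<noteq> 0" and c: "\<forall>r\<in>residues. \<forall>j<length bs. pbound c (N (r, j))"
    and N: "finite {x. N x \<noteq> []}"
    and red: "\<And>f. pval ys d ^ p * pval ys f
        = (\<Sum>j<length bs. pval ys (reduce (length ys) p N f j) ^ p * bs ! j)"
    using reduce_exists by blast
  let ?k = "2 * c"
  \<comment> \<open>The relations among monomials of bounded degree are not computed. For given
    \<open>ys\<close> their coefficient vectors form a fixed finite set, which becomes a constant of
    the program.\<close>
  define T where "T = counts ?k ` {f. pbound ?k f \<and> pval ys f = 0}"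
  have "T \<subseteq> {v. set v \<subseteq> {..<p} \<and> length v = length (List.n_lists (length ys) [0..<Suc ?k])}"
    unfolding T_def counts_def using p_pos by (auto simp del: upt_Suc)
  then have T: "finite T" by (rule finite_subset) (rule finite_lists_length_eq, simp)
  have T_iff: "counts ?k g \<in> T \<longleftrightarrow> pval ys g = 0" if g: "pbound ?k g" for g
  proof
    assume "counts ?k g \<in> T"
    then obtain f where f: "pbound ?k f" "pval ys f = 0" "counts ?k g = counts ?k f"
      unfolding T_def by auto
    show "pval ys g = 0"
      using pval_counts[OF g] pval_counts[OF f(1)] f(2,3) by simp
  qed (use g in \<open>auto simp: T_def\<close>)
  have "(\<forall>g\<in>set (iter_reduce N (enc f) f). counts ?k g \<in> T) \<longleftrightarrow> pval ys f = 0" for f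
  proof -
    have "pbound ?k g" if "g \<in> set (iter_reduce N (enc f) f)" for g
      using iter_reduce_bound[OF c pbound_enc that] by simp
    then show ?thesis using iter_reduce_zero[OF d red, of "enc f" f] T_iff by blast
  qed
  then have eq: "(\<lambda>f. pval ys f = 0) = (\<lambda>f. list_all (\<lambda>g. counts ?k g \<in> T) (iter_reduce N (enc f) f))"
    by (simp add: list_all_iff fun_eq_iff)
  have "computable N" using N by (rule computable_finite_support)
  then have it: "computable (\<lambda>f. iter_reduce N (enc f) f)"
    unfolding iter_reduce_def by (intro comp_intro computable_reduce)
  have cnt: "computable (\<lambda>g. counts ?k g)"
    unfolding counts_def by (intro comp_intro)
  show ?thesis
    unfolding eq by (intro comp_intro it computable_finite_set[OF T] cnt[THEN computable_comp])
qed

text \<open>Inversion has to branch on the vanishing of the numerator, so even the normalisation of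
  an expression relies on the zero test for polynomials.\<close>

primrec fraction :: "fexpr \<Rightarrow> nat list list \<times> nat list list" where
  "fraction (Gen i) = (if i < length ys then [map (\<lambda>j. if j = i then 1 else 0) [0..<length ys]] else [], [[]])"
| "fraction One = ([[]], [[]])"
| "fraction (Neg s) = (concat (replicate (p - 1) (fst (fraction s))), snd (fraction s))"
| "fraction (Inv s) = (if pval ys (fst (fraction s)) = 0 then ([], [[]])
     else (snd (fraction s), fst (fraction s)))"
| "fraction (Add s t) =
     (pmul (length ys) (fst (fraction s)) (snd (fraction t)) @ pmul (length ys) (fst (fraction t)) (snd (fraction s)),
      pmul (length ys) (snd (fraction s)) (snd (fraction t)))"
| "fraction (Mul s t) = (pmul (length ys) (fst (fraction s)) (fst (fraction t)),
      pmul (length ys) (snd (fraction s)) (snd (fraction t)))"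

lemma fval_fraction':
  "pval ys (snd (fraction s)) \<noteq> 0 \<and> fval ys s = pval ys (fst (fraction s)) / pval ys (snd (fraction s))"
proof (induction s)
  case (Gen i)
  have "(\<Prod>j<length ys. ys ! j ^ nth_default 0 (map (\<lambda>j. if j = i then 1 else 0) [0..<length ys]) j)
    = (\<Prod>j<length ys. if j = i then ys ! j else 1)"
    by (intro prod.cong) (auto simp: nth_default_map_upt)
  then show ?case by (simp add: mon_def prod.delta)
next
  case (Add s t)
  then show ?case by (simp add: pval_pmul field_simps)
qed (auto simp: pval_uminus[unfolded One_nat_def] pval_pmul)

lemma computable_fraction: "computable fraction"
proof -
  have "\<exists>G. computable G \<and> (\<forall>s. G (enc s) = fraction s)"
    by (rule computable_fexpr_rec[where
          gen = "\<lambda>i. (if i < length ys then [map (\<lambda>j. if j = i then 1 else 0) [0..<length ys]] else [], [[]])"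
          and one = "([[]], [[]])"
          and neg = "\<lambda>x. (concat (replicate (p - 1) (fst x)), snd x)"
          and vin = "\<lambda>x. if pval ys (fst x) = 0 then ([], [[]]) else (snd x, fst x)"
          and add = "\<lambda>x y. (pmul (length ys) (fst x) (snd y) @ pmul (length ys) (fst y) (snd x),
              pmul (length ys) (snd x) (snd y))"
          and mul = "\<lambda>x y. (pmul (length ys) (fst x) (fst y), pmul (length ys) (snd x) (snd y))"])
      (simp_all, (intro comp_intro computable_comp[OF computable_pval_zero])+)
  then obtain G where G: "computable G" "\<And>s. G (enc s) = fraction s" by blast
  have "computable (\<lambda>s. G (enc (s :: fexpr)))" by (intro comp_intro computable_comp[OF G(1)])
  then show ?thesis by (simp add: G(2))
qed

lemma computable_fval_zero: "computable (\<lambda>s. fval ys s = 0)"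
proof -
  have "(\<lambda>s. fval ys s = 0) = (\<lambda>s. pval ys (fst (fraction s)) = 0)"
    using fval_fraction' by auto
  then show ?thesis
    using computable_comp[OF computable_pval_zero computable_fst[OF computable_fraction]] by simp
qed

subsection \<open>Finite sets closed under taking digits\<close>

text \<open>Infinitely many lists satisfy the bound, but multiplicities matter only modulo
  \<open>p\<close>, so finitely many coefficient vectors produce all values.\<close>

lemma finite_pvals: "finite (pval ys ` {f. pbound k f})"
proof -
  let ?L = "List.n_lists (length ys) [0..<Suc k]"
  let ?g = "\<lambda>v. \<Sum>i<length ?L. of_nat (v ! i) * mon ys (?L ! i)"
  have "counts k f \<in> {v. set v \<subseteq> {..<p} \<and> length v = length ?L}" for f
    unfolding counts_def using p_pos by (auto simp del: upt_Suc)
  then have "pval ys ` {f. pbound k f} \<subseteq> ?g ` {v. set v \<subseteq> {..<p} \<and> length v = length ?L}"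
    using pval_counts by (auto simp del: upt_Suc intro!: image_eqI)
  moreover have "finite {v :: nat list. set v \<subseteq> {..<p} \<and> length v = length ?L}"
    by (rule finite_lists_length_eq) simp
  ultimately show ?thesis by (meson finite_imageI finite_subset)
qed

lemma pval_mult_exists: "\<exists>h. pval ys h = pval ys f * pval ys g"
  using pval_pmul by blast

lemma pval_power_exists: "\<exists>h. pval ys h = pval ys f ^ n"
proof (induction n)
  case 0
  show ?case by (rule exI[of _ "[[]]"]) simp
next
  case (Suc n)
  then show ?case using pval_mult_exists[of f] by (metis power_Suc)
qed

lemma pbound_family:
  assumes "finite I" shows "\<exists>m. \<forall>i\<in>I. pbound m (f i)"
  using assms
proof (induction I)
  case (insert i I)
  then obtain m where m: "\<forall>i\<in>I. pbound m (f i)" by blast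
  obtain m' where m': "pbound m' (f i)" using pbound_exists by blast
  have "\<forall>k\<in>insert i I. pbound (max m m') (f k)"
    using m m' by (auto intro: pbound_mono)
  then show ?case ..
qed simp

text \<open>Multiplication by a fixed element and passage to digits roughly divides degrees by \<open>p\<close>,
  so the fractions with a suitable common denominator and bounded numerator form a closed set.\<close>

lemma digit_closed_exists:
  assumes A: "finite A" "A \<subseteq> F" and M: "finite M" "M \<subseteq> F"
  shows "\<exists>W. finite W \<and> A \<subseteq> W \<and> W \<subseteq> F \<and>
    (\<forall>w\<in>W. \<forall>g\<in>M. \<exists>u. (\<forall>j<length bs. u j \<in> W) \<and> w * g = (\<Sum>j<length bs. u j ^ p * bs ! j))"
proof -
  obtain d N c where d: "pval ys d \<noteq> 0" and c: "\<forall>r\<in>residues. \<forall>j<length bs. pbound c (N (r, j))"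
    and red: "\<And>f. pval ys d ^ p * pval ys f
        = (\<Sum>j<length bs. pval ys (reduce (length ys) p N f j) ^ p * bs ! j)"
    using reduce_exists by blast
  obtain e \<kappa> where e: "pval ys e \<noteq> 0" and \<kappa>: "\<forall>g\<in>M. pval ys e * g = pval ys (\<kappa> g)"
    using common_denominator[OF M(1), of "\<lambda>g. g"] M(2) by blast
  obtain e' \<alpha> where e': "pval ys e' \<noteq> 0" and \<alpha>: "\<forall>a\<in>A. pval ys e' * a = pval ys (\<alpha> a)"
    using common_denominator[OF A(1), of "\<lambda>a. a"] A(2) by blast
  \<comment> \<open>The digits of \<open>w * g\<close> must have the same denominator
    \<open>\<Delta>\<close> as \<open>w\<close>. As \<open>\<Delta> = Y * d\<close> and
    \<open>Y ^ p\<close> is \<open>\<Delta> * e\<close> times a polynomial value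
    \<open>\<rho>\<close>, the product \<open>w * g * \<Delta> ^ p\<close> is \<open>d ^ p\<close>
    times a polynomial value, whose digits are polynomial values by \<open>red\<close>. The factor
    \<open>e'\<close> is there for \<open>A\<close>.\<close>
  define Y where "Y = pval ys d * pval ys e * pval ys e'"
  define \<Delta> where "\<Delta> = Y * pval ys d"
  have nz: "Y \<noteq> 0" "\<Delta> \<noteq> 0" using d e e' by (simp_all add: Y_def \<Delta>_def)
  obtain \<rho> where \<rho>: "pval ys \<rho> = pval ys e' * Y ^ (p - 2)"
    unfolding Y_def using pval_mult_exists pval_power_exists by metis
  obtain z where z: "pval ys z = pval ys e * pval ys d ^ 2"
    using pval_mult_exists pval_power_exists by metis
  have Yp: "Y ^ p = \<Delta> * pval ys e * pval ys \<rho>"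
  proof -
    have "2 + (p - 2) = p" using p_ge2 by simp
    then have "Y ^ p = Y ^ (2 + (p - 2))" by (simp only:)
    also have "\<dots> = Y * Y * Y ^ (p - 2)" by (simp only: power_add power2_eq_square)
    also have "\<dots> = \<Delta> * pval ys e * (pval ys e' * Y ^ (p - 2))"
      by (simp add: \<Delta>_def Y_def ac_simps)
    finally show ?thesis by (simp add: \<rho>)
  qed
  let ?n = "length ys"
  obtain m2 where m2: "\<forall>g\<in>M. pbound m2 (pmul ?n (\<kappa> g) \<rho>)" using pbound_family[OF M(1), of "\<lambda>g. pmul ?n (\<kappa> g) \<rho>"] by blast
  obtain m3 where m3: "\<forall>a\<in>A. pbound m3 (pmul ?n (\<alpha> a) z)" using pbound_family[OF A(1), of "\<lambda>a. pmul ?n (\<alpha> a) z"] by blast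
  \<comment> \<open>\<open>m \<ge> m2 + 2 * c\<close> gives
    \<open>(m + m2) div 2 + c \<le> m\<close>, so the bound reproduces itself; \<open>m3\<close>
    makes room for the elements of \<open>A\<close>.\<close>
  define m where "m = m2 + 2 * c + m3"
  define W where "W = (\<lambda>x. x / \<Delta>) ` pval ys ` {f. pbound m f}"
  have "\<Delta> \<in> F" unfolding \<Delta>_def Y_def by (intro gen_field_intros pval_gen_field)
  then have "W \<subseteq> F" unfolding W_def by (auto intro!: gen_field_divide pval_gen_field)
  moreover have "finite W" unfolding W_def using finite_pvals by blast
  moreover have "A \<subseteq> W"
  proof
    fix a assume a: "a \<in> A"
    have "pval ys (\<alpha> a) = pval ys e' * a" using \<alpha> a by simp
    then have "a = pval ys (pmul ?n (\<alpha> a) z) / \<Delta>"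
      using d e e' by (simp add: pval_pmul z \<Delta>_def Y_def power2_eq_square)
    moreover have "pbound m (pmul ?n (\<alpha> a) z)" using m3 a by (auto simp: m_def intro: pbound_mono)
    ultimately show "a \<in> W" unfolding W_def by blast
  qed
  moreover have cl: "\<exists>u. (\<forall>j<length bs. u j \<in> W) \<and> w * g = (\<Sum>j<length bs. u j ^ p * bs ! j)"
    if w: "w \<in> W" and g: "g \<in> M" for w g
  proof -
    obtain f where f: "pbound m f" "w = pval ys f / \<Delta>" using w unfolding W_def by blast
    let ?h = "pmul ?n f (pmul ?n (\<kappa> g) \<rho>)"
    let ?r = "\<lambda>j. pval ys (reduce ?n p N ?h j)"
    have h: "pbound (m + m2) ?h" using f m2 g by (auto intro: pbound_pmul)
    have "(m + m2) div p \<le> (m + m2) div 2" by (rule div_le_mono2) (use p_ge2 in auto)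
    then have le: "(m + m2) div p + c \<le> m" unfolding m_def by linarith
    have "?r j / \<Delta> \<in> W" if "j < length bs" for j
      using pbound_mono[OF reduce_bound[OF c h that] le] unfolding W_def by blast
    moreover have "w * g = (\<Sum>j<length bs. (?r j / \<Delta>) ^ p * bs ! j)"
    proof -
      have "pval ys (\<kappa> g) = pval ys e * g" using \<kappa> g by simp
      then have "pval ys ?h = w * g * Y ^ p"
        using nz f(2) by (simp add: pval_pmul Yp)
      then have "w * g = pval ys d ^ p * pval ys ?h / \<Delta> ^ p"
        using nz d by (simp add: \<Delta>_def power_mult_distrib)
      then show ?thesis by (simp add: red sum_divide_distrib power_divide)
    qed
    ultimately show ?thesis by (intro exI[of _ "\<lambda>j. ?r j / \<Delta>"]) simp
  qed
  ultimately show ?thesis by (intro exI[of _ W] conjI ballI cl)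
qed

end

subsection \<open>Spaces of linear forms\<close>

definition fscale :: "'a::field \<Rightarrow> (nat \<Rightarrow> 'a) \<Rightarrow> nat \<Rightarrow> 'a" where
  "fscale c f = (\<lambda>i. c * f i)"

lemma fscale_apply: "fscale c f i = c * f i"
  by (simp add: fscale_def)

global_interpretation fvec: vector_space "fscale :: 'a::field \<Rightarrow> (nat \<Rightarrow> 'a) \<Rightarrow> nat \<Rightarrow> 'a"
  by unfold_locales (auto simp: fscale_def fun_eq_iff algebra_simps)

text \<open>The ambient space of all functions on the natural numbers has infinite dimension, so
  finite generation accompanies every comparison of dimensions.\<close>

definition fin_gen :: "(nat \<Rightarrow> 'a::field) set \<Rightarrow> bool" where
  "fin_gen V \<longleftrightarrow> (\<exists>S. finite S \<and> V = fvec.span S)"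

lemma fin_gen_subspace: "fin_gen V \<Longrightarrow> fvec.subspace V"
  by (auto simp: fin_gen_def)

lemma fin_gen_basis:
  assumes "fin_gen V"
  obtains B where "finite B" "B \<subseteq> V" "fvec.independent B" "fvec.span B = V" "card B = fvec.dim V"
proof -
  obtain S where S: "finite S" "V = fvec.span S" using assms by (auto simp: fin_gen_def)
  obtain B where B: "B \<subseteq> S" "fvec.independent B" "S \<subseteq> fvec.span B"
    using fvec.maximal_independent_subset[of S] by blast
  have "fvec.span B = V"
    using B(1,3) S(2) by (metis fvec.span_mono fvec.span_minimal fvec.subspace_span subset_antisym)
  moreover have "card B = fvec.dim V"
    using fvec.dim_eq_card[of B V] B(2) calculation by (simp add: fvec.span_span flip: S(2))
      (metis S(2) fvec.span_span)
  moreover have "finite B" using B(1) S(1) finite_subset by blast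
  moreover have "B \<subseteq> V" using B(1) S(2) fvec.span_superset by blast
  ultimately show thesis using that B(2) by blast
qed

lemma fin_gen_dim_mono:
  assumes "V \<subseteq> V'" "fin_gen V'" shows "fvec.dim V \<le> fvec.dim V'"
proof -
  obtain B where "finite B" "fvec.span B = V'" "card B = fvec.dim V'"
    using fin_gen_basis[OF assms(2)] by metis
  then show ?thesis using fvec.dim_le_card[of V B] assms(1) by simp
qed

lemma fin_gen_eqI:
  assumes "V \<subseteq> V'" "fin_gen V" "fin_gen V'" "fvec.dim V' \<le> fvec.dim V" shows "V = V'"
proof (rule ccontr)
  assume "V \<noteq> V'"
  then obtain v where v: "v \<in> V'" "v \<notin> V" using assms(1) by blast
  obtain B where B: "finite B" "fvec.independent B" "fvec.span B = V" "card B = fvec.dim V" "B \<subseteq> V"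
    using fin_gen_basis[OF assms(2)] by metis
  obtain B' where B': "finite B'" "fvec.span B' = V'" "card B' = fvec.dim V'"
    using fin_gen_basis[OF assms(3)] by metis
  have "fvec.independent (insert v B)" using B(2,3) v(2) by (simp add: fvec.independent_insertI)
  moreover have "insert v B \<subseteq> fvec.span B'" using B B'(2) v(1) assms(1) by auto
  ultimately have "card (insert v B) \<le> card B'"
    using fvec.independent_span_bound[OF B'(1)] by blast
  moreover have "v \<notin> B" using v(2) B(5) by blast
  ultimately show False using B(1,4) B'(3) assms(4) by simp
qed

lemma fvec_sum_apply:
  fixes f :: "'b \<Rightarrow> nat \<Rightarrow> 'a::comm_monoid_add"
  shows "(\<Sum>i\<in>A. f i) x = (\<Sum>i\<in>A. f i x)"
  by (induction A rule: infinite_finite_induct) auto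

section \<open>Diagonal maps acting on forms\<close>

lemma mult_linear:
  fixes g :: "nat \<Rightarrow> 'a::field"
  shows "fvec.span ((*) g ` S) = (*) g ` fvec.span S"
proof -
  interpret Vector_Spaces.linear fscale fscale "(*) g"
    by unfold_locales (auto simp: fun_eq_iff fscale_apply algebra_simps)
  show ?thesis by (rule span_image)
qed

lemma fin_gen_mult: "fin_gen V \<Longrightarrow> fin_gen ((*) g ` V)"
  unfolding fin_gen_def using mult_linear by blast

lemma dim_mult_le:
  assumes "fin_gen V" shows "fvec.dim ((*) g ` V) \<le> fvec.dim V"
proof -
  obtain B where B: "finite B" "fvec.span B = V" "card B = fvec.dim V"
    using fin_gen_basis[OF assms] by metis
  have "fvec.dim ((*) g ` V) \<le> card ((*) g ` B)"
    by (rule fvec.dim_le_card) (use B in \<open>simp_all add: mult_linear\<close>)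
  also have "\<dots> \<le> card B" using B(1) by (rule card_image_le)
  finally show ?thesis using B(3) by simp
qed

definition nonvan :: "(nat \<Rightarrow> 'a::field) \<Rightarrow> bool" where
  "nonvan g \<longleftrightarrow> (\<forall>i. g i \<noteq> 0)"

definition vinv :: "(nat \<Rightarrow> 'a::field) \<Rightarrow> nat \<Rightarrow> 'a" where
  "vinv g = (\<lambda>i. inverse (g i))"

lemma vinv_apply: "vinv g i = inverse (g i)"
  by (simp add: vinv_def)

lemma nonvan_vinv [simp]: "nonvan g \<Longrightarrow> nonvan (vinv g)" "nonvan g \<Longrightarrow> vinv g * g = 1"
  "nonvan g \<Longrightarrow> g * vinv g = 1"
  by (auto simp: nonvan_def fun_eq_iff fscale_apply vinv_apply)

lemma nonvan_mult: "nonvan f \<Longrightarrow> nonvan g \<Longrightarrow> nonvan (f * g)"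
  by (auto simp: nonvan_def)

lemma mult_image_image:
  fixes f g :: "nat \<Rightarrow> 'a::field"
  shows "(*) f ` (*) g ` V = (*) (f * g) ` V"
  by (simp add: image_image mult.assoc)

lemma mult_image_cancel: "nonvan g \<Longrightarrow> (*) (vinv g) ` (*) g ` V = V"
  by (simp add: mult_image_image)

lemma dim_mult_eq:
  assumes "fin_gen V" "nonvan g" shows "fvec.dim ((*) g ` V) = fvec.dim V"
  using dim_mult_le[OF assms(1), of g] dim_mult_le[OF fin_gen_mult[OF assms(1)], of "vinv g" g]
    mult_image_cancel[OF assms(2), of V] by simp

section \<open>Frobenius acting on forms\<close>

context char_p_field
begin

definition frv :: "nat \<Rightarrow> (nat \<Rightarrow> 'a) \<Rightarrow> nat \<Rightarrow> 'a" where
  "frv s f = (\<lambda>i. f i ^ (p ^ s))"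

lemma frv_apply: "frv s f i = f i ^ (p ^ s)"
  by (simp add: frv_def)

lemma frv_mult: "frv s (f * g) = frv s f * frv s g"
  by (auto simp: fun_eq_iff fscale_apply vinv_apply frv_apply power_mult_distrib)

lemma frv_frv: "frv s (frv t f) = frv (s + t) f"
  by (auto simp: fun_eq_iff fscale_apply vinv_apply frv_apply power_add mult.commute simp flip: power_mult)

lemma frv_0 [simp]: "frv 0 f = f"
  by (auto simp: fun_eq_iff fscale_apply vinv_apply frv_apply)

lemma frv_1 [simp]: "frv s 1 = 1"
  by (auto simp: fun_eq_iff fscale_apply vinv_apply frv_apply)

lemma frv_vinv: "frv s (vinv f) = vinv (frv s f)"
  by (auto simp: fun_eq_iff fscale_apply vinv_apply frv_apply power_inverse)

lemma nonvan_frv: "nonvan f \<Longrightarrow> nonvan (frv s f)"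
  by (simp add: nonvan_def frv_apply)

text \<open>The image of a subspace is closed only under scalars that are \<open>p ^ s\<close>-th
  powers, and the field need not be perfect; hence the span.\<close>

definition Fr :: "nat \<Rightarrow> (nat \<Rightarrow> 'a) set \<Rightarrow> (nat \<Rightarrow> 'a) set" where
  "Fr s V = fvec.span (frv s ` V)"

lemma Fr_span: "Fr s (fvec.span S) = fvec.span (frv s ` S)"
proof (rule subset_antisym)
  have "frv s f \<in> fvec.span (frv s ` S)" if "f \<in> fvec.span S" for f
    using that
  proof (induction rule: fvec.span_induct_alt)
    case base
    have "frv s 0 = 0" using p_pos by (auto simp: fun_eq_iff fscale_apply vinv_apply frv_apply power_0_left)
    then show ?case by (simp only: fvec.span_zero)
  next
    case (step c x y)
    have eq: "frv s (fscale c x + y) = fscale (c ^ (p ^ s)) (frv s x) + frv s y"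
      by (auto simp: fun_eq_iff fscale_apply vinv_apply frv_apply frob_add power_mult_distrib)
    show ?case unfolding eq
      by (intro fvec.span_add fvec.span_scale step fvec.span_base imageI)
  qed
  then show "Fr s (fvec.span S) \<subseteq> fvec.span (frv s ` S)"
    unfolding Fr_def by (intro fvec.span_minimal) auto
  show "fvec.span (frv s ` S) \<subseteq> Fr s (fvec.span S)"
    unfolding Fr_def by (intro fvec.span_mono image_mono fvec.span_superset)
qed

lemma Fr_mono: "V \<subseteq> V' \<Longrightarrow> Fr s V \<subseteq> Fr s V'"
  unfolding Fr_def by (intro fvec.span_mono image_mono)

lemma Fr_Fr: "Fr s (Fr t V) = Fr (s + t) V"
  by (simp add: Fr_span Fr_def[of t] Fr_def[of "s + t"] image_image frv_frv)

lemma Fr_0: "fvec.subspace V \<Longrightarrow> Fr 0 V = V"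
  by (simp add: Fr_def fvec.span_eq_iff)

lemma Fr_mult: "Fr s ((*) g ` V) = (*) (frv s g) ` Fr s V"
proof -
  have "frv s ` (*) g ` V = (*) (frv s g) ` frv s ` V"
    by (simp add: image_image frv_mult)
  then show ?thesis by (simp add: Fr_def mult_linear)
qed

lemma fin_gen_Fr: "fin_gen V \<Longrightarrow> fin_gen (Fr s V)"
  unfolding fin_gen_def using Fr_span by blast

lemma dim_Fr_le:
  assumes "fin_gen V" shows "fvec.dim (Fr s V) \<le> fvec.dim V"
proof -
  obtain B where B: "finite B" "fvec.span B = V" "card B = fvec.dim V"
    using fin_gen_basis[OF assms] by metis
  have "fvec.dim (Fr s V) \<le> card (frv s ` B)"
    by (rule fvec.dim_le_card) (use B in \<open>auto simp flip: B(2) simp: Fr_span\<close>)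
  also have "\<dots> \<le> card B" using B(1) by (rule card_image_le)
  finally show ?thesis using B(3) by simp
qed

end

section \<open>Common zeros of a space of forms, and the resulting bound on its dimension\<close>

definition perp :: "nat \<Rightarrow> (nat \<Rightarrow> 'a::field) set \<Rightarrow> (nat \<Rightarrow> 'a) \<Rightarrow> bool" where
  "perp n V z \<longleftrightarrow> (\<forall>f\<in>V. (\<Sum>i\<le>n. f i * z i) = 0)"

text \<open>For the span of a single form this is the condition on proper subsums in \<open>H\<^sup>*(G)\<close>.\<close>

definition nondeg :: "nat \<Rightarrow> (nat \<Rightarrow> 'a::field) set \<Rightarrow> (nat \<Rightarrow> 'a) \<Rightarrow> bool" where
  "nondeg n V z \<longleftrightarrow> (\<forall>A. A \<noteq> {} \<longrightarrow> A \<subset> {..n} \<longrightarrow> (\<exists>f\<in>V. (\<Sum>i\<in>A. f i * z i) \<noteq> 0))"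

lemma span_sum_zero:
  assumes "\<forall>f\<in>S. (\<Sum>i\<in>A. f i * z i) = 0" "f \<in> fvec.span S"
  shows "(\<Sum>i\<in>A. f i * z i) = (0 :: 'a::field)"
  using assms(2)
proof (induction rule: fvec.span_induct_alt)
  case (step c x y)
  have "(\<Sum>i\<in>A. (fscale c x + y) i * z i) = c * (\<Sum>i\<in>A. x i * z i) + (\<Sum>i\<in>A. y i * z i)"
    by (simp add: fscale_apply algebra_simps sum.distrib sum_distrib_left)
  then show ?case using step assms(1) by simp
qed simp

lemma perp_span: "perp n (fvec.span S) z \<longleftrightarrow> perp n S z"
  unfolding perp_def using span_sum_zero[where S = S and A = "{..n}" and z = z] fvec.span_base by blast

lemma perp_mult: "perp n ((*) g ` V) z \<longleftrightarrow> perp n V (g * z)"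
  by (simp add: perp_def ac_simps)

lemma perp_mono: "perp n V z \<Longrightarrow> V' \<subseteq> V \<Longrightarrow> perp n V' z"
  by (auto simp: perp_def)

lemma (in char_p_field) perp_Fr:
  assumes "perp n V z" shows "perp n (Fr s V) (frv s z)"
proof -
  have "(\<Sum>i\<le>n. frv s f i * frv s z i) = (\<Sum>i\<le>n. f i * z i) ^ (p ^ s)" for f
    by (simp add: frob_sum power_mult_distrib frv_apply)
  then show ?thesis using assms p_pos unfolding Fr_def perp_span by (auto simp: perp_def power_0_left)
qed

definition vsupp :: "nat \<Rightarrow> (nat \<Rightarrow> 'a::zero) set" where
  "vsupp n = {f. \<forall>i>n. f i = 0}"

lemma subspace_vsupp: "fvec.subspace (vsupp n)"
  by (auto simp: vsupp_def fvec.subspace_def fscale_apply)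

definition unit_vec :: "nat \<Rightarrow> nat \<Rightarrow> 'a::field" where
  "unit_vec i = (\<lambda>j. if j = i then 1 else 0)"

lemma perp_subset_hyperplane:
  assumes "V \<subseteq> vsupp n" "perp n V z" "z 0 = 1"
  shows "V \<subseteq> fvec.span ((\<lambda>i. unit_vec i - fscale (z i) (unit_vec 0)) ` {1..n})"
proof
  fix f assume f: "f \<in> V"
  let ?e = "\<lambda>i. unit_vec i - fscale (z i) (unit_vec 0)"
  have "(\<Sum>i\<le>n. f i * z i) = 0" using assms(2) f by (simp add: perp_def)
  also have "{..n} = insert 0 {1..n}" by auto
  finally have f0: "f 0 = - (\<Sum>i=1..n. f i * z i)" using assms(3) by (simp add: eq_neg_iff_add_eq_0)
  have "f = (\<Sum>i=1..n. fscale (f i) (?e i))"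
  proof
    fix j
    have "(\<Sum>i=1..n. fscale (f i) (?e i)) j = (\<Sum>i=1..n. (if i = j then f i else 0) - f i * z i * unit_vec 0 j)"
      unfolding fvec_sum_apply by (intro sum.cong refl) (auto simp: unit_vec_def fscale_apply)
    also have "\<dots> = (if j \<in> {1..n} then f j else 0) - (\<Sum>i=1..n. f i * z i) * unit_vec 0 j"
      by (simp add: sum_subtractf sum_distrib_right)
    also have "\<dots> = f j"
      using f assms(1) f0 by (cases "j = 0") (auto simp: unit_vec_def vsupp_def)
    finally show "f j = (\<Sum>i=1..n. fscale (f i) (?e i)) j" by simp
  qed
  then show "f \<in> fvec.span (?e ` {1..n})"
    by (metis (no_types, lifting) fvec.span_base fvec.span_scale fvec.span_sum imageI)
qed

lemma perp_dim_le:
  assumes "V \<subseteq> vsupp n" "perp n V z" "z 0 = 1" shows "fvec.dim V \<le> n"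
proof -
  let ?D = "(\<lambda>i. unit_vec i - fscale (z i) (unit_vec 0)) ` {1..n}"
  have "fvec.dim V \<le> card ?D" using perp_subset_hyperplane[OF assms] by (rule fvec.dim_le_card) simp
  also have "\<dots> \<le> n" using card_image_le[of "{1..n}"] by simp
  finally show ?thesis .
qed

text \<open>A space of dimension \<open>n\<close> is the whole annihilator of \<open>z\<close>. It
  therefore contains \<open>X\<^sub>i - z\<^sub>i X\<^sub>0\<close> for each \<open>i\<close>, and
  these forms determine a point with coordinate 1 at index 0.\<close>

lemma perp_dim_unique:
  assumes V: "V \<subseteq> vsupp n" "fin_gen V" "fvec.dim V = n" and z: "perp n V z" "z 0 = 1"
    and y: "perp n V y" "y 0 = 1" and i: "i \<le> n"
  shows "y i = z i"
proof (cases "i = 0")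
  case False
  let ?e = "\<lambda>i. unit_vec i - fscale (z i) (unit_vec 0)"
  let ?D = "?e ` {1..n}"
  have sub: "V \<subseteq> fvec.span ?D" using V(1) z by (rule perp_subset_hyperplane)
  have "fvec.dim (fvec.span ?D) \<le> card ?D" by (rule fvec.dim_le_card) auto
  also have "\<dots> \<le> n" using card_image_le[of "{1..n}"] by simp
  finally have "V = fvec.span ?D"
    using sub V by (intro fin_gen_eqI) (auto simp: fin_gen_def)
  then have "?e i \<in> V" using False i by (auto intro!: fvec.span_base)
  then have "(\<Sum>j\<le>n. ?e i j * y j) = 0" using y(1) unfolding perp_def by (rule bspec[rotated])
  moreover have "(\<Sum>j\<le>n. ?e i j * y j) = (\<Sum>j\<le>n. (if j = i then y j else 0) - (if j = 0 then z i * y j else 0))"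
    by (intro sum.cong) (auto simp: unit_vec_def fscale_apply algebra_simps)
  ultimately show ?thesis using i y(2) by (simp add: sum_subtractf)
qed (use z y in simp)

subsection \<open>Forms of minimal support\<close>

definition fsupp :: "(nat \<Rightarrow> 'a::zero) \<Rightarrow> nat set" where
  "fsupp f = {i. f i \<noteq> 0}"

definition vecs :: "nat \<Rightarrow> 'a::field set \<Rightarrow> (nat \<Rightarrow> 'a) set" where
  "vecs n W = {f. (\<forall>i\<le>n. f i \<in> W) \<and> (\<forall>i>n. f i = 0)}"

text \<open>The coefficients that arise when \<open>k\<close> variables are eliminated from linear forms with
  coefficients in \<open>W\<close>.\<close>

primrec elim_closure :: "nat \<Rightarrow> 'a::field set \<Rightarrow> 'a set" where
  "elim_closure 0 W = W"
| "elim_closure (Suc k) W = elim_closure k W \<union>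
     {x * y - z * w | x y z w. x \<in> elim_closure k W \<and> y \<in> elim_closure k W \<and>
        z \<in> elim_closure k W \<and> w \<in> elim_closure k W}"

lemma elim_closure_step:
  "x \<in> elim_closure k W \<Longrightarrow> y \<in> elim_closure k W \<Longrightarrow> z \<in> elim_closure k W \<Longrightarrow>
    w \<in> elim_closure k W \<Longrightarrow> x * y - z * w \<in> elim_closure (Suc k) W"
  by auto

lemma elim_closure_mono: "k \<le> l \<Longrightarrow> elim_closure k W \<subseteq> elim_closure l W"
  by (rule lift_Suc_mono_le[of "\<lambda>k. elim_closure k W"]) auto

lemma vecs_mono: "W \<subseteq> W' \<Longrightarrow> vecs n W \<subseteq> vecs n W'"
  by (auto simp: vecs_def fscale_apply)

text \<open>Gaussian elimination by cross-multiplication. Avoiding division keeps the coefficients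
  in a set built from \<open>W\<close> by finitely many products and differences.\<close>

lemma eliminate:
  assumes "finite A" "S \<subseteq> vecs n W"
  shows "\<exists>S'. S' \<subseteq> vecs n (elim_closure (card A) W) \<and> fvec.span S' = {f \<in> fvec.span S. \<forall>a\<in>A. f a = 0}"
  using assms(1)
proof (induction A)
  case empty
  show ?case using assms(2) by (intro exI[of _ S]) auto
next
  case (insert a A)
  let ?W = "elim_closure (card A) W" let ?W' = "elim_closure (card (insert a A)) W"
  have card: "card (insert a A) = Suc (card A)" using insert.hyps by simp
  obtain T where T: "T \<subseteq> vecs n ?W" "fvec.span T = {f \<in> fvec.span S. \<forall>a\<in>A. f a = 0}"
    using insert.IH by blast
  have goal: "{f \<in> fvec.span S. \<forall>b\<in>insert a A. f b = 0} = {f \<in> fvec.span T. f a = 0}"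
    using T(2) by auto
  show ?case
  proof (cases "\<forall>t\<in>T. t a = 0")
    case True
    have "f a = 0" if "f \<in> fvec.span T" for f
      using that by (induction rule: fvec.span_induct_alt) (use True in \<open>auto simp: fscale_apply\<close>)
    then have "fvec.span T = {f \<in> fvec.span T. f a = 0}" by blast
    moreover have "T \<subseteq> vecs n ?W'"
      using T(1) vecs_mono[OF elim_closure_mono, of "card A" "card (insert a A)"] card by fastforce
    ultimately show ?thesis using goal by (intro exI[of _ T]) simp
  next
    case False
    then obtain s where s: "s \<in> T" "s a \<noteq> 0" by blast
    let ?c = "\<lambda>s t. fscale (s a) t - fscale (t a) s"
    define T' where "T' = {?c s t | s t. s \<in> T \<and> t \<in> T}"
    have T'_sub: "T' \<subseteq> vecs n ?W'"
    proof
      fix f assume "f \<in> T'"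
      then obtain u t where f: "f = ?c u t" "u \<in> T" "t \<in> T" by (auto simp: T'_def)
      have ut: "u \<in> vecs n ?W" "t \<in> vecs n ?W" using T(1) f by auto
      have fi: "f i = u a * t i - t a * u i" for i by (simp add: f(1) fscale_apply)
      have "f i \<in> ?W'" if i: "i \<le> n" for i
      proof (cases "a \<le> n")
        case True
        then show ?thesis using ut i unfolding card fi
          by (intro elim_closure_step) (auto simp: vecs_def)
      next
        case False
        \<comment> \<open>Zero is written as a difference of two equal products, because
          \<open>W\<close> is not assumed to contain 0.\<close>
        then have "f i = u i * t i - u i * t i" using ut unfolding fi by (auto simp: vecs_def)
        moreover have "u i * t i - u i * t i \<in> ?W'" using ut i unfolding card
          by (intro elim_closure_step) (auto simp: vecs_def)
        ultimately show ?thesis by (simp only:)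
      qed
      moreover have "\<forall>i>n. f i = 0" using ut f(1) by (auto simp: vecs_def fscale_apply)
      ultimately show "f \<in> vecs n ?W'" by (auto simp: vecs_def fscale_apply)
    qed
    have "fvec.span T' \<subseteq> {f \<in> fvec.span T. f a = 0}"
    proof (rule fvec.span_minimal)
      show "T' \<subseteq> {f \<in> fvec.span T. f a = 0}"
        by (auto simp: T'_def fscale_apply intro!: fvec.span_diff fvec.span_scale intro: fvec.span_base)
      show "fvec.subspace {f \<in> fvec.span T. f a = 0}"
        by (auto simp: fvec.subspace_def fscale_apply intro: fvec.span_add fvec.span_scale fvec.span_zero)
    qed
    moreover have "f \<in> fvec.span T'" if f: "f \<in> fvec.span T" "f a = 0" for f
    proof -
      have "f - fscale (f a / s a) s \<in> fvec.span T'"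
        using f(1)
      proof (induction rule: fvec.span_induct_alt)
        case base
        have "0 - fscale (0 a / s a) s = 0" by (auto simp: fun_eq_iff fscale_apply)
        then show ?case by (simp only: fvec.span_zero)
      next
        case (step c x y)
        have "?c s x \<in> fvec.span T'" using s(1) step.hyps by (auto simp: T'_def intro!: fvec.span_base)
        moreover have "fscale c x + y - fscale ((fscale c x + y) a / s a) s
            = fscale (c / s a) (?c s x) + (y - fscale (y a / s a) s)"
          using s(2) by (auto simp: fun_eq_iff fscale_apply field_simps)
        ultimately show ?case
          using step.IH by (simp only: fvec.span_add fvec.span_scale)
      qed
      moreover have "f - fscale (f a / s a) s = f" using f(2) by (auto simp: fun_eq_iff fscale_apply)
      ultimately show ?thesis by simp
    qed
    ultimately have "fvec.span T' = {f \<in> fvec.span T. f a = 0}" by blast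
    then show ?thesis using T'_sub goal by (intro exI[of _ T']) simp
  qed
qed

text \<open>The supports of these forms are the circuits of a matroid on the indices of the
  variables.\<close>

definition circuit :: "(nat \<Rightarrow> 'a::field) set \<Rightarrow> (nat \<Rightarrow> 'a) \<Rightarrow> bool" where
  "circuit V g \<longleftrightarrow> g \<in> V \<and> g \<noteq> 0 \<and> (\<forall>h\<in>V. h \<noteq> 0 \<longrightarrow> fsupp h \<subseteq> fsupp g \<longrightarrow> fsupp h = fsupp g)"

lemma fsupp_vecs: "f \<in> vsupp n \<Longrightarrow> fsupp f \<subseteq> {..n}"
  by (auto simp: fsupp_def fscale_apply vsupp_def) (metis not_le)

lemma vecs_subset_vsupp: "vecs n W \<subseteq> vsupp n"
  by (auto simp: vecs_def fscale_apply vsupp_def)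

lemma span_vecs_subset: "S \<subseteq> vecs n W \<Longrightarrow> fvec.span S \<subseteq> vsupp n"
  using vecs_subset_vsupp[of n W] subspace_vsupp by (intro fvec.span_minimal) auto

text \<open>Eliminating all variables outside a minimal support leaves a non-zero space with
  generators over \<open>elim_closure\<close>. By minimality each non-zero generator has the full
  support and is a circuit.\<close>

lemma circuit_exists:
  assumes S: "S \<subseteq> vecs n W" and V: "V = fvec.span S" and f: "f \<in> V" "f \<noteq> 0"
  shows "\<exists>g. circuit V g \<and> fsupp g \<subseteq> fsupp f \<and> g \<in> vecs n (elim_closure (Suc n) W)"
proof -
  let ?P = "\<lambda>h. h \<in> V \<and> h \<noteq> 0 \<and> fsupp h \<subseteq> fsupp f"
  have sub: "V \<subseteq> vsupp n" using span_vecs_subset[OF S] V by simp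
  have fin: "finite (fsupp h)" if "h \<in> V" for h
    using fsupp_vecs[of h n] that sub finite_subset by blast
  define h where "h = arg_min (\<lambda>h. card (fsupp h)) ?P"
  have h: "?P h" and min: "\<And>h'. ?P h' \<Longrightarrow> card (fsupp h) \<le> card (fsupp h')"
    using arg_min_nat_lemma[of ?P f "\<lambda>h. card (fsupp h)"] f unfolding h_def by blast+
  have same: "fsupp h' = fsupp h" if "h' \<in> V" "h' \<noteq> 0" "fsupp h' \<subseteq> fsupp h" for h'
    using min[of h'] that h fin[of h] by (meson card_seteq order_trans)
  let ?A = "{..n} - fsupp h"
  obtain S' where S': "S' \<subseteq> vecs n (elim_closure (card ?A) W)"
    "fvec.span S' = {f \<in> fvec.span S. \<forall>a\<in>?A. f a = 0}"
    using eliminate[of ?A S n W] S by auto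
  have "h \<in> fvec.span S'" using h S'(2) V by (auto simp: fsupp_def fscale_apply)
  then have "\<not> S' \<subseteq> {0}" using h
    by (metis fvec.span_empty fvec.span_insert_0 fvec.span_mono singletonD subset_singletonD subsetD)
  then obtain g where g: "g \<in> S'" "g \<noteq> 0" by blast
  have "g \<in> fvec.span S'" using g(1) by (rule fvec.span_base)
  then have gV: "g \<in> V" "\<forall>a\<in>?A. g a = 0" using S'(2) V by auto
  have "fsupp g \<subseteq> fsupp h"
    using gV fsupp_vecs[of g n] sub by (auto simp: fsupp_def fscale_apply)
  then have eq: "fsupp g = fsupp h" using same gV g by blast
  have "card ?A \<le> card {..n}" by (rule card_mono) auto
  then have "g \<in> vecs n (elim_closure (Suc n) W)"
    using g(1) S'(1) vecs_mono[OF elim_closure_mono[of "card ?A" "Suc n" W], of n] by auto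
  moreover have "circuit V g" unfolding circuit_def eq using gV(1) g(2) same by blast
  ultimately show ?thesis using eq h by (intro exI[of _ g]) simp
qed

text \<open>Cancelling one coordinate of the support leaves a form of smaller support, which
  vanishes by minimality.\<close>

lemma circuit_proportional:
  assumes V: "fvec.subspace V" and g: "circuit V g" and h: "h \<in> V" "fsupp h \<subseteq> fsupp g"
  shows "\<exists>c. h = fscale c g"
proof -
  obtain a where a: "g a \<noteq> 0" using g by (auto simp: circuit_def fun_eq_iff fscale_apply)
  let ?d = "h - fscale (h a / g a) g"
  have "?d \<in> V" using V g h by (auto intro!: fvec.subspace_diff fvec.subspace_scale simp: circuit_def)
  moreover have "fsupp ?d \<subseteq> fsupp g" using h(2) by (auto simp: fsupp_def fscale_apply)
  moreover have "a \<notin> fsupp ?d" "a \<in> fsupp g" using a by (auto simp: fsupp_def fscale_apply)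
  ultimately have "?d = 0" using g unfolding circuit_def by metis
  then show ?thesis by (intro exI[of _ "h a / g a"]) simp
qed

definition vrestrict :: "nat set \<Rightarrow> (nat \<Rightarrow> 'a::zero) \<Rightarrow> nat \<Rightarrow> 'a" where
  "vrestrict C f = (\<lambda>i. if i \<in> C then f i else 0)"

text \<open>Subtracting multiples of circuits reduces every form to zero with shrinking support. If
  no circuit crosses the boundary of \<open>C\<close>, restriction to \<open>C\<close> can be
  carried out on each circuit separately.\<close>

lemma circuits_split:
  assumes S: "S \<subseteq> vecs n W" and V: "V = fvec.span S"
    and C: "\<And>g. circuit V g \<Longrightarrow> g \<in> vecs n (elim_closure (Suc n) W) \<Longrightarrow> fsupp g \<subseteq> C \<or> fsupp g \<inter> C = {}"
    and f: "f \<in> V"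
  shows "vrestrict C f \<in> V"
  using f
proof (induction "card (fsupp f)" arbitrary: f rule: less_induct)
  case less
  have sub: "fvec.subspace V" unfolding V by simp
  have supp: "V \<subseteq> vsupp n" using span_vecs_subset[OF S] V by simp
  show ?case
  proof (cases "f = 0")
    case True
    then have "vrestrict C f = 0" by (auto simp: vrestrict_def fun_eq_iff fscale_apply)
    then show ?thesis using sub by (simp only: fvec.subspace_0)
  next
    case False
    obtain g where g: "circuit V g" "fsupp g \<subseteq> fsupp f" "g \<in> vecs n (elim_closure (Suc n) W)"
      using circuit_exists[OF S V less.prems False] by blast
    obtain a where a: "g a \<noteq> 0" using g(1) by (auto simp: circuit_def fun_eq_iff fscale_apply)
    let ?d = "f - fscale (f a / g a) g"
    have gV: "g \<in> V" using g(1) by (simp add: circuit_def)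
    have d: "?d \<in> V" using sub gV less.prems by (auto intro!: fvec.subspace_diff fvec.subspace_scale)
    have "fsupp ?d \<subseteq> fsupp f" using g(2) by (auto simp: fsupp_def fscale_apply)
    moreover have "a \<in> fsupp f" "a \<notin> fsupp ?d" using g(2) a by (auto simp: fsupp_def fscale_apply)
    ultimately have "fsupp ?d \<subset> fsupp f" by blast
    moreover have "finite (fsupp f)"
      using fsupp_vecs[of f n] supp less.prems finite_subset by blast
    ultimately have "card (fsupp ?d) < card (fsupp f)" by (simp add: psubset_card_mono)
    then have IH: "vrestrict C ?d \<in> V" using d by (rule less.hyps)
    have "vrestrict C g = g \<or> vrestrict C g = 0"
      using C[OF g(1,3)] by (auto simp: vrestrict_def fun_eq_iff fscale_apply fsupp_def)
    then have "vrestrict C g \<in> V" using gV fvec.subspace_0[OF sub] by auto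
    then have "vrestrict C ?d + fscale (f a / g a) (vrestrict C g) \<in> V"
      using IH sub by (auto intro!: fvec.subspace_add fvec.subspace_scale)
    moreover have "vrestrict C ?d + fscale (f a / g a) (vrestrict C g) = vrestrict C f"
      by (auto simp: vrestrict_def fun_eq_iff fscale_apply)
    ultimately show ?thesis by (simp only:)
  qed
qed

text \<open>If \<open>V\<close> splits along \<open>C\<close>, the equations at \<open>x\<close>
  hold for the part over \<open>C\<close> alone, so all subsums over \<open>C\<close>
  vanish.\<close>

lemma nondeg_not_split:
  assumes "nondeg n V x" "perp n V x" "C \<subseteq> {..n}" "C \<noteq> {}" "\<And>f. f \<in> V \<Longrightarrow> vrestrict C f \<in> V"
  shows "C = {..n}"
proof (rule ccontr)
  assume "C \<noteq> {..n}"
  then obtain f where f: "f \<in> V" "(\<Sum>i\<in>C. f i * x i) \<noteq> 0"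
    using assms(1,3,4) unfolding nondeg_def by blast
  have "(\<Sum>i\<le>n. vrestrict C f i * x i) = (\<Sum>i\<in>C. f i * x i)"
    using assms(3) by (intro sum.mono_neutral_cong_right) (auto simp: vrestrict_def)
  then show False using f assms(2,5) unfolding perp_def by metis
qed

text \<open>Nondegeneracy makes the indices connected through circuits: a property that holds at 0
  and spreads over the support of each circuit holds everywhere.\<close>

lemma nondeg_circuits:
  assumes S: "S \<subseteq> vecs n W" and V: "V = fvec.span S" and x: "nondeg n V x" "perp n V x"
    and C: "C \<subseteq> {..n}" "0 \<in> C"
    and closed: "\<And>g a b. circuit V g \<Longrightarrow> g \<in> vecs n (elim_closure (Suc n) W) \<Longrightarrow>
      a \<in> fsupp g \<Longrightarrow> b \<in> fsupp g \<Longrightarrow> a \<in> C \<Longrightarrow> b \<in> C"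
  shows "C = {..n}"
proof (rule nondeg_not_split[OF x])
  show "vrestrict C f \<in> V" if "f \<in> V" for f
    by (rule circuits_split[OF S V _ that]) (use closed in blast)
qed (use C in auto)

text \<open>\<open>t\<close> sends a circuit to a form supported in the same set, hence to a
  multiple of it. So \<open>t\<close> is constant on the support of every circuit, and connectedness
  makes it constant altogether.\<close>

lemma stabilizer_trivial:
  assumes S: "S \<subseteq> vecs n W" and V: "V = fvec.span S" and x: "nondeg n V x" "perp n V x"
    and t: "nonvan t" "(*) t ` V \<subseteq> V" "t 0 = 1" and i: "i \<le> n"
  shows "t i = 1"
proof -
  have sub: "fvec.subspace V" unfolding V by simp
  have "{i. i \<le> n \<and> t i = 1} = {..n}"
  proof (rule nondeg_circuits[OF S V x])
    fix g a b assume g: "circuit V g" "g \<in> vecs n (elim_closure (Suc n) W)"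
      and ab: "a \<in> fsupp g" "b \<in> fsupp g" "a \<in> {i. i \<le> n \<and> t i = 1}"
    have "t * g \<in> V" using t(2) g(1) by (auto simp: circuit_def)
    moreover have "fsupp (t * g) \<subseteq> fsupp g" by (auto simp: fsupp_def fscale_apply)
    ultimately obtain c where "t * g = fscale c g" using circuit_proportional[OF sub g(1)] by blast
    then have "t k * g k = c * g k" for k by (metis fscale_apply times_fun_apply)
    then have "t k = c" if "k \<in> fsupp g" for k using that by (auto simp: fsupp_def fscale_apply)
    then have "t b = 1" using ab by auto
    moreover have "b \<le> n" using ab(2) g(2) by (auto simp: fsupp_def fscale_apply vecs_def) (metis not_le)
    ultimately show "b \<in> {i. i \<le> n \<and> t i = 1}" by simp
  qed (use t in auto)
  then show ?thesis using i by blast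
qed

text \<open>\<open>m\<close> counts the circuits traversed on a path from the index 0; each
  contributes the ratio of two of its coefficients.\<close>

primrec quot_products :: "nat \<Rightarrow> 'a::field set \<Rightarrow> 'a set" where
  "quot_products 0 W = {1}"
| "quot_products (Suc m) W = quot_products m W \<union>
     {u * (x / y) | u x y. u \<in> quot_products m W \<and> x \<in> W \<and> y \<in> W}"

lemma quot_products_step:
  "u \<in> quot_products m W \<Longrightarrow> x \<in> W \<Longrightarrow> y \<in> W \<Longrightarrow> u * (x / y) \<in> quot_products (Suc m) W"
  by auto

lemma one_quot_products: "1 \<in> quot_products m W"
  by (induction m) auto

text \<open>Each proper inclusion adds one of \<open>n + 1\<close> indices and the chain starts with
  at least one, so after \<open>n\<close> steps it is full.\<close>

lemma increasing_chain_full: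
  assumes "\<And>m. A m \<subseteq> A (Suc m)" "\<And>m. A m \<subseteq> {..n}" "A 0 \<noteq> {}"
    and "\<And>m. A (Suc m) = A m \<Longrightarrow> A m = {..n :: nat}"
  shows "A n = {..n}"
proof -
  have "A m = {..n} \<or> Suc m \<le> card (A m)" for m
  proof (induction m)
    case 0
    have "finite (A 0)" using assms(2) finite_subset by blast
    then have "card (A 0) > 0" using assms(3) by (simp add: card_gt_0_iff)
    then show ?case by simp
  next
    case (Suc m)
    have fin: "finite (A (Suc m))" using assms(2) finite_subset by blast
    show ?case
    proof (cases "A (Suc m) = A m")
      case True
      then show ?thesis using assms(4)[of m] by simp
    next
      case False
      then have "card (A m) < card (A (Suc m))" using assms(1)[of m] fin by (intro psubset_card_mono) auto
      moreover have "A m \<noteq> {..n}" using assms(1)[of m] assms(2)[of "Suc m"] False by auto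
      ultimately show ?thesis using Suc by simp
    qed
  qed
  from this[of n] show ?thesis
  proof
    assume "Suc n \<le> card (A n)"
    then show ?thesis using assms(2)[of n] by (intro card_seteq) auto
  qed
qed

context char_p_field
begin

text \<open>A circuit \<open>g\<close> of \<open>V\<close> satisfies \<open>g\<^sup>q = \<kappa> c g\<close>, so on its support the ratios of the values
  of \<open>c\<close> are \<open>(q - 1)\<close>-st powers; by nondegeneracy the circuits connect all indices.\<close>

lemma twist_root:
  assumes S: "S \<subseteq> vecs n W" and V: "V = fvec.span S" and x: "nondeg n V x" "perp n V x"
    and c: "nonvan c" "(*) c ` V = Fr k V" "c 0 = 1" "\<forall>i>n. c i = 1"
  shows "\<exists>\<psi>. (\<forall>i. \<psi> i ^ (p ^ k - 1) = c i) \<and> nonvan \<psi> \<and> \<psi> 0 = 1 \<and> (\<forall>i>n. \<psi> i = 1) \<and>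
    (\<forall>i\<le>n. \<psi> i \<in> quot_products n (elim_closure (Suc n) W))"
proof -
  let ?W = "elim_closure (Suc n) W" let ?q = "p ^ k"
  have sub: "fvec.subspace V" unfolding V by simp
  have q: "?q > 0" using p_pos by simp
  \<comment> \<open>\<open>A m\<close> contains the indices that are reached through at most
    \<open>m\<close> circuits. By connectedness the chain is stationary only when it is full, which
    limits the number of ratios to \<open>n\<close>.\<close>
  define A where "A m = {i. i \<le> n \<and> (\<exists>u\<in>quot_products m ?W. c i = u ^ (?q - 1))}" for m
  have ratio: "g a \<in> ?W \<and> c b = c a * (g b / g a) ^ (?q - 1)"
    if g: "circuit V g" "g \<in> vecs n ?W" and ab: "a \<in> fsupp g" "b \<in> fsupp g" for g a b
  proof -
    have "a \<le> n" using ab(1) g(2) by (auto simp: fsupp_def fscale_apply vecs_def) (metis not_le)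
    have "g \<in> V" using g(1) by (simp add: circuit_def)
    then have "frv k g \<in> Fr k V" unfolding Fr_def by (intro fvec.span_base imageI)
    then have "frv k g \<in> (*) c ` V" using c(2) by simp
    then obtain h where h: "h \<in> V" "frv k g = c * h" by blast
    have hk: "g i ^ ?q = c i * h i" for i using h(2) by (metis frv_apply times_fun_apply)
    have "fsupp h \<subseteq> fsupp g"
    proof
      fix i assume "i \<in> fsupp h"
      then have "c i * h i \<noteq> 0" using c(1) by (simp add: fsupp_def nonvan_def)
      then have "g i ^ ?q \<noteq> 0" unfolding hk .
      then have "g i \<noteq> 0" using p_pos by (intro notI) (simp add: power_0_left)
      then show "i \<in> fsupp g" by (simp add: fsupp_def)
    qed
    then obtain \<kappa> where \<kappa>: "h = fscale \<kappa> g" using circuit_proportional[OF sub g(1) h(1)] by blast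
    have qs: "?q = Suc (?q - 1)" using q by simp
    have e: "g i ^ (?q - 1) = c i * \<kappa>" if i: "i \<in> fsupp g" for i
    proof -
      have "g i * g i ^ (?q - 1) = g i ^ ?q" by (subst (2) qs) (rule power_Suc[symmetric])
      also have "\<dots> = g i * (c i * \<kappa>)" by (simp add: hk \<kappa> fscale_apply ac_simps)
      finally show ?thesis using i by (simp add: fsupp_def)
    qed
    have "\<kappa> \<noteq> 0" using e[OF ab(1)] ab(1) by (auto simp: fsupp_def fscale_apply)
    then have "c b = c a * (g b / g a) ^ (?q - 1)"
      using e[OF ab(1)] e[OF ab(2)] c(1) by (simp add: power_divide nonvan_def)
    then show ?thesis using g(2) \<open>a \<le> n\<close> by (auto simp: vecs_def fscale_apply)
  qed
  have "A n = {..n}"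
  proof (rule increasing_chain_full)
    show "A m \<subseteq> A (Suc m)" for m unfolding A_def by auto
    show "A m \<subseteq> {..n}" for m unfolding A_def by auto
    have "0 \<in> A 0" using c(3) by (simp add: A_def)
    then show "A 0 \<noteq> {}" by blast
    fix m assume eq: "A (Suc m) = A m"
    have "0 \<in> A m" for m by (induction m) (use \<open>0 \<in> A 0\<close> \<open>\<And>m. A m \<subseteq> A (Suc m)\<close> in auto)
    then show "A m = {..n}"
    proof (intro nondeg_circuits[OF S V x])
      fix g a b assume g: "circuit V g" "g \<in> vecs n ?W" and ab: "a \<in> fsupp g" "b \<in> fsupp g" "a \<in> A m"
      obtain u where u: "u \<in> quot_products m ?W" "c a = u ^ (?q - 1)" using ab(3) by (auto simp: A_def)
      have "c b = (u * (g b / g a)) ^ (?q - 1)"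
        using ratio[OF g ab(1,2)] u(2) by (simp only: power_mult_distrib)
      moreover have "u * (g b / g a) \<in> quot_products (Suc m) ?W"
        using u(1) ratio[OF g ab(1,2)] ratio[OF g ab(2,1)] by (intro quot_products_step) simp_all
      moreover have "b \<le> n" using ab(2) g(2) by (auto simp: fsupp_def fscale_apply vecs_def) (metis not_le)
      ultimately have "b \<in> A (Suc m)" unfolding A_def by blast
      then show "b \<in> A m" using eq by simp
    qed (auto simp: A_def)
  qed
  then have "\<forall>i. \<exists>u. i \<le> n \<longrightarrow> u \<in> quot_products n ?W \<and> c i = u ^ (?q - 1)"
    by (auto simp: A_def set_eq_iff)
  then obtain u where u: "\<And>i. i \<le> n \<Longrightarrow> u i \<in> quot_products n ?W \<and> c i = u i ^ (?q - 1)" by metis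
  define \<psi> where "\<psi> i = (if i = 0 \<or> i > n then 1 else u i)" for i
  have pow: "\<psi> i ^ (?q - 1) = c i" for i using u[of i] c(3,4) by (auto simp: \<psi>_def)
  show ?thesis
  proof (cases "k = 0")
    \<comment> \<open>For \<open>k = 0\<close> the exponent \<open>p ^ k - 1\<close> is zero. Then
      \<open>pow\<close> says nothing about \<open>\<psi>\<close>, but it forces \<open>c\<close> to
      be 1, and 1 is a root.\<close>
    case True
    then have "c i = 1" for i using pow[of i] by simp
    then show ?thesis using True by (intro exI[of _ 1]) (auto simp: nonvan_def one_quot_products simp del: elim_closure.simps)
  next
    case False
    then have "?q > 1" using p_ge2 by (metis one_less_power less_le_trans one_less_numeral_iff semiring_norm(76) gr0I)
    then have "\<psi> i \<noteq> 0" for i using pow[of i] c(1) by (auto simp: nonvan_def power_0_left)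
    moreover have "\<psi> i \<in> quot_products n ?W" if "i \<le> n" for i
      using u[OF that] by (simp add: \<psi>_def one_quot_products del: elim_closure.simps)
    moreover have "\<psi> 0 = 1" "\<forall>i>n. \<psi> i = 1" by (simp_all add: \<psi>_def)
    ultimately show ?thesis using pow by (intro exI[of _ \<psi>]) (simp add: nonvan_def del: elim_closure.simps)
  qed
qed

end

subsection \<open>Digit expansions of solutions\<close>

text \<open>\<open>gs\<close> is going to consist of generators of \<open>G\<close> together with
  their inverses, so that group elements are monomials with natural exponents and have digit
  expansions.\<close>

locale digit_system = char_p_basis ys p bs for ys :: "'a::field list" and p bs +
  fixes n :: nat and gs :: "'a list" and W :: "'a set"
  assumes gs_F: "set gs \<subseteq> F" and gs_nz: "0 \<notin> set gs" and W_fin: "finite W" and W_F: "W \<subseteq> F"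
    and digits: "\<And>w d. w \<in> W \<Longrightarrow> length d = length gs \<Longrightarrow> set d \<subseteq> {..<p} \<Longrightarrow>
      \<exists>u. (\<forall>j<length bs. u j \<in> W) \<and> w * mon gs d = (\<Sum>j<length bs. u j ^ p * bs ! j)"
begin

text \<open>Projective points are normalised to have coordinate 1 at index 0, and vectors are
  continued by 1 beyond \<open>n\<close>. Thus all of them are invertible under pointwise
  multiplication.\<close>

definition Gv :: "nat \<Rightarrow> (nat \<Rightarrow> 'a) set" where
  "Gv B = {\<lambda>i. mon gs (m i) | m. (\<forall>i j. nth_default 0 (m i) j \<le> B) \<and>
     (\<forall>i. i = 0 \<or> i > n \<longrightarrow> (\<forall>j. nth_default 0 (m i) j = 0))}"

lemma mon_gs_F: "mon gs e \<in> F"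
  by (rule mon_gen_field[OF gs_F])

lemma mon_gs_nz: "mon gs e \<noteq> 0"
  using gs_nz by (auto simp: mon_def in_set_conv_nth)

lemma mon_zero: "(\<And>j. nth_default 0 e j = 0) \<Longrightarrow> mon xs e = 1"
  by (simp add: mon_def)

lemma GvE:
  assumes "g \<in> Gv B"
  obtains m where "g = (\<lambda>i. mon gs (m i))" "\<forall>i j. nth_default 0 (m i) j \<le> B"
    "\<forall>i j. i = 0 \<or> i > n \<longrightarrow> nth_default 0 (m i) j = 0"
proof -
  from assms obtain m where m: "g = (\<lambda>i. mon gs (m i)) \<and> (\<forall>i j. nth_default 0 (m i) j \<le> B) \<and>
     (\<forall>i. i = 0 \<or> i > n \<longrightarrow> (\<forall>j. nth_default 0 (m i) j = 0))" unfolding Gv_def mem_Collect_eq ..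
  show thesis by (rule that[of m]) (use m in simp_all)
qed

lemma GvI:
  assumes "g = (\<lambda>i. mon gs (m i))" "\<And>i j. nth_default 0 (m i) j \<le> B"
    "\<And>i j. i = 0 \<or> i > n \<Longrightarrow> nth_default 0 (m i) j = 0"
  shows "g \<in> Gv B"
  unfolding Gv_def mem_Collect_eq using assms by (intro exI[of _ m]) simp

lemma Gv_nonvan: "g \<in> Gv B \<Longrightarrow> nonvan g"
  by (auto elim!: GvE simp: nonvan_def mon_gs_nz)

lemma Gv_F: "g \<in> Gv B \<Longrightarrow> g i \<in> F"
  by (auto elim!: GvE simp: mon_gs_F)

lemma Gv_norm: "g \<in> Gv B \<Longrightarrow> i = 0 \<or> i > n \<Longrightarrow> g i = 1"
  by (erule GvE) (auto intro: mon_zero)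

lemma Gv_mono: "g \<in> Gv B \<Longrightarrow> B \<le> B' \<Longrightarrow> g \<in> Gv B'"
  by (erule GvE, rule GvI) (auto intro: order_trans)

lemma Gv_one: "1 \<in> Gv B"
  by (rule GvI[where m = "\<lambda>_. []"]) (auto simp: fun_eq_iff)

lemma Gv_mult:
  assumes "f \<in> Gv B" "g \<in> Gv C" shows "f * g \<in> Gv (B + C)"
proof -
  obtain k where k: "f = (\<lambda>i. mon gs (k i))" "\<forall>i j. nth_default 0 (k i) j \<le> B"
    "\<forall>i j. i = 0 \<or> i > n \<longrightarrow> nth_default 0 (k i) j = 0"
    using assms(1) by (rule GvE)
  obtain l where l: "g = (\<lambda>i. mon gs (l i))" "\<forall>i j. nth_default 0 (l i) j \<le> C"
    "\<forall>i j. i = 0 \<or> i > n \<longrightarrow> nth_default 0 (l i) j = 0"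
    using assms(2) by (rule GvE)
  show ?thesis
  proof (rule GvI[where m = "\<lambda>i. vadd (length gs) (k i) (l i)"])
    show "f * g = (\<lambda>i. mon gs (vadd (length gs) (k i) (l i)))"
      by (simp add: k(1) l(1) mon_vadd fun_eq_iff)
    show "nth_default 0 (vadd (length gs) (k i) (l i)) j \<le> B + C" for i j
      using k(2)[rule_format, of i j] l(2)[rule_format, of i j] by (simp add: vadd_def nth_default_map_upt)
    show "nth_default 0 (vadd (length gs) (k i) (l i)) j = 0" if "i = 0 \<or> i > n" for i j
      using k(3)[rule_format, OF that, of j] l(3)[rule_format, OF that, of j] by (simp add: vadd_def nth_default_map_upt)
  qed
qed

lemma Gv_power:
  assumes "g \<in> Gv B" shows "(\<lambda>i. g i ^ k) \<in> Gv (k * B)"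
proof (induction k)
  case 0
  have "(\<lambda>i. g i ^ 0) = 1" by (auto simp: fun_eq_iff)
  then show ?case using Gv_one by simp
next
  case (Suc k)
  have "(\<lambda>i. g i ^ Suc k) = g * (\<lambda>i. g i ^ k)" by (auto simp: fun_eq_iff)
  then show ?case using Gv_mult[OF assms Suc] by simp
qed

lemma Gv_frv: "g \<in> Gv B \<Longrightarrow> frv s g \<in> Gv (p ^ s * B)"
  unfolding frv_def by (rule Gv_power)

lemma Gv_zero: "g \<in> Gv 0 \<Longrightarrow> g = 1"
  by (erule GvE) (auto simp: fun_eq_iff intro: mon_zero)

lemma Gv_divide:
  assumes "x \<in> Gv B"
  shows "\<exists>\<gamma>\<in>Gv (p - 1). \<exists>z\<in>Gv (B div p). x = \<gamma> * frv 1 z"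
proof -
  obtain m where m: "x = (\<lambda>i. mon gs (m i))" "\<forall>i j. nth_default 0 (m i) j \<le> B"
    "\<forall>i j. i = 0 \<or> i > n \<longrightarrow> nth_default 0 (m i) j = 0"
    using assms by (rule GvE)
  let ?l = "length gs"
  have a: "(\<lambda>i. mon gs (vmod ?l (m i) p)) \<in> Gv (p - 1)"
    using p_pos m(3) by (intro GvI[OF refl]) (auto simp: vmod_def nth_default_map_upt less_Suc_eq_le[symmetric])
  have b: "(\<lambda>i. mon gs (vdiv ?l (m i) p)) \<in> Gv (B div p)"
    using m(2,3) by (intro GvI[OF refl]) (auto simp: vdiv_def nth_default_map_upt intro: div_le_mono)
  have c: "x = (\<lambda>i. mon gs (vmod ?l (m i) p)) * frv 1 (\<lambda>i. mon gs (vdiv ?l (m i) p))"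
  proof
    fix i
    have "x i = mon gs (vdiv ?l (m i) p) ^ p * mon gs (vmod ?l (m i) p)"
      unfolding m(1) by (rule mon_divmod)
    then show "x i = ((\<lambda>i. mon gs (vmod ?l (m i) p)) * frv 1 (\<lambda>i. mon gs (vdiv ?l (m i) p))) i"
      by (simp add: frv_apply mult.commute)
  qed
  show ?thesis by (intro bexI) (rule c, rule b, rule a)
qed

lemma Gv_digit:
  assumes "\<gamma> \<in> Gv (p - 1)" "w \<in> W"
  shows "\<exists>u. (\<forall>j<length bs. u j \<in> W) \<and> w * \<gamma> i = (\<Sum>j<length bs. u j ^ p * bs ! j)"
proof -
  obtain m where m: "\<gamma> = (\<lambda>i. mon gs (m i))" "\<forall>i j. nth_default 0 (m i) j \<le> p - 1"
    using assms(1) by (rule GvE)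
  let ?d = "map (nth_default 0 (m i)) [0..<length gs]"
  have "nth_default 0 (m i) j < p" for j using m(2)[rule_format, of i j] p_pos by linarith
  then have "set ?d \<subseteq> {..<p}" by auto
  moreover have "mon gs ?d = mon gs (m i)" by (simp add: mon_def nth_default_map_upt)
  ultimately show ?thesis using digits[OF assms(2), of ?d] by (simp add: m(1))
qed

section \<open>The finite automaton and its walks\<close>

definition states :: "(nat \<Rightarrow> 'a) set set" where
  "states = fvec.span ` Pow (vecs n W)"

lemma card_vecs: "finite (vecs n W) \<and> card (vecs n W) \<le> card W ^ Suc n"
proof -
  let ?L = "{l. set l \<subseteq> W \<and> length l = Suc n}"
  have L: "finite ?L" "card ?L = card W ^ Suc n"
    using finite_lists_length_eq[OF W_fin] card_lists_length_eq[OF W_fin] by auto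
  have "vecs n W \<subseteq> (\<lambda>l i. if i \<le> n then l ! i else 0) ` ?L"
  proof
    fix f assume f: "f \<in> vecs n W"
    have "f = (\<lambda>i. if i \<le> n then map f [0..<Suc n] ! i else 0)"
      using f by (auto simp: vecs_def fun_eq_iff simp del: upt_Suc)
    moreover have "map f [0..<Suc n] \<in> ?L" using f by (auto simp: vecs_def simp del: upt_Suc)
    ultimately show "f \<in> (\<lambda>l i. if i \<le> n then l ! i else 0) ` ?L" by blast
  qed
  then show ?thesis using L
    by (metis (no_types, lifting) card_image_le card_mono finite_imageI finite_subset le_trans)
qed

lemma card_states: "finite states \<and> card states \<le> 2 ^ (card W ^ Suc n)"
proof -
  have "card states \<le> card (Pow (vecs n W))"
    unfolding states_def using card_vecs by (intro card_image_le) auto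
  also have "\<dots> = 2 ^ card (vecs n W)" using card_vecs by (simp add: card_Pow)
  also have "\<dots> \<le> 2 ^ (card W ^ Suc n)" using card_vecs by (intro power_increasing) auto
  finally show ?thesis using card_vecs by (simp add: states_def)
qed

lemma statesE:
  assumes "V \<in> states" obtains S where "S \<subseteq> vecs n W" "V = fvec.span S"
  using assms unfolding states_def by blast

lemma states_fin_gen: "V \<in> states \<Longrightarrow> fin_gen V"
  unfolding fin_gen_def using card_vecs by (metis finite_subset statesE)

lemma states_vsupp: "V \<in> states \<Longrightarrow> V \<subseteq> vsupp n"
  by (metis span_vecs_subset statesE)

text \<open>The digit forms of all generators of \<open>V\<close> generate \<open>V'\<close>.
  Independence of the basis yields the equations for \<open>z\<close>, and a subsum that is non-zero
  for \<open>x\<close> has a digit that is non-zero for \<open>z\<close>. Only an inclusion links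
  \<open>V\<close> and \<open>V'\<close>, because the digits may span more than \<open>V\<close>
  did.\<close>

lemma digit_step:
  assumes V: "V \<in> states" "perp n V x" "nondeg n V x" and x: "x = \<gamma> * frv 1 z"
    and \<gamma>: "\<gamma> \<in> Gv (p - 1)" and z: "z \<in> Gv B"
  shows "\<exists>V'\<in>states. (*) \<gamma> ` V \<subseteq> Fr 1 V' \<and> perp n V' z \<and> nondeg n V' z"
proof -
  obtain S where S: "S \<subseteq> vecs n W" "V = fvec.span S" using V(1) by (rule statesE)
  have "\<exists>u. w \<in> W \<longrightarrow> (\<forall>j<length bs. u j \<in> W) \<and> w * \<gamma> i = (\<Sum>j<length bs. u j ^ p * bs ! j)" for w i
    using Gv_digit[OF \<gamma>] by blast
  then obtain u where u: "\<And>w i j. w \<in> W \<Longrightarrow> j < length bs \<Longrightarrow> u w i j \<in> W"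
    "\<And>w i. w \<in> W \<Longrightarrow> w * \<gamma> i = (\<Sum>j<length bs. u w i j ^ p * bs ! j)" by metis
  define t where "t s j = (\<lambda>i. if i \<le> n then u (s i) i j else 0)" for s j
  define S' where "S' = {t s j | s j. s \<in> S \<and> j < length bs}"
  have S': "S' \<subseteq> vecs n W" using S(1) u(1) by (auto simp: S'_def t_def vecs_def)
  have sW: "s i \<in> W" if "s \<in> S" "i \<le> n" for s i using S(1) that by (auto simp: vecs_def)
  have sum: "(\<Sum>i\<in>A. s i * x i) = (\<Sum>j<length bs. (\<Sum>i\<in>A. t s j i * z i) ^ p * bs ! j)"
    if s: "s \<in> S" and A: "A \<subseteq> {..n}" for s A
  proof -
    have "(\<Sum>i\<in>A. s i * x i) = (\<Sum>i\<in>A. \<Sum>j<length bs. (t s j i * z i) ^ p * bs ! j)"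
    proof (rule sum.cong[OF refl])
      fix i assume "i \<in> A"
      then have i: "i \<le> n" using A by auto
      have "s i * x i = s i * \<gamma> i * z i ^ p" by (simp add: x frv_apply)
      also have "s i * \<gamma> i = (\<Sum>j<length bs. t s j i ^ p * bs ! j)"
        using u(2)[OF sW[OF s i]] i by (simp add: t_def)
      finally show "s i * x i = (\<Sum>j<length bs. (t s j i * z i) ^ p * bs ! j)"
        by (simp add: sum_distrib_left power_mult_distrib ac_simps)
    qed
    also have "\<dots> = (\<Sum>j<length bs. \<Sum>i\<in>A. (t s j i * z i) ^ p * bs ! j)" by (rule sum.swap)
    also have "\<dots> = (\<Sum>j<length bs. (\<Sum>i\<in>A. (t s j i * z i) ^ p) * bs ! j)"
      by (simp only: sum_distrib_right)
    also have "\<dots> = (\<Sum>j<length bs. (\<Sum>i\<in>A. t s j i * z i) ^ p * bs ! j)"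
      by (rule sum.cong[OF refl]) (simp only: frob_sum[where s = 1, unfolded power_one_right])
    finally show ?thesis .
  qed
  have "perp n S' z"
    unfolding perp_def
  proof
    fix f assume "f \<in> S'"
    then obtain s j where s: "s \<in> S" "j < length bs" "f = t s j" by (auto simp: S'_def)
    have "s \<in> V" using s(1) S(2) by (auto intro: fvec.span_base)
    then have "(\<Sum>i\<le>n. s i * x i) = 0" using V(2) by (simp add: perp_def)
    then have zero: "(\<Sum>j<length bs. (\<Sum>i\<le>n. t s j i * z i) ^ p * bs ! j) = 0"
      using sum[OF s(1), of "{..n}"] by simp
    have "t s j i \<in> F" if "j < length bs" "i \<le> n" for i j
      using u(1)[OF sW[OF s(1) that(2)] that(1)] W_F that(2) by (auto simp: t_def)
    then have "\<forall>j<length bs. (\<Sum>i\<le>n. t s j i * z i) \<in> F"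
      using Gv_F[OF z] by (auto intro!: gen_field_sum gen_field_mult)
    from basis_indep[OF this zero s(2)] show "(\<Sum>i\<le>n. f i * z i) = 0" by (simp only: s(3))
  qed
  moreover have "nondeg n (fvec.span S') z"
    unfolding nondeg_def
  proof (intro allI impI)
    fix A assume A: "A \<noteq> {}" "A \<subset> {..n}"
    obtain f where "f \<in> V" "(\<Sum>i\<in>A. f i * x i) \<noteq> 0" using V(3) A by (auto simp: nondeg_def)
    then obtain s where s: "s \<in> S" "(\<Sum>i\<in>A. s i * x i) \<noteq> 0"
      using span_sum_zero[where S = S and A = A and z = x] S(2) by blast
    have "(\<Sum>j<length bs. (\<Sum>i\<in>A. t s j i * z i) ^ p * bs ! j) \<noteq> 0"
      using sum[OF s(1), of A] s(2) A(2) by auto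
    then obtain j where "j < length bs" "(\<Sum>i\<in>A. t s j i * z i) ^ p * bs ! j \<noteq> 0"
      by (meson lessThan_iff sum.not_neutral_contains_not_neutral)
    then have "j < length bs" "(\<Sum>i\<in>A. t s j i * z i) \<noteq> 0"
      using p_pos by (auto simp: power_0_left)
    then show "\<exists>f\<in>fvec.span S'. (\<Sum>i\<in>A. f i * z i) \<noteq> 0"
      using s(1) by (intro bexI[of _ "t s j"] fvec.span_base) (auto simp: S'_def)
  qed
  moreover have "(*) \<gamma> ` V \<subseteq> Fr 1 (fvec.span S')"
  proof -
    have "\<gamma> * s \<in> fvec.span (frv 1 ` S')" if s: "s \<in> S" for s
    proof -
      have eq: "\<gamma> * s = (\<Sum>j<length bs. fscale (bs ! j) (frv 1 (t s j)))"
      proof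
        fix i
        have "s i = 0" if "i > n" using s S(1) that by (auto simp: vecs_def)
        then show "(\<gamma> * s) i = (\<Sum>j<length bs. fscale (bs ! j) (frv 1 (t s j))) i"
          using u(2)[OF sW[OF s], of i i] p_pos
          by (cases "i \<le> n") (auto simp: fvec_sum_apply fscale_apply frv_apply t_def ac_simps power_0_left)
      qed
      have "t s j \<in> S'" if "j < length bs" for j using s that by (auto simp: S'_def)
      then show ?thesis
        unfolding eq by (intro fvec.span_sum fvec.span_scale fvec.span_base imageI) simp
    qed
    then show ?thesis unfolding Fr_span S(2) mult_linear[symmetric]
      by (intro fvec.span_minimal) auto
  qed
  moreover have "fvec.span S' \<in> states" using S' by (auto simp: states_def)
  ultimately show ?thesis by (intro bexI[of _ "fvec.span S'"]) (auto simp: perp_span)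
qed

text \<open>The walk is continued for ever. The bound \<open>B div p ^ l\<close> becomes 0, so from
  some step on the point is constantly 1, and no separate stopping condition is required.\<close>

lemma trajectory:
  assumes V: "V \<in> states" "perp n V x" "nondeg n V x" and x: "x \<in> Gv B"
  shows "\<exists>zs Vs \<gamma>. zs 0 = x \<and> Vs 0 = V \<and> (\<forall>l. zs l \<in> Gv (B div p ^ l) \<and> Vs l \<in> states \<and>
    perp n (Vs l) (zs l) \<and> nondeg n (Vs l) (zs l) \<and> \<gamma> l \<in> Gv (p - 1) \<and>
    zs l = \<gamma> l * frv 1 (zs (Suc l)) \<and> (*) (\<gamma> l) ` Vs l \<subseteq> Fr 1 (Vs (Suc l)))"
proof -
  let ?P = "\<lambda>l s. fst s \<in> Gv (B div p ^ l) \<and> snd s \<in> states \<and> perp n (snd s) (fst s) \<and> nondeg n (snd s) (fst s)"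
  let ?R = "\<lambda>s s' g. g \<in> Gv (p - 1) \<and> fst s = g * frv 1 (fst s') \<and> (*) g ` snd s \<subseteq> Fr 1 (snd s')"
  let ?Q = "\<lambda>l s s'. (l = (0::nat) \<longrightarrow> s = (x, V)) \<and> (\<exists>g. ?R s s' g)"
  have "\<exists>f. \<forall>l. (?P l (f l) \<and> (l = 0 \<longrightarrow> f l = (x, V))) \<and> (\<exists>g. ?R (f l) (f (Suc l)) g)"
  proof (rule dependent_nat_choice)
    show "\<exists>s. ?P 0 s \<and> (0 = (0::nat) \<longrightarrow> s = (x, V))" using assms by (intro exI[of _ "(x, V)"]) auto
    fix s l assume s: "?P l s \<and> (l = 0 \<longrightarrow> s = (x, V))"
    obtain g z where gz: "g \<in> Gv (p - 1)" "z \<in> Gv (B div p ^ l div p)" "fst s = g * frv 1 z"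
      using Gv_divide[of "fst s" "B div p ^ l"] s by blast
    obtain V' where V': "V' \<in> states" "(*) g ` snd s \<subseteq> Fr 1 V'" "perp n V' z" "nondeg n V' z"
      using digit_step[OF _ _ _ gz(3,1,2), of "snd s"] s by blast
    have "B div p ^ l div p = B div p ^ Suc l" by (simp only: power_Suc2 div_mult2_eq)
    then show "\<exists>s'. (?P (Suc l) s' \<and> (Suc l = 0 \<longrightarrow> s' = (x, V))) \<and> (\<exists>g. ?R s s' g)"
      using gz V' by (intro exI[of _ "(z, V')"]) auto
  qed
  then obtain f where f: "\<And>l. ?P l (f l)" "f 0 = (x, V)" "\<And>l. \<exists>g. ?R (f l) (f (Suc l)) g"
    by blast
  obtain \<gamma> where \<gamma>: "\<And>l. ?R (f l) (f (Suc l)) (\<gamma> l)" using f(3) by metis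
  show ?thesis
  proof (rule exI[of _ "\<lambda>l. fst (f l)"], rule exI[of _ "\<lambda>l. snd (f l)"], rule exI[of _ \<gamma>],
      intro conjI allI)
    show "fst (f 0) = x" "snd (f 0) = V" by (simp_all add: f(2))
  qed (use f(1) \<gamma> in blast)+
qed

text \<open>\<open>\<gamma> 0 * \<gamma> 1 ^ p * \<gamma> 2 ^ p\<^sup>2 * \<dots>\<close>, the part
  of the point that is described by the first \<open>s\<close> digits of its exponents.\<close>

primrec wprod :: "(nat \<Rightarrow> nat \<Rightarrow> 'a) \<Rightarrow> nat \<Rightarrow> nat \<Rightarrow> 'a" where
  "wprod \<gamma> 0 = 1"
| "wprod \<gamma> (Suc s) = wprod \<gamma> s * frv s (\<gamma> s)"

lemma wprod_Gv: "\<forall>l<s. \<gamma> l \<in> Gv (p - 1) \<Longrightarrow> wprod \<gamma> s \<in> Gv (p ^ s)"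
proof (induction s)
  case (Suc s)
  have "wprod \<gamma> (Suc s) \<in> Gv (p ^ s + p ^ s * (p - 1))"
    using Suc by (auto intro!: Gv_mult Gv_frv)
  moreover have "p ^ s + p ^ s * (p - 1) = p ^ Suc s"
    using p_pos by (cases p) auto
  ultimately show ?case by (simp only:)
qed (simp add: Gv_one)

lemma wprod_point:
  "\<forall>l<s. zs l = \<gamma> l * frv 1 (zs (Suc l)) \<Longrightarrow> zs 0 = wprod \<gamma> s * frv s (zs s)"
proof (induction s)
  case (Suc s)
  have "zs 0 = wprod \<gamma> s * frv s (zs s)" using Suc.prems by (intro Suc.IH) simp
  also have "zs s = \<gamma> s * frv 1 (zs (Suc s))" using Suc.prems by blast
  finally show ?case
    by (simp only: frv_mult frv_frv mult.assoc wprod.simps One_nat_def add_Suc_right add_0_right)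
qed simp

lemma wprod_subset:
  "\<forall>l<s. (*) (\<gamma> l) ` V l \<subseteq> Fr 1 (V (Suc l)) \<Longrightarrow> (*) (wprod \<gamma> s) ` V 0 \<subseteq> Fr s (V s)"
proof (induction s)
  case 0
  show ?case by (auto simp: Fr_def intro: fvec.span_base)
next
  case (Suc s)
  have "(*) (wprod \<gamma> (Suc s)) ` V 0 = (*) (frv s (\<gamma> s)) ` (*) (wprod \<gamma> s) ` V 0"
    by (simp only: mult_image_image wprod.simps mult.commute)
  also have "\<dots> \<subseteq> (*) (frv s (\<gamma> s)) ` Fr s (V s)"
    by (rule image_mono, rule Suc.IH) (intro allI impI, rule Suc.prems[rule_format], simp)
  also have "\<dots> = Fr s ((*) (\<gamma> s) ` V s)" by (rule Fr_mult[symmetric])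
  also have "\<dots> \<subseteq> Fr s (Fr 1 (V (Suc s)))" by (rule Fr_mono, rule Suc.prems[rule_format]) simp
  also have "\<dots> = Fr (Suc s) (V (Suc s))" by (simp add: Fr_Fr)
  finally show ?case .
qed

lemma wprod_eq:
  assumes "fvec.subspace (V 0)" "\<forall>l<s. (*) (\<gamma> l) ` V l = Fr 1 (V (Suc l))"
  shows "(*) (wprod \<gamma> s) ` V 0 = Fr s (V s)"
  using assms(2)
proof (induction s)
  case 0
  show ?case using Fr_0[OF assms(1)] by simp
next
  case (Suc s)
  have "(*) (wprod \<gamma> (Suc s)) ` V 0 = (*) (frv s (\<gamma> s)) ` (*) (wprod \<gamma> s) ` V 0"
    by (simp only: mult_image_image wprod.simps mult.commute)
  also have "\<dots> = (*) (frv s (\<gamma> s)) ` Fr s (V s)"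
    by (rule arg_cong[OF Suc.IH]) (intro allI impI, rule Suc.prems[rule_format], simp)
  also have "\<dots> = Fr s ((*) (\<gamma> s) ` V s)" by (rule Fr_mult[symmetric])
  also have "(*) (\<gamma> s) ` V s = Fr 1 (V (Suc s))" by (rule Suc.prems[rule_format]) simp
  also have "Fr s (Fr 1 (V (Suc s))) = Fr (Suc s) (V (Suc s))" by (simp add: Fr_Fr)
  finally show ?case .
qed

text \<open>Walks on which the inclusion of \<open>digit_step\<close> is an equality throughout. No
  point is attached to them, and this is what allows parts to be cut out.\<close>

definition eqwalk :: "(nat \<Rightarrow> nat \<Rightarrow> 'a) \<Rightarrow> (nat \<Rightarrow> (nat \<Rightarrow> 'a) set) \<Rightarrow> nat \<Rightarrow> bool" where
  "eqwalk \<gamma> V s \<longleftrightarrow> (\<forall>l<s. \<gamma> l \<in> Gv (p - 1) \<and> (*) (\<gamma> l) ` V l = Fr 1 (V (Suc l))) \<and> (\<forall>l\<le>s. V l \<in> states)"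

lemma pigeonhole_le:
  assumes "finite S" "\<forall>i\<in>I. f i \<in> S" "card S < card I"
  shows "\<exists>i\<in>I. \<exists>j\<in>I. i < j \<and> f i = f (j :: nat)"
proof (rule ccontr)
  assume "\<not> ?thesis"
  then have "inj_on f I" by (auto simp: inj_on_def) (metis linorder_neqE_nat)
  then have "card I \<le> card S" using assms(1,2) by (intro card_inj_on_le[of f]) auto
  then show False using assms(3) by simp
qed

text \<open>Walks are shortened by cutting out detours whose length is a multiple of \<open>K\<close>.\<close>

lemma eqwalk_cut:
  assumes "eqwalk \<gamma> V s" "K > 0"
  shows "\<exists>\<gamma>' V' s' t. eqwalk \<gamma>' V' s' \<and> V' 0 = V 0 \<and> V' s' = V s \<and> s = s' + K * t \<and> s' \<le> card states * K"
  using assms(1)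
proof (induction s arbitrary: \<gamma> V rule: less_induct)
  case (less s)
  show ?case
  proof (cases "s \<le> card states * K")
    case True
    then show ?thesis using less.prems by (intro exI[of _ \<gamma>] exI[of _ V] exI[of _ s] exI[of _ 0]) simp
  next
    case False
    \<comment> \<open>The pigeonhole principle is applied to pairs of a state and a position modulo
      \<open>K\<close>, so the stretch between the two positions is divisible by
      \<open>K\<close>.\<close>
    have "\<exists>i\<in>{..s}. \<exists>j\<in>{..s}. i < j \<and> (V i, i mod K) = (V j, j mod K)"
    proof (rule pigeonhole_le)
      show "finite (states \<times> {..<K})" using card_states by simp
      show "\<forall>i\<in>{..s}. (V i, i mod K) \<in> states \<times> {..<K}" using less.prems assms(2) by (auto simp: eqwalk_def)
      show "card (states \<times> {..<K}) < card {..s}" using False by (simp add: card_cartesian_product)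
    qed
    then obtain i j where ij: "i < j" "j \<le> s" "V i = V j" "i mod K = j mod K" by auto
    define d where "d = j - i"
    have d: "0 < d" "i + d = j" using ij by (auto simp: d_def)
    have "K dvd d" using ij(1,4) by (metis d_def mod_eq_dvd_iff_nat less_imp_le)
    then obtain e where e: "d = K * e" by (auto simp: dvd_def)
    let ?V = "\<lambda>l. if l \<le> i then V l else V (l + d)" let ?\<gamma> = "\<lambda>l. if l < i then \<gamma> l else \<gamma> (l + d)"
    have "eqwalk ?\<gamma> ?V (s - d)"
      unfolding eqwalk_def
    proof (intro conjI allI impI)
      fix l assume l: "l < s - d"
      show "?\<gamma> l \<in> Gv (p - 1)" using less.prems l by (auto simp: eqwalk_def)
      have e1: "(*) (\<gamma> l') ` V l' = Fr 1 (V (Suc l'))" if "l' < s" for l'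
        using less.prems that by (simp add: eqwalk_def)
      show "(*) (?\<gamma> l) ` ?V l = Fr 1 (?V (Suc l))"
        using e1[of l] e1[of "l + d"] l d ij(3) by (cases "l < i"; cases "l = i") auto
    next
      fix l assume "l \<le> s - d"
      then show "?V l \<in> states" using less.prems ij(2) d by (auto simp: eqwalk_def)
    qed
    from less.IH[OF _ this] obtain \<gamma>' V' s' t where
      "eqwalk \<gamma>' V' s'" "V' 0 = ?V 0" "V' s' = ?V (s - d)" "s - d = s' + K * t" "s' \<le> card states * K"
      using d(1) ij by fastforce
    moreover have "?V (s - d) = V s"
    proof (cases "s - d \<le> i")
      case True
      then have "s - d = i" "s = j" using ij(2) d(2) by auto
      then show ?thesis using ij(3) by simp
    next
      case False
      then show ?thesis using ij(2) d(2) by simp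
    qed
    moreover have "s = s' + K * (t + e)" using calculation(4) e ij(2) d by (simp add: algebra_simps)
    ultimately show ?thesis by (intro exI[of _ \<gamma>'] exI[of _ V'] exI[of _ s'] exI[of _ "t + e"]) simp
  qed
qed

end

subsection \<open>Covering solutions by orbits\<close>

text \<open>The composed maps \<open>\<psi>\<^sup>-\<^sup>1 \<phi>\<^sup>e \<psi>\<close> on fixed
  coordinate vectors; \<open>frob_orbit_hpoint\<close> makes the transition to projective
  points.\<close>

fun orbit_pt :: "nat \<Rightarrow> (nat \<Rightarrow> 'a::field) list \<Rightarrow> nat list \<Rightarrow> (nat \<Rightarrow> 'a) \<Rightarrow> nat \<Rightarrow> 'a" where
  "orbit_pt q (\<psi> # \<psi>s) (e # es) \<tau> = (\<lambda>i. inverse (\<psi> i) * (\<psi> i * orbit_pt q \<psi>s es \<tau> i) ^ (q ^ e))"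
| "orbit_pt q _ _ \<tau> = \<tau>"

text \<open>\<open>N\<close> is an upper bound and not the exact number of states, since the
  algorithm knows \<open>W\<close> only as a list of expressions whose values may coincide.\<close>

locale cover_system = digit_system ys p bs n gs W for ys :: "'a::field list" and p bs n gs W +
  fixes N :: nat
  assumes N: "2 ^ (card W ^ Suc n) \<le> N"
begin

definition "K = (fact N :: nat)"

text \<open>The longest stretch that is kept as a prefix: a shortened walk has at most
  \<open>N * K\<close> steps, and from a repeated state to the next increase of the dimension there
  are at most \<open>N + 1\<close>.\<close>

definition "L = N * K + N + 1"

text \<open>The growth of the bounds under a prefix of at most \<open>L\<close> digits: exponents up
  to \<open>b\<close> become at most \<open>p ^ L * (b + 1)\<close>, and the Frobenius exponent in a
  twist grows by at most \<open>L\<close>.\<close>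

definition pre :: "nat \<Rightarrow> nat" where
  "pre b = p ^ L * (b + 1) + L"

text \<open>Only conditions that can be tested: the coordinates come from a finite list, and their
  \<open>(p ^ K - 1)\<close>-st powers are monomials with bounded exponents. The second condition
  will place the multipliers in \<open>radical G\<close>.\<close>

definition roots :: "(nat \<Rightarrow> 'a) set" where
  "roots = {u. nonvan u \<and> (\<forall>i>n. u i = 1) \<and> (\<forall>i\<le>n. u i \<in> quot_products n (elim_closure (Suc n) W)) \<and>
     (\<lambda>i. u i ^ (p ^ K - 1)) \<in> Gv (p ^ N * p ^ K)}"

definition twists :: "nat \<Rightarrow> (nat \<Rightarrow> 'a) set" where
  "twists b = {frv s u * vinv g | u g s. u \<in> roots \<and> g \<in> Gv b \<and> s \<le> b}"

text \<open>The induction has to provide that the entire orbit, and not only \<open>x\<close>,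
  consists of solutions; otherwise the orbits would not stay on the hyperplane.\<close>

definition cov :: "nat \<Rightarrow> nat \<Rightarrow> (nat \<Rightarrow> 'a) set \<Rightarrow> (nat \<Rightarrow> 'a) \<Rightarrow> bool" where
  "cov b h V x \<longleftrightarrow> (\<exists>\<psi>s \<tau> es. length \<psi>s \<le> h \<and> set \<psi>s \<subseteq> twists b \<and> \<tau> \<in> Gv b \<and>
     length es = length \<psi>s \<and> x = orbit_pt (p ^ K) \<psi>s es \<tau> \<and>
     (\<forall>es'. length es' = length \<psi>s \<longrightarrow> perp n V (orbit_pt (p ^ K) \<psi>s es' \<tau>)))"

lemma K_pos: "K > 0"
  by (simp add: K_def)

lemma pre_ge: "b + L \<le> pre b" "p ^ s \<le> p ^ L \<Longrightarrow> p ^ s * b + p ^ s \<le> pre b" "p ^ L \<le> pre b"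
proof -
  have "1 * (b + 1) \<le> p ^ L * (b + 1)" using p_pos by (intro mult_le_mono1) simp
  then show "b + L \<le> pre b" by (simp add: pre_def)
  show "p ^ s * b + p ^ s \<le> pre b" if "p ^ s \<le> p ^ L"
    using mult_le_mono1[OF that, of "b + 1"] by (simp add: pre_def)
  show "p ^ L \<le> pre b" by (simp add: pre_def)
qed

lemma pow_le_L: "s \<le> L \<Longrightarrow> p ^ s \<le> p ^ L"
  using p_pos by (intro power_increasing) auto

lemma twistsE:
  assumes "\<psi> \<in> twists b"
  obtains u g s where "u \<in> roots" "g \<in> Gv b" "s \<le> b" "\<psi> = frv s u * vinv g"
  using assms unfolding twists_def mem_Collect_eq by (elim exE conjE) (rule that)

lemma twistsI: "u \<in> roots \<Longrightarrow> g \<in> Gv b \<Longrightarrow> s \<le> b \<Longrightarrow> frv s u * vinv g \<in> twists b"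
  unfolding twists_def mem_Collect_eq by (intro exI conjI) (rule refl | assumption)+

lemma twists_mono:
  assumes "\<psi> \<in> twists b" "b \<le> b'" shows "\<psi> \<in> twists b'"
proof -
  obtain u g s where u: "u \<in> roots" "g \<in> Gv b" "s \<le> b" "\<psi> = frv s u * vinv g"
    using assms(1) by (rule twistsE)
  show ?thesis unfolding u(4) by (rule twistsI[OF u(1) Gv_mono[OF u(2) assms(2)] le_trans[OF u(3) assms(2)]])
qed

lemma covI:
  assumes "length \<psi>s \<le> h" "set \<psi>s \<subseteq> twists b" "\<tau> \<in> Gv b" "length es = length \<psi>s"
    "x = orbit_pt (p ^ K) \<psi>s es \<tau>"
    "\<And>es'. length es' = length \<psi>s \<Longrightarrow> perp n V (orbit_pt (p ^ K) \<psi>s es' \<tau>)"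
  shows "cov b h V x"
  unfolding cov_def
  by (rule exI[of _ \<psi>s], rule exI[of _ \<tau>], rule exI[of _ es], intro conjI allI impI assms)

lemma covE:
  assumes "cov b h V x"
  obtains \<psi>s \<tau> es where "length \<psi>s \<le> h" "set \<psi>s \<subseteq> twists b" "\<tau> \<in> Gv b"
    "length es = length \<psi>s" "x = orbit_pt (p ^ K) \<psi>s es \<tau>"
    "\<forall>es'. length es' = length \<psi>s \<longrightarrow> perp n V (orbit_pt (p ^ K) \<psi>s es' \<tau>)"
  using assms unfolding cov_def by (elim exE conjE) (rule that)

lemma cov_mono:
  assumes "cov b h V x" "b \<le> b'" "h \<le> h'" shows "cov b' h' V x"
proof -
  obtain \<psi>s \<tau> es where o: "length \<psi>s \<le> h" "set \<psi>s \<subseteq> twists b" "\<tau> \<in> Gv b"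
    "length es = length \<psi>s" "x = orbit_pt (p ^ K) \<psi>s es \<tau>"
    "\<forall>es'. length es' = length \<psi>s \<longrightarrow> perp n V (orbit_pt (p ^ K) \<psi>s es' \<tau>)"
    using assms(1) by (rule covE)
  show ?thesis
    by (rule covI[OF le_trans[OF o(1) assms(3)] _ Gv_mono[OF o(3) assms(2)] o(4,5) o(6)[rule_format]])
      (use o(2) twists_mono[OF _ assms(2)] in auto)
qed

text \<open>The map \<open>y \<mapsto> w * frv s y\<close> carries the twist of
  \<open>\<psi>\<close> to the twist of these multipliers, because powers of Frobenius commute with
  each other.\<close>

definition twist_pre :: "(nat \<Rightarrow> 'a) \<Rightarrow> nat \<Rightarrow> (nat \<Rightarrow> 'a) \<Rightarrow> nat \<Rightarrow> 'a" where
  "twist_pre w s \<psi> = frv s \<psi> * vinv w"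

lemma vinv_mult: "vinv (f * g) = vinv f * vinv g"
  by (auto simp: fun_eq_iff vinv_apply)

lemma twist_pre_twists:
  assumes "\<psi> \<in> twists b" "w \<in> Gv (p ^ s)" "s \<le> L"
  shows "twist_pre w s \<psi> \<in> twists (pre b)"
proof -
  obtain u g t where u: "u \<in> roots" "g \<in> Gv b" "t \<le> b" "\<psi> = frv t u * vinv g"
    using assms(1) by (rule twistsE)
  have eq: "twist_pre w s \<psi> = frv (s + t) u * vinv (frv s g * w)"
    by (simp only: twist_pre_def u(4) frv_mult frv_frv frv_vinv vinv_mult mult.assoc)
  have g: "frv s g * w \<in> Gv (pre b)"
    using Gv_mono[OF Gv_mult[OF Gv_frv[OF u(2)] assms(2)] pre_ge(2)[OF pow_le_L[OF assms(3)]]] .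
  have "s + t \<le> pre b" using pre_ge(1)[of b] u(3) assms(3) by linarith
  then show ?thesis unfolding eq by (rule twistsI[OF u(1) g])
qed

lemma orbit_pt_pre:
  assumes "nonvan w" "length es = length \<psi>s"
  shows "orbit_pt (p ^ K) (map (twist_pre w s) \<psi>s) es (w * frv s \<tau>) = w * frv s (orbit_pt (p ^ K) \<psi>s es \<tau>)"
  using assms(2)
proof (induction \<psi>s arbitrary: es)
  case (Cons \<psi> \<psi>s)
  then obtain e es' where es: "es = e # es'" "length es' = length \<psi>s" by (cases es) auto
  have w: "w i \<noteq> 0" for i using assms(1) by (simp add: nonvan_def)
  show ?case
  proof
    fix i
    let ?o = "orbit_pt (p ^ K) \<psi>s es' \<tau> i" let ?Q = "(p ^ K) ^ e" let ?P = "p ^ s"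
    have IHi: "orbit_pt (p ^ K) (map (twist_pre w s) \<psi>s) es' (w * frv s \<tau>) i = w i * ?o ^ ?P"
      by (simp only: Cons.IH[OF es(2)] times_fun_apply frv_apply)
    have "orbit_pt (p ^ K) (map (twist_pre w s) (\<psi> # \<psi>s)) es (w * frv s \<tau>) i
      = inverse (\<psi> i ^ ?P * inverse (w i)) * (\<psi> i ^ ?P * inverse (w i) * (w i * ?o ^ ?P)) ^ ?Q"
      by (simp only: es(1) list.map orbit_pt.simps IHi twist_pre_def vinv_apply frv_apply times_fun_apply)
    also have "\<psi> i ^ ?P * inverse (w i) * (w i * ?o ^ ?P) = (\<psi> i * ?o) ^ ?P"
      using w by (simp add: power_mult_distrib)
    also have "((\<psi> i * ?o) ^ ?P) ^ ?Q = ((\<psi> i * ?o) ^ ?Q) ^ ?P"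
      by (simp only: power_mult[symmetric] mult.commute)
    also have "inverse (\<psi> i ^ ?P * inverse (w i)) * ((\<psi> i * ?o) ^ ?Q) ^ ?P
      = w i * (inverse (\<psi> i) * (\<psi> i * ?o) ^ ?Q) ^ ?P"
      by (simp add: power_mult_distrib power_inverse ac_simps)
    also have "\<dots> = (w * frv s (orbit_pt (p ^ K) (\<psi> # \<psi>s) es \<tau>)) i"
      by (simp only: es(1) orbit_pt.simps times_fun_apply frv_apply)
    finally show "orbit_pt (p ^ K) (map (twist_pre w s) (\<psi> # \<psi>s)) es (w * frv s \<tau>) i
      = (w * frv s (orbit_pt (p ^ K) (\<psi> # \<psi>s) es \<tau>)) i" .
  qed
qed simp

lemma perp_walk:
  assumes "(*) w ` V \<subseteq> Fr s V'" "perp n V' y" shows "perp n V (w * frv s y)"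
  using perp_mono[OF perp_Fr[OF assms(2)] assms(1)] perp_mult by blast

lemma cov_prefix:
  assumes "cov b h V' y" "w \<in> Gv (p ^ s)" "s \<le> L" "(*) w ` V \<subseteq> Fr s V'"
  shows "cov (pre b) h V (w * frv s y)"
proof -
  obtain \<psi>s \<tau> es where o: "length \<psi>s \<le> h" "set \<psi>s \<subseteq> twists b" "\<tau> \<in> Gv b"
    "length es = length \<psi>s" "y = orbit_pt (p ^ K) \<psi>s es \<tau>"
    "\<forall>es'. length es' = length \<psi>s \<longrightarrow> perp n V' (orbit_pt (p ^ K) \<psi>s es' \<tau>)"
    using assms(1) by (rule covE)
  have w: "nonvan w" using assms(2) by (rule Gv_nonvan)
  have a: "w * frv s \<tau> \<in> Gv (pre b)"
    using Gv_mono[OF Gv_mult[OF Gv_frv[OF o(3)] assms(2)] pre_ge(2)[OF pow_le_L[OF assms(3)]]]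
    by (simp only: mult.commute)
  have b: "set (map (twist_pre w s) \<psi>s) \<subseteq> twists (pre b)"
    using o(2) twist_pre_twists[OF _ assms(2,3)] by auto
  have d: "perp n V (orbit_pt (p ^ K) (map (twist_pre w s) \<psi>s) es' (w * frv s \<tau>))"
    if "length es' = length (map (twist_pre w s) \<psi>s)" for es'
    using perp_walk[OF assms(4)] o(6) that by (simp add: orbit_pt_pre[OF w])
  have e: "w * frv s y = orbit_pt (p ^ K) (map (twist_pre w s) \<psi>s) es (w * frv s \<tau>)"
    using orbit_pt_pre[OF w o(4)] o(5) by simp
  show ?thesis by (rule covI[OF _ b a _ e d]) (use o(1,4) in simp_all)
qed

lemma pow_minus_one_dvd: "k dvd m \<Longrightarrow> (p ^ k - 1) dvd (p ^ m - 1)"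
proof -
  assume "k dvd m"
  then obtain t where t: "m = k * t" by (auto simp: dvd_def)
  have "int (p ^ k) - 1 dvd int (p ^ k) ^ t - 1" by (metis dvd_triv_left power_diff_1_eq)
  moreover have "int (p ^ k) - 1 = int (p ^ k - 1)" "int (p ^ k) ^ t - 1 = int (p ^ m - 1)"
    using p_pos by (simp_all add: of_nat_diff t power_mult)
  ultimately show ?thesis by (metis int_dvd_int_iff)
qed

lemma card_states_N: "card states \<le> N"
  using card_states N by linarith

text \<open>Along the cycle at \<open>V'\<close> the spaces are permuted by a twisted Frobenius map that \<open>\<psi>\<close>
  conjugates to the standard one; a long walk into the cycle therefore differs from its shortened
  version only by powers of \<open>\<psi>\<close>.\<close>

lemma cov_cycle:
  assumes walk: "eqwalk \<gamma> Vs j" and ij: "i < j" "j - i \<le> N" "Vs i = Vs j"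
    and V: "perp n (Vs 0) x" "nondeg n (Vs 0) x"
    and V': "perp n (Vs i) z" "nondeg n (Vs i) z"
    and y: "cov b h (Vs i) y"
  shows "cov (pre b) (Suc h) (Vs 0) (wprod \<gamma> i * frv i y)"
proof -
  let ?V = "Vs 0" let ?V' = "Vs i" let ?q = "p ^ K"
  define k where "k = j - i"
  have k: "0 < k" "k \<le> N" "j = i + k" using ij by (auto simp: k_def)
  have st: "Vs l \<in> states" if "l \<le> j" for l using walk that by (simp add: eqwalk_def)
  have \<gamma>: "\<gamma> l \<in> Gv (p - 1)" if "l < j" for l using walk that by (simp add: eqwalk_def)
  have edge: "(*) (\<gamma> l) ` Vs l = Fr 1 (Vs (Suc l))" if "l < j" for l using walk that by (simp add: eqwalk_def)
  have sub: "fvec.subspace (Vs l)" if "l \<le> j" for l using fin_gen_subspace[OF states_fin_gen[OF st[OF that]]] .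
  have eq_i: "eqwalk \<gamma> Vs i" using walk ij(1) by (auto simp: eqwalk_def)
  \<comment> \<open>One round of the cycle is the map \<open>y \<mapsto> c * frv k y\<close>, which
    sends solutions of \<open>?V'\<close> to solutions of \<open>?V'\<close>.\<close>
  define c where "c = wprod (\<lambda>l. \<gamma> (i + l)) k"
  have cV': "(*) c ` ?V' = Fr k ?V'"
    using wprod_eq[of "\<lambda>l. Vs (i + l)" k "\<lambda>l. \<gamma> (i + l)"] sub edge k ij(3) by (simp add: c_def)
  have cG: "c \<in> Gv (p ^ k)" unfolding c_def by (rule wprod_Gv) (use \<gamma> k in auto)
  obtain S where S: "S \<subseteq> vecs n W" "?V' = fvec.span S" using st[of i] ij(1) by (auto elim: statesE)
  have "c 0 = 1" "\<forall>i>n. c i = 1" using Gv_norm[OF cG] by auto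
  then obtain \<psi> where \<psi>: "\<And>l. \<psi> l ^ (p ^ k - 1) = c l" "nonvan \<psi>" "\<psi> 0 = 1" "\<forall>l>n. \<psi> l = 1"
    "\<forall>l\<le>n. \<psi> l \<in> quot_products n (elim_closure (Suc n) W)"
    using twist_root[OF S V'(2,1) Gv_nonvan[OF cG] cV'] by blast
  have kK: "k dvd K" unfolding K_def using k by (intro dvd_fact) auto
  obtain r where r: "p ^ K - 1 = (p ^ k - 1) * r" using pow_minus_one_dvd[OF kK] by (auto simp: dvd_def)
  have "p ^ k > 1" using one_less_power[of p k] k(1) p_ge2 by simp
  then have "1 \<le> p ^ k - 1" by linarith
  then have "r \<le> (p ^ k - 1) * r" using mult_le_mono1[of 1 "p ^ k - 1" r] by simp
  then have r_le: "r \<le> p ^ K" using r by linarith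
  have pow_eq: "(\<lambda>l. \<psi> l ^ (p ^ K - 1)) = (\<lambda>l. c l ^ r)" by (simp only: r power_mult \<psi>(1))
  have "p ^ k \<le> p ^ N" using k(2) p_pos by (intro power_increasing) auto
  then have "p ^ k * r \<le> p ^ N * p ^ K" using r_le by (rule mult_le_mono)
  then have "r * p ^ k \<le> p ^ N * p ^ K" by (simp only: mult.commute[of r])
  then have "(\<lambda>l. \<psi> l ^ (p ^ K - 1)) \<in> Gv (p ^ N * p ^ K)"
    unfolding pow_eq by (rule Gv_mono[OF Gv_power[OF cG]])
  then have root: "\<psi> \<in> roots" unfolding roots_def mem_Collect_eq using \<psi>(2,4,5) by blast
  define E where "E t = (\<lambda>l. \<psi> l ^ (?q ^ t - 1))" for t
  have nzE: "nonvan (E t)" for t using \<psi>(2) by (auto simp: E_def nonvan_def)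
  have Q: "p ^ m > 0" for m using p_pos by simp
  have pw: "\<psi> l * \<psi> l ^ (p ^ m - 1) = \<psi> l ^ (p ^ m)" for l m
    using Q[of m] by (metis Suc_pred' power_Suc)
  \<comment> \<open>\<open>t\<close> rounds multiply by \<open>\<psi> ^ (p ^ (k * t) - 1)\<close>:
    the exponents add up by \<open>(p ^ k - 1) * p ^ (k * t) + (p ^ (k * t) - 1) = p ^ (k * Suc t) -
    1\<close>. Conjugating Frobenius by \<open>\<psi>\<close> produces the same multiplier.\<close>
  have FrV': "Fr (k * t) ?V' = (*) (\<lambda>l. \<psi> l ^ (p ^ (k * t) - 1)) ` ?V'" for t
  proof (induction t)
    case 0
    have "(*) (\<lambda>l. 1) ` ?V' = ?V'" by (simp add: times_fun_def image_def)
    then show ?case using Fr_0[OF sub[of i]] ij(1) by simp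
  next
    case (Suc t)
    have "Fr (k * Suc t) ?V' = Fr (k * t) (Fr k ?V')" by (simp add: Fr_Fr add.commute)
    also have "\<dots> = Fr (k * t) ((*) c ` ?V')" by (simp only: cV')
    also have "\<dots> = (*) (frv (k * t) c) ` (*) (\<lambda>l. \<psi> l ^ (p ^ (k * t) - 1)) ` ?V'"
      by (simp only: Fr_mult Suc)
    also have "\<dots> = (*) (frv (k * t) c * (\<lambda>l. \<psi> l ^ (p ^ (k * t) - 1))) ` ?V'" by (rule mult_image_image)
    also have "frv (k * t) c * (\<lambda>l. \<psi> l ^ (p ^ (k * t) - 1)) = (\<lambda>l. \<psi> l ^ (p ^ (k * Suc t) - 1))"
    proof
      fix l
      have "(p ^ k - 1) * p ^ (k * t) + (p ^ (k * t) - 1) = p ^ (k * Suc t) - 1"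
      proof -
        have "(a - 1) * b + (b - 1) = a * b - 1" if "a > 0" "b > 0" for a b :: nat
          using that by (cases a) auto
        from this[OF Q[of k] Q[of "k * t"]] show ?thesis by (simp only: mult_Suc_right power_add)
      qed
      then show "(frv (k * t) c * (\<lambda>l. \<psi> l ^ (p ^ (k * t) - 1))) l = \<psi> l ^ (p ^ (k * Suc t) - 1)"
        by (simp only: times_fun_apply frv_apply \<psi>(1)[symmetric] power_mult[symmetric] power_add[symmetric])
    qed
    finally show ?case .
  qed
  have FrK: "Fr (K * t) ?V' = (*) (E t) ` ?V'" for t
  proof -
    obtain m where "K = k * m" using kK by (auto simp: dvd_def)
    then show ?thesis using FrV'[of "m * t"] by (simp add: E_def power_mult mult.assoc flip: power_mult)
  qed
  \<comment> \<open>The short walk ends in the same state, and the missing \<open>K * t\<close>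
    steps are to become the exponent \<open>t\<close> of the new twist.\<close>
  obtain \<gamma>' V'' s t where cut: "eqwalk \<gamma>' V'' s" "V'' 0 = ?V" "V'' s = ?V'" "i = s + K * t" "s \<le> card states * K"
    using eqwalk_cut[OF eq_i K_pos] by blast
  have sL: "s \<le> L"
  proof -
    have "s \<le> N * K" using cut(5) card_states_N mult_le_mono1 le_trans by blast
    then show ?thesis by (simp add: L_def)
  qed
  define w0 where "w0 = wprod \<gamma>' s"
  have w0G: "w0 \<in> Gv (p ^ s)" unfolding w0_def by (rule wprod_Gv) (use cut(1) in \<open>simp add: eqwalk_def\<close>)
  have w0V: "(*) w0 ` ?V = Fr s ?V'"
    using wprod_eq[of V'' s \<gamma>'] cut sub[of 0] by (simp add: w0_def eqwalk_def)
  define w where "w = wprod \<gamma> i"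
  have wG: "w \<in> Gv (p ^ i)" unfolding w_def by (rule wprod_Gv) (use \<gamma> ij(1) in auto)
  have wV: "(*) w ` ?V = Fr i ?V'"
    using wprod_eq[of Vs i \<gamma>] sub[of 0] edge ij(1) by (simp add: w_def)
  have shift: "Fr (s + K * t') ?V' = (*) (frv s (E t') * w0) ` ?V" for t'
  proof -
    have "Fr (s + K * t') ?V' = Fr s ((*) (E t') ` ?V')" by (simp only: Fr_Fr[symmetric] FrK)
    also have "\<dots> = (*) (frv s (E t')) ` (*) w0 ` ?V" by (simp only: Fr_mult w0V)
    finally show ?thesis by (simp only: mult_image_image)
  qed
  have nzw0: "nonvan w0" using w0G by (rule Gv_nonvan)
  \<comment> \<open>Both sides carry \<open>?V\<close> onto \<open>Fr i ?V'\<close>. Their quotient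
    is a diagonal map that preserves \<open>?V\<close> and has entry 1 at index 0, so it is 1 by
    nondegeneracy.\<close>
  have w_eq: "w = frv s (E t) * w0"
  proof
    fix l
    let ?g = "frv s (E t) * w0"
    have nzg: "nonvan ?g" using nonvan_mult[OF nonvan_frv[OF nzE] nzw0] .
    have "(*) w ` ?V = (*) ?g ` ?V" using wV shift[of t] cut(4) by simp
    then have "(*) (vinv ?g) ` (*) w ` ?V = ?V" using mult_image_cancel[OF nzg] by simp
    then have sub': "(*) (vinv ?g * w) ` ?V \<subseteq> ?V" by (simp only: mult_image_image)
    have norm: "w l = 1" "?g l = 1" if "l = 0 \<or> l > n" for l
      using that Gv_norm[OF wG that] Gv_norm[OF w0G that] \<psi>(3,4) by (auto simp: E_def frv_apply)
    show "w l = ?g l"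
    proof (cases "l \<le> n")
      case True
      obtain S0 where S0: "S0 \<subseteq> vecs n W" "?V = fvec.span S0" using st[of 0] by (auto elim: statesE)
      have "(vinv ?g * w) 0 = 1" using norm[of 0] by (simp add: vinv_apply)
      then have "(vinv ?g * w) l = 1"
        using stabilizer_trivial[OF S0 V(2,1) _ sub'] nonvan_mult[OF _ Gv_nonvan[OF wG]] nzg True by simp
      then have "inverse (?g l) * w l = 1" by (simp only: times_fun_apply vinv_apply)
      then show ?thesis using nzg by (simp only: nonvan_def) (metis inverse_inverse_eq inverse_unique)
    next
      case False
      then show ?thesis using norm[of l] by simp
    qed
  qed
  obtain \<psi>s \<tau> es where o: "length \<psi>s \<le> h" "set \<psi>s \<subseteq> twists b" "\<tau> \<in> Gv b"
    "length es = length \<psi>s" "y = orbit_pt ?q \<psi>s es \<tau>"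
    "\<forall>es'. length es' = length \<psi>s \<longrightarrow> perp n ?V' (orbit_pt ?q \<psi>s es' \<tau>)"
    using y by (rule covE)
  let ?\<psi>s = "map (twist_pre w0 s) (\<psi> # \<psi>s)" let ?\<tau> = "w0 * frv s \<tau>"
  have pt: "orbit_pt ?q ?\<psi>s (t' # es') ?\<tau> = (frv s (E t') * w0) * frv (s + K * t') (orbit_pt ?q \<psi>s es' \<tau>)"
    if "length es' = length \<psi>s" for t' es'
  proof -
    have "orbit_pt ?q ?\<psi>s (t' # es') ?\<tau> = w0 * frv s (orbit_pt ?q (\<psi> # \<psi>s) (t' # es') \<tau>)"
      using orbit_pt_pre[OF nzw0, of "t' # es'" "\<psi> # \<psi>s" s \<tau>] that by simp
    also have "orbit_pt ?q (\<psi> # \<psi>s) (t' # es') \<tau> = E t' * frv (K * t') (orbit_pt ?q \<psi>s es' \<tau>)"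
    proof
      fix l
      have "\<psi> l \<noteq> 0" using \<psi>(2) by (simp add: nonvan_def)
      moreover have "\<psi> l * E t' l = \<psi> l ^ (?q ^ t')" using pw[of l "K * t'"] by (simp add: E_def power_mult)
      ultimately show "orbit_pt ?q (\<psi> # \<psi>s) (t' # es') \<tau> l = (E t' * frv (K * t') (orbit_pt ?q \<psi>s es' \<tau>)) l"
        by (simp add: frv_apply power_mult power_mult_distrib flip: mult.assoc) (simp add: field_simps)
    qed
    finally show ?thesis by (simp only: frv_mult frv_frv ac_simps)
  qed
  have A: "w * frv i y = orbit_pt ?q ?\<psi>s (t # es) ?\<tau>"
    unfolding pt[OF o(4), of t] by (simp only: w_eq cut(4)[symmetric] o(5))
  \<comment> \<open>Every exponent \<open>t'\<close> yields a solution, not only the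
    \<open>t\<close> that belongs to the given point, because \<open>shift\<close> holds for all of
    them.\<close>
  have B: "perp n ?V (orbit_pt ?q ?\<psi>s es'' ?\<tau>)" if len: "length es'' = length ?\<psi>s" for es''
  proof -
    obtain t' es' where es: "es'' = t' # es'" "length es' = length \<psi>s" using len by (cases es'') auto
    have "perp n ?V' (orbit_pt ?q \<psi>s es' \<tau>)" using o(6) es(2) by simp
    then show ?thesis unfolding es(1) pt[OF es(2)]
      by (rule perp_walk[rotated]) (simp add: shift)
  qed
  have "frv 0 \<psi> * vinv 1 = \<psi>" by (auto simp: fun_eq_iff vinv_apply)
  then have "\<psi> \<in> twists 0" using twistsI[OF root Gv_one[of 0], of 0] by simp
  then have "\<psi> \<in> twists b" by (rule twists_mono) simp
  then have C: "set ?\<psi>s \<subseteq> twists (pre b)" using o(2) twist_pre_twists[OF _ w0G sL] by auto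
  have D: "?\<tau> \<in> Gv (pre b)"
    using Gv_mono[OF Gv_mult[OF Gv_frv[OF o(3)] w0G] pre_ge(2)[OF pow_le_L[OF sL]]]
    by (simp only: mult.commute)
  show ?thesis unfolding w_def[symmetric]
    by (rule covI[OF _ C D _ A B]) (use o(1,4) in simp_all)
qed

lemma edge_dim:
  assumes "V \<in> states" "V' \<in> states" "\<gamma> \<in> Gv (p - 1)" "(*) \<gamma> ` V \<subseteq> Fr 1 V'"
  shows "fvec.dim V \<le> fvec.dim V'" "fvec.dim V' \<le> fvec.dim V \<Longrightarrow> (*) \<gamma> ` V = Fr 1 V'"
proof -
  have fg: "fin_gen V" "fin_gen V'" by (rule states_fin_gen[OF assms(1)], rule states_fin_gen[OF assms(2)])
  have d: "fvec.dim ((*) \<gamma> ` V) = fvec.dim V" using dim_mult_eq[OF fg(1) Gv_nonvan[OF assms(3)]] .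
  have e: "fvec.dim (Fr 1 V') \<le> fvec.dim V'" using fg(2) by (rule dim_Fr_le)
  have "fvec.dim ((*) \<gamma> ` V) \<le> fvec.dim (Fr 1 V')"
    using assms(4) fin_gen_Fr[OF fg(2)] by (rule fin_gen_dim_mono)
  then show "fvec.dim V \<le> fvec.dim V'" using d e by linarith
  show "(*) \<gamma> ` V = Fr 1 V'" if "fvec.dim V' \<le> fvec.dim V"
    by (rule fin_gen_eqI[OF assms(4) fin_gen_mult[OF fg(1)] fin_gen_Fr[OF fg(2)]]) (use d e that in linarith)
qed

text \<open>Each step up in codimension costs two prefixes: the stretch from the recurring state to
  the increase of the dimension, and the shortened walk into the recurring state.\<close>

primrec bnd :: "nat \<Rightarrow> nat" where
  "bnd 0 = p ^ L"
| "bnd (Suc h) = pre (pre (bnd h))"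

lemma bnd_mono: "h \<le> h' \<Longrightarrow> bnd h \<le> bnd h'"
proof (rule lift_Suc_mono_le[of bnd])
  fix h
  show "bnd h \<le> bnd (Suc h)" using pre_ge(1)[of "bnd h"] pre_ge(1)[of "pre (bnd h)"] by simp
qed

lemma states_repeat:
  assumes "\<And>l. Vs l \<in> states"
  shows "\<exists>i j. m \<le> i \<and> i < j \<and> j \<le> m + N \<and> Vs i = (Vs j :: (nat \<Rightarrow> 'a) set)"
proof -
  have "\<exists>i\<in>{m..m + N}. \<exists>j\<in>{m..m + N}. i < j \<and> Vs i = Vs j"
    by (rule pigeonhole_le[of states]) (use assms card_states card_states_N in auto)
  then show ?thesis by (meson atLeastAtMost_iff)
qed

text \<open>Induction on \<open>n - dim V\<close>. If the dimension increases along the walk, the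
  induction hypothesis covers the rest, and the part before the increase costs at most one twist. If
  it never increases, the walk ends in the constant point 1, which plays the role of the
  rest.\<close>

lemma cover:
  assumes "V \<in> states" "x \<in> Gv B" "perp n V x" "nondeg n V x"
  shows "cov (bnd (n - fvec.dim V)) (n - fvec.dim V) V x"
  using assms
proof (induction "n - fvec.dim V" arbitrary: V x B rule: less_induct)
  case less
  let ?d = "fvec.dim V"
  let ?h = "n - ?d"
  obtain zs Vs \<gamma> where start: "zs 0 = x" "Vs 0 = V" and
    tr: "\<forall>l. zs l \<in> Gv (B div p ^ l) \<and> Vs l \<in> states \<and>
      perp n (Vs l) (zs l) \<and> nondeg n (Vs l) (zs l) \<and> \<gamma> l \<in> Gv (p - 1) \<and>
      zs l = \<gamma> l * frv 1 (zs (Suc l)) \<and> (*) (\<gamma> l) ` Vs l \<subseteq> Fr 1 (Vs (Suc l))"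
    using trajectory[OF less.prems(1,3,4,2)] by blast
  have z: "zs l \<in> Gv (B div p ^ l)" for l using tr[rule_format, of l] by (elim conjE)
  have st: "Vs l \<in> states" for l using tr[rule_format, of l] by (elim conjE)
  have perp: "perp n (Vs l) (zs l)" for l using tr[rule_format, of l] by (elim conjE)
  have nd: "nondeg n (Vs l) (zs l)" for l using tr[rule_format, of l] by (elim conjE)
  have \<gamma>: "\<gamma> l \<in> Gv (p - 1)" for l using tr[rule_format, of l] by (elim conjE)
  have zz: "zs l = \<gamma> l * frv 1 (zs (Suc l))" for l using tr[rule_format, of l] by (elim conjE)
  have edge: "(*) (\<gamma> l) ` Vs l \<subseteq> Fr 1 (Vs (Suc l))" for l using tr[rule_format, of l] by (elim conjE)
  have dim_mono: "fvec.dim (Vs l) \<le> fvec.dim (Vs m)" if "l \<le> m" for l m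
    by (rule lift_Suc_mono_le[of "\<lambda>l. fvec.dim (Vs l)"]) (use edge_dim(1)[OF st st \<gamma> edge] that in auto)
  have dim_n: "fvec.dim (Vs l) \<le> n" for l
    using perp_dim_le[OF states_vsupp[OF st] perp] Gv_norm[OF z] by simp
  have word1: "zs i = wprod (\<lambda>l. \<gamma> (i + l)) k * frv k (zs (i + k))" for i k
  proof -
    have "\<forall>l<k. zs (i + l) = \<gamma> (i + l) * frv 1 (zs (i + Suc l))"
      unfolding add_Suc_right by (intro allI impI zz)
    from wprod_point[where zs = "\<lambda>l. zs (i + l)", OF this] show ?thesis by (simp only: add_0_right)
  qed
  have word2: "wprod (\<lambda>l. \<gamma> (i + l)) k \<in> Gv (p ^ k)" for i k
    by (rule wprod_Gv) (intro allI impI \<gamma>)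
  have word3: "(*) (wprod (\<lambda>l. \<gamma> (i + l)) k) ` Vs i \<subseteq> Fr k (Vs (i + k))" for i k
  proof -
    have "\<forall>l<k. (*) (\<gamma> (i + l)) ` Vs (i + l) \<subseteq> Fr 1 (Vs (i + Suc l))"
      unfolding add_Suc_right by (intro allI impI edge)
    from wprod_subset[where V = "\<lambda>l. Vs (i + l)", OF this] show ?thesis by (simp only: add_0_right)
  qed
  have walk: "eqwalk \<gamma> Vs s" if "fvec.dim (Vs s) \<le> ?d" for s
    unfolding eqwalk_def
  proof (intro conjI allI impI)
    fix l assume l: "l < s"
    have "fvec.dim (Vs (Suc l)) \<le> fvec.dim (Vs l)"
      using dim_mono[of "Suc l" s] dim_mono[of 0 l] l that start(2) by simp
    then show "(*) (\<gamma> l) ` Vs l = Fr 1 (Vs (Suc l))" by (rule edge_dim(2)[OF st st \<gamma> edge])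
  qed (use st \<gamma> in simp_all)
  have cycle: "cov (pre b) (Suc h) V x"
    if c: "cov b h (Vs i) (zs i)" and ij: "i < j" "j - i \<le> N" "Vs i = Vs j" "fvec.dim (Vs j) \<le> ?d" for b h i j
  proof -
    have "cov (pre b) (Suc h) (Vs 0) (wprod \<gamma> i * frv i (zs i))"
      by (rule cov_cycle[OF walk[OF ij(4)] ij(1-3) _ _ perp nd c, of x]) (use less.prems start in simp_all)
    moreover have "wprod \<gamma> i * frv i (zs i) = x" using word1[of 0 i] start(1) by (simp only: add_0_left)
    ultimately show ?thesis using start(2) by simp
  qed
  show ?case
  proof (cases "\<exists>E. ?d < fvec.dim (Vs E)")
    case True
    define E where "E = (LEAST E. ?d < fvec.dim (Vs E))"
    have E: "?d < fvec.dim (Vs E)" unfolding E_def using True by (rule LeastI_ex)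
    have before: "fvec.dim (Vs l) \<le> ?d" if "l < E" for l
      using not_less_Least[of l "\<lambda>E. ?d < fvec.dim (Vs E)"] that unfolding E_def by simp
    have lt: "n - fvec.dim (Vs E) < ?h" using E dim_n[of E] by simp
    then obtain h where h: "?h = Suc h" "n - fvec.dim (Vs E) \<le> h" by (metis Suc_le_eq less_Suc_eq_le not0_implies_Suc not_less_zero)
    have "cov (bnd (n - fvec.dim (Vs E))) (n - fvec.dim (Vs E)) (Vs E) (zs E)"
      by (rule less.hyps[OF lt st z perp nd])
    then have covE: "cov (bnd h) h (Vs E) (zs E)" using bnd_mono[OF h(2)] h(2) by (rule cov_mono)
    have le: "pre (bnd h) \<le> bnd ?h" using pre_ge(1)[of "pre (bnd h)"] h(1) by simp
    show ?thesis
    proof (cases "E \<le> N")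
      case True
      have "E \<le> L" using True by (simp add: L_def)
      from cov_prefix[OF covE word2[where i = 0 and k = E, unfolded add_0_left] this word3[where i = 0 and k = E, unfolded add_0_left]]
      have "cov (pre (bnd h)) h V x" using word1[of 0 E] start by (simp only: add_0_left)
      then show ?thesis by (rule cov_mono[OF _ le]) (simp add: h(1))
    next
      case False
      \<comment> \<open>A repetition among the last \<open>N + 1\<close> states before the increase
        at \<open>E\<close>. What follows \<open>i\<close> is a prefix of bounded length; what
        precedes \<open>i\<close>, however long, is handled by the twist at this state.\<close>
      obtain i j where ij: "E - 1 - N \<le> i" "i < j" "j \<le> E - 1 - N + N" "Vs i = Vs j"
        using states_repeat[of Vs "E - 1 - N", OF st] by blast
      have E_eq: "E = i + (E - i)" and Ei: "E - i \<le> L" and jE: "j < E" "j - i \<le> N"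
        using ij False by (auto simp: L_def)
      have "cov (bnd h) h (Vs (i + (E - i))) (zs (i + (E - i)))" using covE E_eq by simp
      from cov_prefix[OF this word2 Ei word3]
      have "cov (pre (bnd h)) h (Vs i) (zs i)" using word1[of i "E - i"] by (simp only:)
      from cycle[OF this ij(2) jE(2) ij(4) before[OF jE(1)]] show ?thesis using h(1) by simp
    qed
  next
    case False
    then have flat: "fvec.dim (Vs l) \<le> ?d" for l by (meson not_less)
    \<comment> \<open>\<open>B < p ^ l\<close> for \<open>l \<ge> B\<close>, so all digits of the
      exponents have been read.\<close>
    have one: "zs l = 1" if "B \<le> l" for l
    proof -
      have "B < p ^ l" using that p_ge2 by (metis less_exp order_le_less_trans order_less_le_trans power_mono zero_le)
      then show ?thesis using z[of l] Gv_zero by simp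
    qed
    have triv: "cov b h (Vs l) (zs l)" if "B \<le> l" for b h l
      by (rule covI[of "[]" _ _ 1 "[]"]) (use one[OF that] perp[of l] Gv_one in simp_all)
    show ?thesis
    proof (cases ?h)
      case (Suc h)
      \<comment> \<open>From \<open>B\<close> on the point is 1, which is covered without any twist.
        A repetition there contributes the only twist.\<close>
      obtain i j where ij: "B \<le> i" "i < j" "j \<le> B + N" "Vs i = Vs j"
        using states_repeat[of Vs B, OF st] by blast
      have "cov (pre 0) (Suc h) V x"
        by (rule cycle[OF triv[OF ij(1)] ij(2) _ ij(4) flat]) (use ij in simp)
      moreover have "pre 0 \<le> bnd ?h" unfolding Suc bnd.simps pre_def by (intro add_mono mult_le_mono) auto
      ultimately show ?thesis using Suc by (simp only: cov_mono[OF _ _ order_refl])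
    next
      \<comment> \<open>In dimension \<open>n\<close> the space determines its solution. The prefix
        \<open>w\<close> of a shortened walk ending in the point 1 is a solution, hence equals
        \<open>x\<close> and bounds its exponents.\<close>
      case 0
      then have dn: "fvec.dim V = n" using dim_n[of 0] start(2) by simp
      obtain \<gamma>' V' s t where cut: "eqwalk \<gamma>' V' s" "V' 0 = Vs 0" "V' s = Vs B" "s \<le> card states * K"
        using eqwalk_cut[OF walk[OF flat] K_pos] by blast
      have "s \<le> N * K" using cut(4) card_states_N mult_le_mono1 le_trans by blast
      then have sL: "s \<le> L" by (simp add: L_def)
      define w where "w = wprod \<gamma>' s"
      have w: "w \<in> Gv (p ^ s)" unfolding w_def by (rule wprod_Gv) (use cut(1) in \<open>simp add: eqwalk_def\<close>)
      have wV: "(*) w ` V \<subseteq> Fr s (Vs B)"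
        using wprod_subset[of s \<gamma>' V'] cut start(2) by (simp add: w_def eqwalk_def)
      have "perp n (Vs B) 1" using perp[of B] one[of B] by simp
      from perp_walk[OF wV this] have pw: "perp n V w" by simp
      have "x = w"
      proof
        fix i
        show "x i = w i"
        proof (cases "i \<le> n")
          case True
          show ?thesis
            by (rule perp_dim_unique[OF states_vsupp[OF less.prems(1)] states_fin_gen[OF less.prems(1)] dn pw _ less.prems(3) _ True])
              (use Gv_norm[OF w] Gv_norm[OF less.prems(2)] in simp_all)
        next
          case False
          then show ?thesis using Gv_norm[OF w] Gv_norm[OF less.prems(2)] by simp
        qed
      qed
      moreover have "w \<in> Gv (bnd 0)" using Gv_mono[OF w] pow_le_L[OF sL] by simp
      ultimately show ?thesis unfolding 0
        by (intro covI[of "[]" _ _ w "[]"]) (use pw in simp_all)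
    qed
  qed
qed

end

subsection \<open>Vanishing of forms on orbits\<close>

lemma vsupp_span: "vsupp n \<subseteq> fvec.span (unit_vec ` {..n})"
proof
  fix f :: "nat \<Rightarrow> 'a::field" assume f: "f \<in> vsupp n"
  have "f = (\<Sum>i\<le>n. fscale (f i) (unit_vec i))"
  proof
    fix j
    have "(\<Sum>i\<le>n. fscale (f i) (unit_vec i)) j = (\<Sum>i\<le>n. if i = j then f i else 0)"
      unfolding fvec_sum_apply by (intro sum.cong refl) (auto simp: unit_vec_def fscale_apply)
    also have "\<dots> = f j" using f by (auto simp: vsupp_def)
    finally show "f j = (\<Sum>i\<le>n. fscale (f i) (unit_vec i)) j" by simp
  qed
  also have "\<dots> \<in> fvec.span (unit_vec ` {..n})"
    by (intro fvec.span_sum fvec.span_scale fvec.span_base imageI)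
  finally show "f \<in> fvec.span (unit_vec ` {..n})" .
qed

lemma independent_vsupp:
  fixes B :: "(nat \<Rightarrow> 'a::field) set"
  assumes "fvec.independent B" "B \<subseteq> vsupp n" shows "finite B \<and> card B \<le> Suc n"
proof -
  have "finite B \<and> card B \<le> card (unit_vec ` {..n} :: (nat \<Rightarrow> 'a) set)"
    using assms vsupp_span[of n] by (intro fvec.independent_span_bound) auto
  moreover have "card (unit_vec ` {..n} :: (nat \<Rightarrow> 'a) set) \<le> card {..n}" by (rule card_image_le) simp
  ultimately show ?thesis by simp
qed

lemma fin_gen_span_vsupp:
  assumes "Y \<subseteq> vsupp n" shows "fin_gen (fvec.span Y)"
proof -
  obtain B where B: "B \<subseteq> Y" "fvec.independent B" "Y \<subseteq> fvec.span B"
    using fvec.maximal_independent_subset[of Y] by blast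
  have "fvec.span Y = fvec.span B"
  proof (rule subset_antisym)
    show "fvec.span Y \<subseteq> fvec.span B" using B(3) by (rule fvec.span_minimal) (rule fvec.subspace_span)
    show "fvec.span B \<subseteq> fvec.span Y" using B(1) by (rule fvec.span_mono)
  qed
  moreover have "finite B" using independent_vsupp[OF B(2)] B(1) assms by blast
  ultimately show ?thesis by (auto simp: fin_gen_def)
qed

lemma vsupp_dependent:
  assumes "\<And>e. v e \<in> vsupp n"
  shows "\<exists>d\<le>Suc n. v d \<in> fvec.span (v ` {..<d})"
proof (rule ccontr)
  assume neg: "\<not> ?thesis"
  have "fvec.independent (v ` {..<e}) \<and> card (v ` {..<e}) = e" if "e \<le> Suc (Suc n)" for e
    using that
  proof (induction e)
    case 0
    show ?case by (simp add: fvec.independent_empty)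
  next
    case (Suc e)
    have ind: "fvec.independent (v ` {..<e})" and card: "card (v ` {..<e}) = e" using Suc by simp_all
    have nin: "v e \<notin> fvec.span (v ` {..<e})" using neg Suc.prems by auto
    have eq: "v ` {..<Suc e} = insert (v e) (v ` {..<e})" by (simp add: lessThan_Suc)
    have "v e \<notin> v ` {..<e}" using nin fvec.span_base[of "v e" "v ` {..<e}"] by argo
    then have "card (insert (v e) (v ` {..<e})) = Suc e" using card by simp
    moreover have "fvec.independent (insert (v e) (v ` {..<e}))"
      using nin ind by (rule fvec.independent_insertI)
    ultimately show ?case unfolding eq by simp
  qed
  from this[of "Suc (Suc n)"] show False
    using independent_vsupp[of "v ` {..<Suc (Suc n)}" n] assms by auto
qed

context char_p_field
begin

text \<open>Frobenius maps \<open>v e\<close> to \<open>v (Suc e)\<close>. Once \<open>v d\<close>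
  depends on its predecessors, their span is stable under Frobenius and contains all later vectors.
  As \<open>d \<le> n + 1\<close>, the equations for exponents up to \<open>n\<close> imply all
  others.\<close>

lemma forward_vanish:
  fixes n :: nat
  assumes "\<And>e. e \<le> n \<Longrightarrow> (\<Sum>i\<le>n. A i * y i ^ ((p ^ K) ^ e)) = (0 :: 'a)"
  shows "(\<Sum>i\<le>n. A i * y i ^ ((p ^ K) ^ e)) = 0"
proof -
  define v where "v e = (\<lambda>i. if i \<le> n then y i ^ ((p ^ K) ^ e) else 0)" for e
  have "v e \<in> vsupp n" for e by (simp add: v_def vsupp_def)
  then obtain d where d: "d \<le> Suc n" "v d \<in> fvec.span (v ` {..<d})" using vsupp_dependent[of v n] by auto
  have frv_v: "frv K (v e) = v (Suc e)" for e
  proof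
    fix i
    show "frv K (v e) i = v (Suc e) i"
      using p_pos by (auto simp: v_def frv_apply power_0_left mult.commute simp flip: power_mult)
  qed
  have "v e \<in> fvec.span (v ` {..<d})"
  proof (induction e)
    case 0
    show ?case
    proof (cases "d = 0")
      case True
      show ?thesis using d(2) by (simp only: True)
    next
      case False
      then show ?thesis by (intro fvec.span_base imageI) simp
    qed
  next
    case (Suc e)
    have "v (Suc e) \<in> Fr K (fvec.span (v ` {..<d}))"
      unfolding frv_v[symmetric] Fr_def by (rule fvec.span_base, rule imageI, rule Suc)
    also have "\<dots> = fvec.span ((\<lambda>e. v (Suc e)) ` {..<d})"
      by (simp only: Fr_span image_image frv_v)
    also have "\<dots> \<subseteq> fvec.span (v ` {..<d})"
    proof (rule fvec.span_minimal)
      show "(\<lambda>e. v (Suc e)) ` {..<d} \<subseteq> fvec.span (v ` {..<d})"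
      proof
        fix f assume "f \<in> (\<lambda>e. v (Suc e)) ` {..<d}"
        then obtain e where e: "e < d" "f = v (Suc e)" by blast
        show "f \<in> fvec.span (v ` {..<d})"
        proof (cases "Suc e = d")
          case True
          show ?thesis using d(2) by (simp only: e(2) True)
        next
          case False
          then show ?thesis unfolding e(2) using e(1) by (intro fvec.span_base imageI) simp
        qed
      qed
    qed (rule fvec.subspace_span)
    finally show ?case .
  qed
  moreover have "\<forall>f\<in>v ` {..<d}. (\<Sum>i\<in>{..n}. f i * A i) = 0"
  proof
    fix f assume "f \<in> v ` {..<d}"
    then obtain k where k: "k < d" "f = v k" by blast
    have "(\<Sum>i\<in>{..n}. f i * A i) = (\<Sum>i\<le>n. A i * y i ^ ((p ^ K) ^ k))"
      by (intro sum.cong) (auto simp: k(2) v_def)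
    then show "(\<Sum>i\<in>{..n}. f i * A i) = 0" using assms[of k] k(1) d(1) by simp
  qed
  ultimately have "(\<Sum>i\<in>{..n}. v e i * A i) = 0" by (rule span_sum_zero[rotated])
  moreover have "(\<Sum>i\<in>{..n}. v e i * A i) = (\<Sum>i\<le>n. A i * y i ^ ((p ^ K) ^ e))"
    by (intro sum.cong) (auto simp: v_def)
  ultimately show ?thesis by simp
qed

text \<open>Extraction of \<open>p ^ s\<close>-th roots from an equation: the coordinates of the
  coefficients in a basis over the \<open>p ^ s\<close>-th powers form a system of linear equations
  for \<open>y\<close> itself.\<close>

lemma form_decomp:
  fixes n :: nat
  assumes A: "\<And>i. A i \<in> F"
  obtains bs \<mu> where "\<forall>j i. \<mu> j i \<in> F" "\<forall>i. A i = (\<Sum>j<length bs. \<mu> j i ^ (p ^ s) * bs ! j)"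
    "\<forall>y. (\<forall>i. y i \<in> F) \<longrightarrow>
      ((\<Sum>i\<le>n. A i * y i ^ (p ^ s)) = 0 \<longleftrightarrow> (\<forall>j<length bs. (\<Sum>i\<le>n. \<mu> j i * y i) = 0))"
proof -
  obtain bs where bs: "q_basis (p ^ s) bs" using q_basis_exists by blast
  have "\<exists>u. (\<forall>j. u j \<in> F) \<and> A i = (\<Sum>j<length bs. u j ^ (p ^ s) * bs ! j)" for i
    using bs A[of i] by (simp add: q_basis_def)
  then have "\<exists>u. \<forall>i. (\<forall>j. u i j \<in> F) \<and> A i = (\<Sum>j<length bs. u i j ^ (p ^ s) * bs ! j)"
    by (intro choice allI)
  then obtain u where u: "\<And>i j. u i j \<in> F" "\<And>i. A i = (\<Sum>j<length bs. u i j ^ (p ^ s) * bs ! j)" by blast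
  have "(\<Sum>i\<le>n. A i * y i ^ (p ^ s)) = 0 \<longleftrightarrow> (\<forall>j<length bs. (\<Sum>i\<le>n. u i j * y i) = 0)"
    if y: "\<forall>i. y i \<in> F" for y
  proof -
    have "(\<Sum>i\<le>n. A i * y i ^ (p ^ s)) = (\<Sum>i\<le>n. \<Sum>j<length bs. (u i j * y i) ^ (p ^ s) * bs ! j)"
      by (simp add: u(2) sum_distrib_left power_mult_distrib ac_simps)
    also have "\<dots> = (\<Sum>j<length bs. \<Sum>i\<le>n. (u i j * y i) ^ (p ^ s) * bs ! j)" by (rule sum.swap)
    also have "\<dots> = (\<Sum>j<length bs. (\<Sum>i\<le>n. u i j * y i) ^ (p ^ s) * bs ! j)"
      by (simp only: frob_sum sum_distrib_right)
    finally have eq: "(\<Sum>i\<le>n. A i * y i ^ (p ^ s)) = (\<Sum>j<length bs. (\<Sum>i\<le>n. u i j * y i) ^ (p ^ s) * bs ! j)" .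
    have mem: "\<forall>j<length bs. (\<Sum>i\<le>n. u i j * y i) \<in> F"
      using u(1) y by (auto intro!: gen_field_sum gen_field_mult)
    show ?thesis
    proof
      assume "(\<Sum>i\<le>n. A i * y i ^ (p ^ s)) = 0"
      then have "(\<Sum>j<length bs. (\<Sum>i\<le>n. u i j * y i) ^ (p ^ s) * bs ! j) = 0" by (simp only: eq)
      with bs mem show "\<forall>j<length bs. (\<Sum>i\<le>n. u i j * y i) = 0"
        unfolding q_basis_def by (elim conjE allE[of _ "\<lambda>j. \<Sum>i\<le>n. u i j * y i"] impE)
    next
      assume "\<forall>j<length bs. (\<Sum>i\<le>n. u i j * y i) = 0"
      then show "(\<Sum>i\<le>n. A i * y i ^ (p ^ s)) = 0" unfolding eq using p_pos by (simp add: power_0_left)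
    qed
  qed
  then show thesis by (intro that[of "\<lambda>j i. u i j" bs] allI impI u)
qed

text \<open>The forms vanishing at all \<open>y\<^sup>q, y\<^sup>q\<^sup>2, \<dots>\<close> are spanned by Frobenius images of those
  vanishing at all \<open>y, y\<^sup>q, \<dots>\<close>; comparing dimensions, the two spaces agree.\<close>

lemma backward_step:
  fixes n :: nat
  assumes A: "\<And>i. A i \<in> F" and y: "\<And>i. y i \<in> F"
    and zero: "\<And>e. (\<Sum>i\<le>n. A i * y i ^ ((p ^ K) ^ Suc e)) = (0 :: 'a)"
  shows "(\<Sum>i\<le>n. A i * y i) = 0"
proof -
  \<comment> \<open>Coefficients are restricted to \<open>F\<close> so that
    \<open>form_decomp\<close> applies; dimensions are compared after taking spans over the whole
    field.\<close>
  define Z where "Z m = {B \<in> vsupp n. (\<forall>i. B i \<in> F) \<and> (\<forall>e\<ge>m. (\<Sum>i\<le>n. B i * y i ^ ((p ^ K) ^ e)) = 0)}" for m :: nat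
  have Zv: "Z m \<subseteq> vsupp n" for m by (auto simp: Z_def)
  have sub: "fvec.span (Z 0) \<subseteq> fvec.span (Z 1)" by (intro fvec.span_mono) (auto simp: Z_def)
  have "Z 1 \<subseteq> Fr K (fvec.span (Z 0))"
  proof
    fix B assume B: "B \<in> Z 1"
    have BF: "\<And>i. B i \<in> F" using B by (simp add: Z_def)
    obtain bs \<mu> where \<mu>: "\<forall>j i. \<mu> j i \<in> F" "\<forall>i. B i = (\<Sum>j<length bs. \<mu> j i ^ (p ^ K) * bs ! j)"
      and dec: "\<forall>y. (\<forall>i. y i \<in> F) \<longrightarrow>
        ((\<Sum>i\<le>n. B i * y i ^ (p ^ K)) = 0 \<longleftrightarrow> (\<forall>j<length bs. (\<Sum>i\<le>n. \<mu> j i * y i) = 0))"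
      by (rule form_decomp[of B K n, OF BF])
    define \<nu> where "\<nu> j = (\<lambda>i. if i \<le> n then \<mu> j i else 0)" for j
    have "\<nu> j \<in> Z 0" if j: "j < length bs" for j
    proof -
      have "(\<Sum>i\<le>n. \<mu> j i * y i ^ ((p ^ K) ^ e)) = 0" for e
      proof -
        have "\<forall>e\<ge>1. (\<Sum>i\<le>n. B i * y i ^ ((p ^ K) ^ e)) = 0"
          using B unfolding Z_def mem_Collect_eq by (elim conjE)
        from this[rule_format, of "Suc e"] have "(\<Sum>i\<le>n. B i * y i ^ ((p ^ K) ^ Suc e)) = 0" by simp
        then have "(\<Sum>i\<le>n. B i * (y i ^ ((p ^ K) ^ e)) ^ (p ^ K)) = 0"
          by (simp only: power_Suc2 power_mult)
        then show ?thesis using dec[rule_format, of "\<lambda>i. y i ^ ((p ^ K) ^ e)", OF gen_field_power[OF y]] j by blast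
      qed
      then have "(\<Sum>i\<le>n. \<nu> j i * y i ^ ((p ^ K) ^ e)) = 0" for e by (simp add: \<nu>_def)
      then show ?thesis using \<mu>(1) by (auto simp: Z_def \<nu>_def vsupp_def gen_field_zero)
    qed
    then have mem: "frv K (\<nu> j) \<in> Fr K (fvec.span (Z 0))" if "j < length bs" for j
      unfolding Fr_def using that by (intro fvec.span_base imageI)
    have "B = (\<Sum>j<length bs. fscale (bs ! j) (frv K (\<nu> j)))"
    proof
      fix i
      show "B i = (\<Sum>j<length bs. fscale (bs ! j) (frv K (\<nu> j))) i"
      proof (cases "i \<le> n")
        case True
        then show ?thesis by (simp add: \<mu>(2)[rule_format, of i] fvec_sum_apply fscale_apply frv_apply \<nu>_def mult.commute)
      next
        case False
        then have "B i = 0" using B by (simp add: Z_def vsupp_def)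
        then show ?thesis using False p_pos
          by (simp add: fvec_sum_apply fscale_apply frv_apply \<nu>_def power_0_left)
      qed
    qed
    also have "\<dots> \<in> Fr K (fvec.span (Z 0))"
      unfolding Fr_def by (intro fvec.span_sum fvec.span_scale) (use mem in \<open>simp add: Fr_def\<close>)
    finally show "B \<in> Fr K (fvec.span (Z 0))" .
  qed
  then have "fvec.span (Z 1) \<subseteq> Fr K (fvec.span (Z 0))"
    by (rule fvec.span_minimal) (simp add: Fr_def)
  then have "fvec.dim (fvec.span (Z 1)) \<le> fvec.dim (Fr K (fvec.span (Z 0)))"
    using fin_gen_Fr[OF fin_gen_span_vsupp[OF Zv]] by (rule fin_gen_dim_mono)
  also have "\<dots> \<le> fvec.dim (fvec.span (Z 0))" by (rule dim_Fr_le[OF fin_gen_span_vsupp[OF Zv]])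
  finally have eq: "fvec.span (Z 0) = fvec.span (Z 1)"
    by (rule fin_gen_eqI[OF sub fin_gen_span_vsupp[OF Zv] fin_gen_span_vsupp[OF Zv]])
  let ?A = "\<lambda>i. if i \<le> n then A i else 0"
  have "(\<Sum>i\<le>n. A i * y i ^ ((p ^ K) ^ e)) = 0" if "e \<ge> 1" for e
    using zero[of "e - 1"] that by (metis Suc_diff_1 less_le_trans zero_less_one)
  then have "?A \<in> Z 1" using A by (simp add: Z_def vsupp_def gen_field_zero)
  then have "?A \<in> fvec.span (Z 0)" unfolding eq by (rule fvec.span_base)
  moreover have "\<forall>B\<in>Z 0. (\<Sum>i\<in>{..n}. B i * y i) = 0"
  proof
    fix B assume "B \<in> Z 0"
    then have "(\<Sum>i\<le>n. B i * y i ^ ((p ^ K) ^ 0)) = 0" unfolding Z_def by blast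
    then show "(\<Sum>i\<in>{..n}. B i * y i) = 0" by simp
  qed
  ultimately have "(\<Sum>i\<in>{..n}. ?A i * y i) = 0" by (rule span_sum_zero[rotated])
  then show ?thesis by simp
qed

lemma backward_vanish:
  fixes n :: nat
  assumes A: "\<And>i. A i \<in> F" and y: "\<And>i. y i \<in> F"
    and "\<And>e. e \<ge> m \<Longrightarrow> (\<Sum>i\<le>n. A i * y i ^ ((p ^ K) ^ e)) = (0 :: 'a)"
  shows "(\<Sum>i\<le>n. A i * y i) = 0"
  using assms(3)
proof (induction m)
  case 0
  from 0[of 0] show ?case by simp
next
  case (Suc m)
  have "(\<Sum>i\<le>n. A i * y i ^ ((p ^ K) ^ m)) = 0"
  proof (rule backward_step[OF A])
    show "y i ^ ((p ^ K) ^ m) \<in> F" for i using y by (rule gen_field_power)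
    show "(\<Sum>i\<le>n. A i * (y i ^ ((p ^ K) ^ m)) ^ ((p ^ K) ^ Suc e)) = 0" for e
      using Suc.prems[of "m + Suc e"] by (simp only: power_add power_mult)
  qed
  then show ?case using Suc.prems by (intro Suc.IH) (metis not_less_eq_eq le_antisym)
qed

lemma orbit_pt_F:
  assumes "\<And>\<psi> i. \<psi> \<in> set \<psi>s \<Longrightarrow> \<psi> i \<in> F" "\<And>i. \<tau> i \<in> F"
  shows "orbit_pt q \<psi>s es \<tau> i \<in> F"
  using assms(1)
proof (induction \<psi>s arbitrary: es i)
  case (Cons \<psi> \<psi>s)
  then show ?case by (cases es) (auto intro!: gen_field_mult gen_field_inverse gen_field_power assms(2))
qed (simp add: assms(2))

lemma orbit_pt_sum:
  fixes n :: nat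
  shows "(\<Sum>i\<le>n. A i * orbit_pt q (\<psi> # \<psi>s) (e # es) \<tau> i)
    = (\<Sum>i\<le>n. (A i * inverse (\<psi> i) * \<psi> i ^ (q ^ e)) * orbit_pt q \<psi>s es \<tau> i ^ (q ^ e))"
  by (intro sum.cong refl) (simp add: power_mult_distrib ac_simps)

text \<open>For a fixed first exponent \<open>k \<le> n\<close>, extracting roots leaves equations
  on the orbit of the remaining twists, to which the induction hypothesis applies; afterwards
  \<open>forward_vanish\<close> releases the first exponent.\<close>

lemma orbit_check:
  fixes n :: nat
  assumes \<psi>: "\<And>\<psi> i. \<psi> \<in> set \<psi>s \<Longrightarrow> \<psi> i \<in> F" and \<tau>: "\<And>i. \<tau> i \<in> F" and A: "\<And>i. A i \<in> F"
    and box: "\<And>es. length es = length \<psi>s \<Longrightarrow> set es \<subseteq> {..n} \<Longrightarrow> (\<Sum>i\<le>n. A i * orbit_pt (p ^ K) \<psi>s es \<tau> i) = 0"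
    and es: "length es = length \<psi>s"
  shows "(\<Sum>i\<le>n. A i * orbit_pt (p ^ K) \<psi>s es \<tau> i) = 0"
  using \<psi> A box es
proof (induction \<psi>s arbitrary: A es)
  case (Cons \<psi> \<psi>s)
  obtain e es' where es: "es = e # es'" "length es' = length \<psi>s" using Cons.prems(4) by (cases es) auto
  have \<psi>F: "\<psi> i \<in> F" and \<psi>sF: "\<psi>' \<in> set \<psi>s \<Longrightarrow> \<psi>' i \<in> F" for i \<psi>' using Cons.prems(1) by auto
  let ?B = "\<lambda>e i. A i * inverse (\<psi> i) * \<psi> i ^ ((p ^ K) ^ e)"
  have small: "(\<Sum>i\<le>n. ?B k i * orbit_pt (p ^ K) \<psi>s fs \<tau> i ^ ((p ^ K) ^ k)) = 0"
    if k: "k \<le> n" and fs: "length fs = length \<psi>s" for k fs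
  proof -
    have BF: "?B k i \<in> F" for i
      using Cons.prems(2) \<psi>F by (intro gen_field_mult gen_field_inverse gen_field_power)
    obtain bs \<mu> where \<mu>: "\<forall>j i. \<mu> j i \<in> F" "\<forall>i. ?B k i = (\<Sum>j<length bs. \<mu> j i ^ (p ^ (K * k)) * bs ! j)"
      and dec: "\<forall>y. (\<forall>i. y i \<in> F) \<longrightarrow>
        ((\<Sum>i\<le>n. ?B k i * y i ^ (p ^ (K * k))) = 0 \<longleftrightarrow> (\<forall>j<length bs. (\<Sum>i\<le>n. \<mu> j i * y i) = 0))"
      by (rule form_decomp[of "?B k" "K * k" n, OF BF])
    have oF: "\<And>i. orbit_pt (p ^ K) \<psi>s fs \<tau> i \<in> F" for fs
      by (rule orbit_pt_F) (use \<psi>sF \<tau> in auto)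
    have "(\<Sum>i\<le>n. \<mu> j i * orbit_pt (p ^ K) \<psi>s fs \<tau> i) = 0" if j: "j < length bs" for j
    proof (rule Cons.IH)
      show "\<psi>' i \<in> F" if "\<psi>' \<in> set \<psi>s" for \<psi>' i using that by (rule \<psi>sF)
      show "\<mu> j i \<in> F" for i by (rule \<mu>(1)[rule_format])
      show "length fs = length \<psi>s" by (rule fs)
      fix gs :: "nat list" assume gs: "length gs = length \<psi>s" "set gs \<subseteq> {..n}"
      have "(\<Sum>i\<le>n. A i * orbit_pt (p ^ K) (\<psi> # \<psi>s) (k # gs) \<tau> i) = 0"
        by (rule Cons.prems(3)) (use gs k in auto)
      then have "(\<Sum>i\<le>n. ?B k i * orbit_pt (p ^ K) \<psi>s gs \<tau> i ^ (p ^ (K * k))) = 0"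
        unfolding orbit_pt_sum by (simp only: power_mult)
      then show "(\<Sum>i\<le>n. \<mu> j i * orbit_pt (p ^ K) \<psi>s gs \<tau> i) = 0"
        using dec[rule_format, of "orbit_pt (p ^ K) \<psi>s gs \<tau>", OF oF] j by blast
    qed
    then show ?thesis using dec[rule_format, of "orbit_pt (p ^ K) \<psi>s fs \<tau>", OF oF] by (simp only: power_mult) blast
  qed
  have eq: "(\<Sum>i\<le>n. A i * orbit_pt (p ^ K) (\<psi> # \<psi>s) (k # es') \<tau> i)
      = (\<Sum>i\<le>n. (A i * inverse (\<psi> i)) * (\<psi> i * orbit_pt (p ^ K) \<psi>s es' \<tau> i) ^ ((p ^ K) ^ k))" for k
    by (simp add: mult.assoc)
  have "(\<Sum>i\<le>n. (A i * inverse (\<psi> i)) * (\<psi> i * orbit_pt (p ^ K) \<psi>s es' \<tau> i) ^ ((p ^ K) ^ e)) = 0"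
  proof (rule forward_vanish)
    fix k assume "k \<le> n"
    from small[OF this es(2)] show "(\<Sum>i\<le>n. (A i * inverse (\<psi> i)) * (\<psi> i * orbit_pt (p ^ K) \<psi>s es' \<tau> i) ^ ((p ^ K) ^ k)) = 0"
      unfolding eq[symmetric] orbit_pt_sum .
  qed
  then show ?case unfolding es(1) eq .
qed auto

end

section \<open>Products of Frobenius powers with independent exponents\<close>

fun multi_power :: "nat \<Rightarrow> (nat \<Rightarrow> 'a::field) list \<Rightarrow> nat list \<Rightarrow> nat \<Rightarrow> 'a" where
  "multi_power q (y # ys) (l # ls) = (\<lambda>i. y i ^ (q ^ l) * multi_power q ys ls i)"
| "multi_power q _ _ = (\<lambda>i. 1)"

text \<open>Passing from conjugates to products: \<open>\<psi>\<^sub>1\<^sup>-\<^sup>1 (\<psi>\<^sub>1/\<psi>\<^sub>2)\<^sup>q\<^sup>a (\<psi>\<^sub>2/\<psi>\<^sub>3)\<^sup>q\<^sup>b \<dots>\<close>,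
  where the exponents \<open>a, b, \<dots>\<close> are the partial sums of the orbit parameters.\<close>

primrec to_product :: "(nat \<Rightarrow> 'a::field) list \<Rightarrow> (nat \<Rightarrow> 'a) \<Rightarrow> (nat \<Rightarrow> 'a) \<times> (nat \<Rightarrow> 'a) list" where
  "to_product [] \<tau> = (\<tau>, [])"
| "to_product (\<psi> # \<psi>s) \<tau> =
     (\<lambda>i. inverse (\<psi> i), (\<lambda>i. \<psi> i * fst (to_product \<psi>s \<tau>) i) # snd (to_product \<psi>s \<tau>))"

primrec partial_sums :: "nat list \<Rightarrow> nat list" where
  "partial_sums [] = []"
| "partial_sums (e # es) = e # map ((+) e) (partial_sums es)"

lemma length_to_product [simp]: "length (snd (to_product \<psi>s \<tau>)) = length \<psi>s"
  by (induction \<psi>s) auto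

lemma length_partial_sums [simp]: "length (partial_sums es) = length es"
  by (induction es) auto

lemma multi_power_shift:
  "length ls = length ys \<Longrightarrow> multi_power q ys (map ((+) e) ls) i = multi_power q ys ls i ^ (q ^ e)"
proof (induction ys arbitrary: ls)
  case (Cons y ys)
  then obtain l ls' where ls: "ls = l # ls'" "length ls' = length ys" by (cases ls) auto
  have "y i ^ (q ^ (e + l)) = (y i ^ (q ^ l)) ^ (q ^ e)"
    by (simp add: power_add mult.commute flip: power_mult)
  then show ?case using Cons.IH[OF ls(2)] by (simp add: ls(1) power_mult_distrib)
qed simp

lemma orbit_pt_to_product:
  "length es = length \<psi>s \<Longrightarrow> orbit_pt q \<psi>s es \<tau> i =
    fst (to_product \<psi>s \<tau>) i * multi_power q (snd (to_product \<psi>s \<tau>)) (partial_sums es) i"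
proof (induction \<psi>s arbitrary: es)
  case (Cons \<psi> \<psi>s)
  then obtain e es' where es: "es = e # es'" "length es' = length \<psi>s" by (cases es) auto
  show ?case using Cons.IH[OF es(2)]
    by (simp add: es multi_power_shift power_mult_distrib mult.assoc)
qed simp

context char_p_field
begin

lemma to_product_F:
  assumes "\<And>\<psi> i. \<psi> \<in> set \<psi>s \<Longrightarrow> \<psi> i \<in> F" "\<And>i. \<tau> i \<in> F"
  shows "fst (to_product \<psi>s \<tau>) i \<in> F \<and> multi_power q (snd (to_product \<psi>s \<tau>)) ls i \<in> F"
  using assms(1)
proof (induction \<psi>s arbitrary: ls i)
  case Nil
  show ?case by (simp add: assms(2) gen_field_one)
next
  case (Cons \<psi> \<psi>s)
  have "\<psi> i \<in> F" using Cons.prems by simp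
  moreover have "fst (to_product \<psi>s \<tau>) i \<in> F" "multi_power q (snd (to_product \<psi>s \<tau>)) ls' i \<in> F" for ls'
    using Cons.IH[of i ls'] Cons.prems by auto
  ultimately show ?case
    by (cases ls) (auto intro!: gen_field_mult gen_field_power gen_field_inverse gen_field_one)
qed

text \<open>With first exponent \<open>l\<close>, an orbit only reaches further exponents that are
  at least \<open>l\<close>. Extracting roots and applying the induction hypothesis frees these from
  each other; \<open>backward_vanish\<close> then removes the common shift by
  \<open>l\<close>.\<close>

lemma product_vanish:
  fixes n :: nat
  assumes \<psi>: "\<And>\<psi> i. \<psi> \<in> set \<psi>s \<Longrightarrow> \<psi> i \<in> F" and \<tau>: "\<And>i. \<tau> i \<in> F" and A: "\<And>i. A i \<in> F"
    and zero: "\<And>es. length es = length \<psi>s \<Longrightarrow> (\<Sum>i\<le>n. A i * orbit_pt (p ^ K) \<psi>s es \<tau> i) = 0"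
    and ls: "length ls = length \<psi>s"
  shows "(\<Sum>i\<le>n. A i * (fst (to_product \<psi>s \<tau>) i * multi_power (p ^ K) (snd (to_product \<psi>s \<tau>)) ls i)) = 0"
  using \<psi> A zero ls
proof (induction \<psi>s arbitrary: A ls)
  case Nil
  then show ?case using Nil.prems(3)[of "[]"] by simp
next
  case (Cons \<psi> \<psi>s)
  obtain l ls' where ls: "ls = l # ls'" "length ls' = length \<psi>s" using Cons.prems(4) by (cases ls) auto
  have \<psi>F: "\<psi> i \<in> F" and \<psi>sF: "\<psi>' \<in> set \<psi>s \<Longrightarrow> \<psi>' i \<in> F" for i \<psi>' using Cons.prems(1) by auto
  let ?x = "fst (to_product \<psi>s \<tau>)" let ?m = "multi_power (p ^ K) (snd (to_product \<psi>s \<tau>))"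
  let ?q = "p ^ K"
  have xF: "?x i \<in> F" and mF: "?m ks i \<in> F" for i ks using to_product_F[of \<psi>s \<tau>] \<psi>sF \<tau> by auto
  let ?B = "\<lambda>i. A i * inverse (\<psi> i) * \<psi> i ^ (?q ^ l)"
  have BF: "?B i \<in> F" for i
    using Cons.prems(2) \<psi>F by (intro gen_field_mult gen_field_inverse gen_field_power)
  obtain bs \<mu> where \<mu>: "\<forall>j i. \<mu> j i \<in> F" "\<forall>i. ?B i = (\<Sum>j<length bs. \<mu> j i ^ (p ^ (K * l)) * bs ! j)"
    and dec: "\<forall>y. (\<forall>i. y i \<in> F) \<longrightarrow>
        ((\<Sum>i\<le>n. ?B i * y i ^ (p ^ (K * l))) = 0 \<longleftrightarrow> (\<forall>j<length bs. (\<Sum>i\<le>n. \<mu> j i * y i) = 0))"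
    by (rule form_decomp[of ?B "K * l" n, OF BF])
  have oF: "\<And>i. orbit_pt ?q \<psi>s fs \<tau> i \<in> F" for fs
    by (rule orbit_pt_F) (use \<psi>sF \<tau> in auto)
  have shifted: "(\<Sum>i\<le>n. ?B i * (?x i * ?m ks i) ^ (?q ^ l)) = 0" if ks: "length ks = length \<psi>s" for ks
  proof -
    have "(\<Sum>i\<le>n. \<mu> j i * (?x i * ?m ks i)) = 0" if j: "j < length bs" for j
    proof (rule Cons.IH)
      show "\<psi>' i \<in> F" if "\<psi>' \<in> set \<psi>s" for \<psi>' i using that by (rule \<psi>sF)
      show "\<mu> j i \<in> F" for i by (rule \<mu>(1)[rule_format])
      show "length ks = length \<psi>s" by (rule ks)
      fix gs :: "nat list" assume gs: "length gs = length \<psi>s"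
      have "(\<Sum>i\<le>n. A i * orbit_pt ?q (\<psi> # \<psi>s) (l # gs) \<tau> i) = 0"
        by (rule Cons.prems(3)) (use gs in simp)
      then have "(\<Sum>i\<le>n. ?B i * orbit_pt ?q \<psi>s gs \<tau> i ^ (p ^ (K * l))) = 0"
        unfolding orbit_pt_sum by (simp only: power_mult)
      then show "(\<Sum>i\<le>n. \<mu> j i * orbit_pt ?q \<psi>s gs \<tau> i) = 0"
        using dec[rule_format, of "orbit_pt ?q \<psi>s gs \<tau>", OF oF] j by blast
    qed
    then have "(\<Sum>i\<le>n. ?B i * (?x i * ?m ks i) ^ (p ^ (K * l))) = 0"
      using dec[rule_format, of "\<lambda>i. ?x i * ?m ks i", OF gen_field_mult[OF xF mF]] by blast
    then show ?thesis by (simp only: power_mult)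
  qed
  have "(\<Sum>i\<le>n. (?B i * ?x i ^ (?q ^ l)) * ?m ls' i) = 0"
  proof (rule backward_vanish[where m = l and K = K])
    show "?B i * ?x i ^ (?q ^ l) \<in> F" for i using BF xF by (intro gen_field_mult[of "?B i"] gen_field_power)
    show "?m ls' i \<in> F" for i by (rule mF)
    fix e assume "e \<ge> l"
    then have e: "?q ^ e = ?q ^ (e - l) * ?q ^ l" by (simp flip: power_add)
    have "(\<Sum>i\<le>n. (?B i * ?x i ^ (?q ^ l)) * ?m ls' i ^ (?q ^ e))
      = (\<Sum>i\<le>n. ?B i * (?x i * ?m (map ((+) (e - l)) ls') i) ^ (?q ^ l))"
      by (intro sum.cong refl)
        (simp only: e power_mult multi_power_shift ls(2) length_to_product power_mult_distrib mult.assoc)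
    then show "(\<Sum>i\<le>n. (?B i * ?x i ^ (?q ^ l)) * ?m ls' i ^ (?q ^ e)) = 0"
      using shifted[of "map ((+) (e - l)) ls'"] ls(2) by simp
  qed
  moreover have "(\<Sum>i\<le>n. A i * (fst (to_product (\<psi> # \<psi>s) \<tau>) i * multi_power ?q (snd (to_product (\<psi> # \<psi>s) \<tau>)) ls i))
    = (\<Sum>i\<le>n. (?B i * ?x i ^ (?q ^ l)) * ?m ls' i)"
    by (intro sum.cong refl) (simp add: ls(1) power_mult_distrib ac_simps)
  ultimately show ?case by simp
qed

end

subsection \<open>Orbits and products in coordinates\<close>

text \<open>The default 1 agrees with the normalisation beyond \<open>n\<close> in \<open>Gv\<close>
  and \<open>roots\<close> and introduces no zeros among multipliers.\<close>

abbreviation pt_fun :: "'a::field list \<Rightarrow> nat \<Rightarrow> 'a" where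
  "pt_fun xs \<equiv> nth_default 1 xs"

abbreviation pt_list :: "nat \<Rightarrow> (nat \<Rightarrow> 'a) \<Rightarrow> 'a list" where
  "pt_list n f \<equiv> map f [0..<Suc n]"

lemma pt_list_eqI: "length xs = Suc n \<Longrightarrow> (\<And>i. i \<le> n \<Longrightarrow> xs ! i = f i) \<Longrightarrow> xs = pt_list n f"
  by (rule nth_equalityI) (auto simp del: upt_Suc)

lemma frob_funpow_hpoint: "(frob q ^^ e) (hpoint xs) = hpoint (map (\<lambda>x. x ^ (q ^ e)) xs)"
proof (induction e)
  case (Suc e)
  have "(frob q ^^ Suc e) (hpoint xs) = frob q (hpoint (map (\<lambda>x. x ^ (q ^ e)) xs))" using Suc by simp
  also have "\<dots> = hpoint (map (\<lambda>x. x ^ (q ^ Suc e)) xs)"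
    by (simp add: frob_hpoint o_def mult.commute flip: power_mult)
  finally show ?case .
qed simp

lemma conj_frob_hpoint:
  assumes "length g = Suc n"
  shows "conj_frob q g e (hpoint (pt_list n f))
    = hpoint (pt_list n (\<lambda>i. inverse (pt_fun g i) * (pt_fun g i * f i) ^ (q ^ e)))"
proof -
  have "map2 (*) (map inverse g) (map (\<lambda>x. x ^ (q ^ e)) (map2 (*) g (pt_list n f)))
      = pt_list n (\<lambda>i. inverse (pt_fun g i) * (pt_fun g i * f i) ^ (q ^ e))"
    using assms by (intro pt_list_eqI) (simp_all add: nth_default_eq del: upt_Suc)
  then show ?thesis
    by (simp only: conj_frob_def o_apply diag_map_hpoint frob_funpow_hpoint)
qed

lemma foldr_conj_frob:
  assumes "\<forall>g\<in>set gs. length g = Suc n" "length es = length gs"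
  shows "foldr (\<circ>) (map2 (conj_frob q) gs es) id (hpoint (pt_list n f))
    = hpoint (pt_list n (orbit_pt q (map pt_fun gs) es f))"
  using assms
proof (induction gs arbitrary: es)
  case (Cons g gs)
  then obtain e es' where es: "es = e # es'" "length es' = length gs" by (cases es) auto
  have g: "length g = Suc n" using Cons.prems(1) by simp
  have "foldr (\<circ>) (map2 (conj_frob q) (g # gs) es) id (hpoint (pt_list n f))
    = conj_frob q g e (foldr (\<circ>) (map2 (conj_frob q) gs es') id (hpoint (pt_list n f)))"
    by (simp add: es(1) del: upt_Suc)
  also have "foldr (\<circ>) (map2 (conj_frob q) gs es') id (hpoint (pt_list n f))
    = hpoint (pt_list n (orbit_pt q (map pt_fun gs) es' f))"
    by (rule Cons.IH) (use Cons.prems(1) es(2) in simp_all)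
  also have "conj_frob q g e \<dots> = hpoint (pt_list n (\<lambda>i. inverse (pt_fun g i) *
      (pt_fun g i * orbit_pt q (map pt_fun gs) es' f i) ^ (q ^ e)))"
    by (rule conj_frob_hpoint[OF g])
  finally show ?case by (simp only: es(1) list.map orbit_pt.simps)
qed simp

lemma frob_orbit_hpoint:
  assumes "\<forall>g\<in>set gs. length g = Suc n" "length t = Suc n"
  shows "frob_orbit q gs {hpoint t}
    = {hpoint (pt_list n (orbit_pt q (map pt_fun gs) es (pt_fun t))) | es. length es = length gs}"
proof -
  have "t = pt_list n (pt_fun t)" using assms(2) by (intro pt_list_eqI) (simp_all add: nth_default_eq)
  then have "foldr (\<circ>) (map2 (conj_frob q) gs es) id (hpoint t)
    = hpoint (pt_list n (orbit_pt q (map pt_fun gs) es (pt_fun t)))" if "length es = length gs" for es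
    using foldr_conj_frob[OF assms(1) that, where q = q and f = "pt_fun t"] by (simp only:)
  then show ?thesis unfolding frob_orbit_def by auto
qed

lemma foldl_pmult:
  assumes "\<forall>g\<in>set gs. length g = Suc n" "length ls = length gs"
  shows "foldl pmult (hpoint (pt_list n f)) (map2 (\<lambda>l. frob q ^^ l) ls (map hpoint gs))
    = hpoint (pt_list n (\<lambda>i. f i * multi_power q (map pt_fun gs) ls i))"
  using assms
proof (induction gs arbitrary: ls f)
  case (Cons g gs)
  then obtain l ls' where ls: "ls = l # ls'" "length ls' = length gs" by (cases ls) auto
  have g: "length g = Suc n" using Cons.prems(1) by simp
  have "map2 (*) (pt_list n f) (map (\<lambda>x. x ^ (q ^ l)) g) = pt_list n (\<lambda>i. f i * pt_fun g i ^ (q ^ l))"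
    using g by (intro pt_list_eqI) (simp_all add: nth_default_eq del: upt_Suc)
  then have step: "pmult (hpoint (pt_list n f)) ((frob q ^^ l) (hpoint g))
      = hpoint (pt_list n (\<lambda>i. f i * pt_fun g i ^ (q ^ l)))"
    by (simp only: frob_funpow_hpoint pmult_hpoint)
  have "foldl pmult (hpoint (pt_list n f)) (map2 (\<lambda>l. frob q ^^ l) ls (map hpoint (g # gs)))
    = foldl pmult (hpoint (pt_list n (\<lambda>i. f i * pt_fun g i ^ (q ^ l))))
        (map2 (\<lambda>l. frob q ^^ l) ls' (map hpoint gs))"
    by (simp only: ls(1) list.map zip_Cons_Cons case_prod_conv foldl_Cons step)
  also have "\<dots> = hpoint (pt_list n (\<lambda>i. f i * pt_fun g i ^ (q ^ l) * multi_power q (map pt_fun gs) ls' i))"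
    by (rule Cons.IH) (use Cons.prems(1) ls(2) in simp_all)
  finally show ?case by (simp only: ls(1) list.map multi_power.simps mult.assoc)
qed (simp del: upt_Suc)

lemma frob_product_hpoint:
  assumes "\<forall>g\<in>set gs. length g = Suc n" "length t = Suc n"
  shows "frob_product q (hpoint t) (map hpoint gs)
    = {hpoint (pt_list n (\<lambda>i. pt_fun t i * multi_power q (map pt_fun gs) ls i)) | ls. length ls = length gs}"
proof -
  have "t = pt_list n (pt_fun t)" using assms(2) by (intro pt_list_eqI) (simp_all add: nth_default_eq)
  then have "foldl pmult (hpoint t) (map2 (\<lambda>l. frob q ^^ l) ls (map hpoint gs))
    = hpoint (pt_list n (\<lambda>i. pt_fun t i * multi_power q (map pt_fun gs) ls i))" if "length ls = length gs" for ls
    using foldl_pmult[OF assms(1) that, where q = q and f = "pt_fun t"] by (simp only:)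
  then show ?thesis unfolding frob_product_def by auto
qed

lemma hpoint_mem_scale:
  assumes "xs \<in> hpoint ys" obtains c where "c \<noteq> 0" "xs = map ((*) c) ys"
  using assms unfolding hpoint_def by blast

lemma hpoint_proj_space:
  assumes "\<And>i. i \<le> n \<Longrightarrow> f i \<noteq> 0" shows "hpoint (pt_list n f) \<in> proj_space n"
proof -
  have "f 0 \<in> set (pt_list n f)" by (auto simp del: upt_Suc)
  then show ?thesis unfolding proj_space_def using assms[of 0]
    by (intro CollectI exI[of _ "pt_list n f"]) (auto simp del: upt_Suc)
qed

lemma hpoint_hyperplane_over:
  assumes "\<And>i. i \<le> n \<Longrightarrow> f i \<in> G" "0 \<notin> G" "(\<Sum>i\<le>n. a ! i * f i) = 0"
  shows "hpoint (pt_list n f) \<in> hyperplane_over n a G"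
proof -
  have nz: "f i \<noteq> 0" if "i \<le> n" for i using assms(1)[OF that] assms(2) by auto
  have P: "hpoint (pt_list n f) \<in> proj_space n" using nz by (rule hpoint_proj_space)
  have "(\<Sum>i\<le>n. a ! i * xs ! i) = 0" if xs: "xs \<in> hpoint (pt_list n f)" for xs
  proof -
    obtain c where c: "c \<noteq> 0" "xs = map ((*) c) (pt_list n f)" using xs by (rule hpoint_mem_scale)
    have "(\<Sum>i\<le>n. a ! i * xs ! i) = (\<Sum>i\<le>n. c * (a ! i * f i))"
      by (intro sum.cong refl) (auto simp: c(2) simp del: upt_Suc)
    then show ?thesis using assms(3) by (simp flip: sum_distrib_left)
  qed
  moreover have "hpoint (pt_list n f) \<in> proj_space_over n G"
    unfolding proj_space_over_def using P assms(1)
    by (intro IntI CollectI exI[of _ "pt_list n f"]) (auto simp del: upt_Suc)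
  ultimately show ?thesis using P by (simp add: hyperplane_over_def hyperplane_def)
qed

lemma nondegenerate_overE:
  assumes G: "mult_subgroup G" and P: "P \<in> nondegenerate_over n a G"
  obtains x where "P = hpoint (pt_list n x)" "x 0 = 1" "\<forall>i\<le>n. x i \<in> G" "(\<Sum>i\<le>n. a ! i * x i) = 0"
    "\<forall>I. I \<noteq> {} \<longrightarrow> I \<subset> {..n} \<longrightarrow> (\<Sum>i\<in>I. a ! i * x i) \<noteq> 0"
proof -
  have "P \<in> hyperplane_over n a G" using P by (simp add: nondegenerate_over_def)
  then have "P \<in> proj_space_over n G" and hyp: "\<forall>xs\<in>P. (\<Sum>i\<le>n. a ! i * xs ! i) = 0"
    by (simp_all add: hyperplane_over_def hyperplane_def)
  then obtain ys where ys: "P = hpoint ys" "length ys = Suc n" "set ys \<subseteq> G"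
    by (auto simp: proj_space_over_def)
  have yG: "ys ! i \<in> G" if "i \<le> n" for i using ys(2,3) that by (auto simp: subset_iff)
  have y0: "ys ! 0 \<noteq> 0" using yG[of 0] G by (auto simp: mult_subgroup_def)
  let ?x = "\<lambda>i. inverse (ys ! 0) * ys ! i"
  have eq: "map ((*) (inverse (ys ! 0))) ys = pt_list n ?x"
    using ys(2) by (intro pt_list_eqI) simp_all
  have P_eq: "P = hpoint (pt_list n ?x)"
    unfolding ys(1) eq[symmetric] using hpoint_scale[of "inverse (ys ! 0)" ys] y0 by simp
  have mem: "pt_list n ?x \<in> P" unfolding P_eq by (rule hpoint_refl)
  have nth: "pt_list n ?x ! i = ?x i" if "i \<le> n" for i using that by (simp del: upt_Suc)
  have "(\<Sum>i\<le>n. a ! i * pt_list n ?x ! i) = 0" using hyp mem by blast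
  then have s: "(\<Sum>i\<le>n. a ! i * ?x i) = 0" using nth by simp
  have nd: "(\<Sum>i\<in>I. a ! i * ?x i) \<noteq> 0" if I: "I \<noteq> {}" "I \<subset> {..n}" for I
  proof -
    have "(\<Sum>i\<in>I. a ! i * pt_list n ?x ! i) \<noteq> 0" using P I mem unfolding nondegenerate_over_def by blast
    moreover have "(\<Sum>i\<in>I. a ! i * pt_list n ?x ! i) = (\<Sum>i\<in>I. a ! i * ?x i)"
      using I(2) nth by (intro sum.cong refl) (metis atMost_iff psubsetD)
    ultimately show ?thesis by simp
  qed
  show thesis
    by (rule that[OF P_eq]) (use y0 s nd yG G in \<open>auto simp: mult_subgroup_def\<close>)
qed

lemma orbit_pt_cong:
  assumes "length \<psi>s = length \<phi>s" "\<And>k. k < length \<psi>s \<Longrightarrow> (\<psi>s ! k) i = (\<phi>s ! k) i" "\<tau> i = \<sigma> i"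
  shows "orbit_pt q \<psi>s es \<tau> i = orbit_pt q \<phi>s es \<sigma> i"
  using assms(1,2)
proof (induction \<psi>s \<phi>s arbitrary: es rule: list_induct2)
  case (Cons \<psi> \<psi>s \<phi> \<phi>s)
  have "\<psi> i = \<phi> i" using Cons.prems[of 0] by simp
  moreover have "orbit_pt q \<psi>s es' \<tau> i = orbit_pt q \<phi>s es' \<sigma> i" for es'
    by (rule Cons.IH) (use Cons.prems[of "Suc _"] in simp)
  ultimately show ?case by (cases es) (simp_all add: assms(3))
qed (simp add: assms(3))

subsection \<open>Membership of orbit points in a group\<close>

lemma mult_subgroup_closed:
  assumes "mult_subgroup G"
  shows "1 \<in> G" "x \<in> G \<Longrightarrow> y \<in> G \<Longrightarrow> x * y \<in> G" "x \<in> G \<Longrightarrow> inverse x \<in> G" "0 \<notin> G"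
    "x \<in> G \<Longrightarrow> x ^ k \<in> G"
proof -
  show 1: "1 \<in> G" and m: "\<And>x y. x \<in> G \<Longrightarrow> y \<in> G \<Longrightarrow> x * y \<in> G"
    using assms by (simp_all add: mult_subgroup_def)
  show "x \<in> G \<Longrightarrow> inverse x \<in> G" "0 \<notin> G" using assms by (simp_all add: mult_subgroup_def)
  show "x \<in> G \<Longrightarrow> x ^ k \<in> G" by (induction k) (simp_all add: 1 m)
qed

text \<open>\<open>q - 1\<close> divides \<open>q ^ e - 1\<close>. Hence conjugating Frobenius by a
  multiplier whose \<open>(q - 1)\<close>-st power is in \<open>G\<close> only multiplies by
  elements of \<open>G\<close>.\<close>

lemma power_diff_group:
  fixes x :: "'a::field"
  assumes G: "mult_subgroup G" and x: "x ^ (q - 1) \<in> G" "x \<noteq> 0" and q: "q > 0"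
  shows "inverse x * x ^ (q ^ e) \<in> G"
proof -
  have "int q - 1 dvd int q ^ e - 1" by (metis dvd_triv_left power_diff_1_eq)
  moreover have "int q - 1 = int (q - 1)" "int q ^ e - 1 = int (q ^ e - 1)"
    using q by (simp_all add: of_nat_diff)
  ultimately have "(q - 1) dvd (q ^ e - 1)" by (metis int_dvd_int_iff)
  then obtain k where k: "q ^ e - 1 = (q - 1) * k" by (auto simp: dvd_def)
  have "q ^ e = Suc ((q - 1) * k)" using k q by (metis Suc_pred' zero_less_power)
  then have "inverse x * x ^ (q ^ e) = (x ^ (q - 1)) ^ k" using x(2) by (simp add: power_mult)
  then show ?thesis using mult_subgroup_closed(5)[OF G x(1)] by simp
qed

lemma orbit_pt_group:
  assumes G: "mult_subgroup G" and \<psi>: "\<forall>\<psi>\<in>set \<psi>s. \<psi> i ^ (q - 1) \<in> G \<and> \<psi> i \<noteq> 0" and q: "q > 0"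
    and \<tau>: "\<tau> i \<in> G"
  shows "orbit_pt q \<psi>s es \<tau> i \<in> G"
  using \<psi>
proof (induction \<psi>s arbitrary: es)
  case (Cons \<psi> \<psi>s)
  show ?case
  proof (cases es)
    case (Cons e es')
    have "orbit_pt q (\<psi> # \<psi>s) es \<tau> i = (inverse (\<psi> i) * \<psi> i ^ (q ^ e)) * orbit_pt q \<psi>s es' \<tau> i ^ (q ^ e)"
      by (simp add: Cons power_mult_distrib mult.assoc)
    moreover have "inverse (\<psi> i) * \<psi> i ^ (q ^ e) \<in> G"
      using Cons.prems by (intro power_diff_group[OF G _ _ q]) auto
    moreover have "orbit_pt q \<psi>s es' \<tau> i \<in> G" using Cons.IH Cons.prems by simp
    ultimately show ?thesis using mult_subgroup_closed[OF G] by simp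
  qed (simp add: \<tau>)
qed (simp add: \<tau>)

lemma to_product_group:
  assumes G: "mult_subgroup G" and \<psi>: "\<forall>\<psi>\<in>set \<psi>s. \<psi> i ^ (q - 1) \<in> G \<and> \<psi> i \<noteq> 0" and q: "q > 0"
    and \<tau>: "\<tau> i \<in> G" and "length ls = length \<psi>s"
  shows "fst (to_product \<psi>s \<tau>) i ^ (q - 1) \<in> G \<and> fst (to_product \<psi>s \<tau>) i \<noteq> 0 \<and>
    (\<forall>y\<in>set (snd (to_product \<psi>s \<tau>)). y i \<noteq> 0) \<and>
    fst (to_product \<psi>s \<tau>) i * multi_power q (snd (to_product \<psi>s \<tau>)) ls i \<in> G"
  using \<psi> assms(5)
proof (induction \<psi>s arbitrary: ls)
  case Nil
  then show ?case using \<tau> mult_subgroup_closed[OF G] by auto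
next
  case (Cons \<psi> \<psi>s)
  obtain l ls' where ls: "ls = l # ls'" "length ls' = length \<psi>s" using Cons.prems(2) by (cases ls) auto
  let ?x = "fst (to_product \<psi>s \<tau>) i" let ?m = "multi_power q (snd (to_product \<psi>s \<tau>)) ls' i"
  have IH: "?x ^ (q - 1) \<in> G" "?x \<noteq> 0" "\<forall>y\<in>set (snd (to_product \<psi>s \<tau>)). y i \<noteq> 0" "?x * ?m \<in> G"
    using Cons.IH[of ls'] Cons.prems(1) ls(2) by auto
  have \<psi>i: "\<psi> i ^ (q - 1) \<in> G" "\<psi> i \<noteq> 0" using Cons.prems(1) by auto
  \<comment> \<open>The single factors need not be in \<open>G\<close>. Regrouping collects the
    exponents \<open>q ^ l - 1\<close>, which lead into \<open>G\<close>, around the product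
    supplied by the induction hypothesis.\<close>
  have e: "inverse (\<psi> i) * ((\<psi> i * ?x) ^ (q ^ l) * ?m)
      = (inverse (\<psi> i) * \<psi> i ^ (q ^ l)) * ((inverse ?x * ?x ^ (q ^ l)) * (?x * ?m))"
    using IH(2) by (simp add: power_mult_distrib field_simps)
  have "inverse (\<psi> i) * ((\<psi> i * ?x) ^ (q ^ l) * ?m) \<in> G"
    unfolding e by (intro mult_subgroup_closed(2)[OF G] power_diff_group[OF G \<psi>i q]
        power_diff_group[OF G IH(1,2) q] IH(4))
  moreover have "inverse (\<psi> i) ^ (q - 1) \<in> G"
    using mult_subgroup_closed(3)[OF G \<psi>i(1)] by (simp add: power_inverse)
  ultimately show ?case using \<psi>i(2) IH by (simp add: ls(1))
qed

subsection \<open>Finitely generated groups as monomials\<close>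

lemma prod_lessThan_add:
  fixes f :: "nat \<Rightarrow> 'a::comm_monoid_mult"
  shows "(\<Prod>i<m + n. f i) = (\<Prod>i<m. f i) * (\<Prod>i<n. f (m + i))"
  by (induction n) (simp_all add: mult.assoc)

lemma mon_append:
  assumes "length d = length gs"
  shows "mon (gs @ map inverse gs) (d @ e) = mon gs d * inverse (mon gs e :: 'a::field)"
proof -
  let ?r = "length gs"
  have "mon (gs @ map inverse gs) (d @ e)
    = (\<Prod>i<?r + ?r. (gs @ map inverse gs) ! i ^ nth_default 0 (d @ e) i)" by (simp add: mon_def)
  also have "\<dots> = (\<Prod>i<?r. (gs @ map inverse gs) ! i ^ nth_default 0 (d @ e) i)
     * (\<Prod>i<?r. (gs @ map inverse gs) ! (?r + i) ^ nth_default 0 (d @ e) (?r + i))"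
    by (rule prod_lessThan_add)
  also have "(\<Prod>i<?r. (gs @ map inverse gs) ! i ^ nth_default 0 (d @ e) i) = mon gs d"
    using assms by (simp add: mon_def nth_append nth_default_def)
  also have "(\<Prod>i<?r. (gs @ map inverse gs) ! (?r + i) ^ nth_default 0 (d @ e) (?r + i)) = inverse (mon gs e)"
    using assms by (simp add: mon_def nth_append nth_default_def power_inverse prod_inversef[unfolded o_def] flip: assms cong: if_cong)
  finally show ?thesis .
qed

lemma mon_group:
  assumes G: "mult_subgroup G" and "set gs \<subseteq> G" shows "mon gs d \<in> G"
proof -
  have "(\<Prod>i\<in>A. gs ! i ^ nth_default 0 d i) \<in> G" if "finite A" "A \<subseteq> {..<length gs}" for A
    using that
  proof (induction A)
    case (insert i A)
    then have "gs ! i \<in> G" using assms(2) by auto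
    then show ?case using insert mult_subgroup_closed[OF G] by simp
  qed (simp add: mult_subgroup_closed[OF G])
  then show ?thesis by (simp add: mon_def)
qed

text \<open>Quotients of two monomials form a group containing the generators. Adjoining the
  inverses as further generators turns such quotients into monomials.\<close>

lemma mon_hull:
  fixes gs :: "'a::field list"
  assumes G: "mult_subgroup G" and hull: "G = mult_subgroup hull (set gs)"
  shows "0 \<notin> set gs" "G = range (mon (gs @ map inverse gs))"
proof -
  have sub: "set gs \<subseteq> G" unfolding hull by (rule hull_subset)
  then show nz: "0 \<notin> set gs" using mult_subgroup_closed(4)[OF G] by blast
  let ?n = "length gs"
  define T where "T = {mon gs d * inverse (mon gs e) | d e. True}"
  have mnz: "mon gs d \<noteq> 0" for d using nz by (auto simp: mon_def in_set_conv_nth)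
  have "mult_subgroup T"
    unfolding mult_subgroup_def
  proof (intro conjI ballI)
    show "0 \<notin> T" using mnz by (auto simp: T_def)
    have "1 = mon gs [] * inverse (mon gs [])" by simp
    then show "1 \<in> T" unfolding T_def by blast
    fix x assume "x \<in> T"
    then obtain d e where x: "x = mon gs d * inverse (mon gs e)" by (auto simp: T_def)
    have "inverse x = mon gs e * inverse (mon gs d)" by (simp add: x)
    then show "inverse x \<in> T" unfolding T_def by blast
    fix y assume "y \<in> T"
    then obtain d' e' where y: "y = mon gs d' * inverse (mon gs e')" by (auto simp: T_def)
    have "x * y = mon gs (vadd ?n d d') * inverse (mon gs (vadd ?n e e'))" by (simp add: x y mon_vadd)
    then show "x * y \<in> T" unfolding T_def by blast
  qed
  moreover have "set gs \<subseteq> T"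
  proof
    fix x assume "x \<in> set gs"
    then obtain i where i: "i < ?n" "x = gs ! i" by (auto simp: in_set_conv_nth)
    have "(\<Prod>j<?n. gs ! j ^ nth_default 0 (map (\<lambda>j. if j = i then 1 else 0) [0..<?n]) j)
      = (\<Prod>j<?n. if j = i then gs ! j else 1)"
      by (intro prod.cong) (auto simp: nth_default_map_upt)
    then have "x = mon gs (map (\<lambda>j. if j = i then 1 else 0) [0..<?n]) * inverse (mon gs [])"
      using i by (simp add: mon_def prod.delta)
    then show "x \<in> T" unfolding T_def by blast
  qed
  ultimately have "G \<subseteq> T" unfolding hull by (intro hull_minimal)
  also have "T \<subseteq> range (mon (gs @ map inverse gs))"
  proof
    fix x assume "x \<in> T"
    then obtain d e where x: "x = mon gs d * inverse (mon gs e)" by (auto simp: T_def)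
    \<comment> \<open>\<open>d\<close> is brought to length \<open>?n\<close> so that the exponents
      \<open>e\<close> of the inverses begin at the right position.\<close>
    let ?d = "map (nth_default 0 d) [0..<?n]"
    have "mon gs ?d = mon gs d" by (simp add: mon_def nth_default_map_upt)
    then have "x = mon (gs @ map inverse gs) (?d @ e)" by (simp add: mon_append x)
    then show "x \<in> range (mon (gs @ map inverse gs))" by blast
  qed
  finally have "G \<subseteq> range (mon (gs @ map inverse gs))" .
  moreover have "mon (gs @ map inverse gs) d \<in> G" for d
    by (rule mon_group[OF G]) (use sub mult_subgroup_closed(3)[OF G] in auto)
  ultimately show "G = range (mon (gs @ map inverse gs))" by blast
qed

subsection \<open>The algorithm\<close>

definition fprod :: "fexpr list \<Rightarrow> fexpr" where
  "fprod l = foldr Mul l One"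

text \<open>The empty sum is expressed as \<open>1 - 1\<close>, because expressions have no constant
  for zero.\<close>

definition fsum :: "fexpr list \<Rightarrow> fexpr" where
  "fsum l = foldr Add l (Add One (Neg One))"

definition fpow :: "fexpr \<Rightarrow> nat \<Rightarrow> fexpr" where
  "fpow s k = fprod (replicate k s)"

definition fmon :: "fexpr list \<Rightarrow> nat list \<Rightarrow> fexpr" where
  "fmon gs d = fprod (map (\<lambda>i. fpow (nth_default One gs i) (nth_default 0 d i)) [0..<length gs])"

lemma prod_list_upt: "prod_list (map f [0..<n]) = (\<Prod>i<n. f i :: 'a::comm_monoid_mult)"
  by (induction n) auto

lemma sum_list_upt: "sum_list (map f [0..<n]) = (\<Sum>i<n. f i :: 'a::comm_monoid_add)"
  by (induction n) auto

lemma fval_fprod [simp]: "fval ys (fprod l) = prod_list (map (fval ys) l)"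
  by (induction l) (simp_all add: fprod_def)

lemma fval_fsum [simp]: "fval ys (fsum l) = sum_list (map (fval ys) l)"
  by (induction l) (simp_all add: fsum_def)

lemma fval_fpow [simp]: "fval ys (fpow s k) = fval ys s ^ k"
  by (induction k) (simp_all add: fpow_def)

lemma fval_nth_default: "fval ys (nth_default One l i) = pt_fun (vec_val ys l) i"
  by (simp add: nth_default_def)

lemma fval_fmon [simp]: "fval ys (fmon gs d) = mon (vec_val ys gs) d"
  by (simp add: fmon_def o_def prod_list_upt mon_def fval_nth_default nth_default_eq)

text \<open>Built from \<open>rec_nat\<close> and list operations, so that computability is a matter
  of the rules in \<open>comp_intro\<close>; the same holds for the definitions below.\<close>

definition elim_list :: "nat \<Rightarrow> fexpr list \<Rightarrow> fexpr list" where
  "elim_list k W = rec_nat W (\<lambda>_ r. r @ concat (map (\<lambda>x. concat (map (\<lambda>y. concat (map (\<lambda>z.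
     map (\<lambda>w. Add (Mul x y) (Neg (Mul z w))) r) r)) r)) r)) k"

definition quot_list :: "nat \<Rightarrow> fexpr list \<Rightarrow> fexpr list" where
  "quot_list m W = rec_nat [One] (\<lambda>_ r. r @ concat (map (\<lambda>u. concat (map (\<lambda>x.
     map (\<lambda>y. Mul u (Mul x (Inv y))) W) W)) r)) m"

lemma fval_elim_list: "fval ys ` set (elim_list k W) = elim_closure k (fval ys ` set W)"
proof (induction k)
  case 0
  show ?case by (simp add: elim_list_def)
next
  case (Suc k)
  let ?r = "elim_list k W"
  have "elim_list (Suc k) W = ?r @ concat (map (\<lambda>x. concat (map (\<lambda>y. concat (map (\<lambda>z.
     map (\<lambda>w. Add (Mul x y) (Neg (Mul z w))) ?r) ?r)) ?r)) ?r)"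
    by (simp add: elim_list_def)
  then have r: "set (elim_list (Suc k) W) = set ?r \<union> {Add (Mul x y) (Neg (Mul z w)) | x y z w.
      x \<in> set ?r \<and> y \<in> set ?r \<and> z \<in> set ?r \<and> w \<in> set ?r}"
    by auto
  have "fval ys ` {Add (Mul x y) (Neg (Mul z w)) | x y z w.
      x \<in> set ?r \<and> y \<in> set ?r \<and> z \<in> set ?r \<and> w \<in> set ?r} =
      {x * y - z * w | x y z w. x \<in> fval ys ` set ?r \<and> y \<in> fval ys ` set ?r \<and>
        z \<in> fval ys ` set ?r \<and> w \<in> fval ys ` set ?r}" (is "?A = ?B")
  proof (intro subset_antisym subsetI)
    fix v assume "v \<in> ?A"
    then obtain a b c d where v: "v = fval ys a * fval ys b - fval ys c * fval ys d"
      and m: "a \<in> set ?r" "b \<in> set ?r" "c \<in> set ?r" "d \<in> set ?r" by auto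
    show "v \<in> ?B" unfolding mem_Collect_eq
      by (rule exI[of _ "fval ys a"], rule exI[of _ "fval ys b"], rule exI[of _ "fval ys c"],
          rule exI[of _ "fval ys d"]) (intro conjI v imageI m)
  next
    fix v assume "v \<in> ?B"
    then obtain a b c d where v: "v = fval ys a * fval ys b - fval ys c * fval ys d"
      and m: "a \<in> set ?r" "b \<in> set ?r" "c \<in> set ?r" "d \<in> set ?r" by auto
    have "v = fval ys (Add (Mul a b) (Neg (Mul c d)))" by (simp add: v)
    then show "v \<in> ?A" by (rule image_eqI) (use m in blast)
  qed
  then have "fval ys ` set (elim_list (Suc k) W) = fval ys ` set ?r \<union>
      {x * y - z * w | x y z w. x \<in> fval ys ` set ?r \<and> y \<in> fval ys ` set ?r \<and>
        z \<in> fval ys ` set ?r \<and> w \<in> fval ys ` set ?r}"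
    unfolding r image_Un by (simp only:)
  then show ?case by (simp only: Suc elim_closure.simps)
qed

lemma fval_quot_list: "fval ys ` set (quot_list m W) = quot_products m (fval ys ` set W)"
proof (induction m)
  case 0
  show ?case by (simp add: quot_list_def)
next
  case (Suc m)
  let ?r = "quot_list m W"
  have "quot_list (Suc m) W = ?r @ concat (map (\<lambda>u. concat (map (\<lambda>x.
     map (\<lambda>y. Mul u (Mul x (Inv y))) W) W)) ?r)"
    by (simp add: quot_list_def)
  then have r: "set (quot_list (Suc m) W) = set ?r \<union> {Mul u (Mul x (Inv y)) | u x y.
      u \<in> set ?r \<and> x \<in> set W \<and> y \<in> set W}"
    by auto
  have "fval ys ` {Mul u (Mul x (Inv y)) | u x y. u \<in> set ?r \<and> x \<in> set W \<and> y \<in> set W} =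
      {u * (x / y) | u x y. u \<in> fval ys ` set ?r \<and> x \<in> fval ys ` set W \<and> y \<in> fval ys ` set W}" (is "?A = ?B")
  proof (intro subset_antisym subsetI)
    fix v assume "v \<in> ?A"
    then obtain a b c where v: "v = fval ys a * (fval ys b / fval ys c)"
      and m: "a \<in> set ?r" "b \<in> set W" "c \<in> set W" by (auto simp: divide_inverse)
    show "v \<in> ?B" unfolding mem_Collect_eq
      by (rule exI[of _ "fval ys a"], rule exI[of _ "fval ys b"], rule exI[of _ "fval ys c"])
        (intro conjI v imageI m)
  next
    fix v assume "v \<in> ?B"
    then obtain a b c where v: "v = fval ys a * (fval ys b / fval ys c)"
      and m: "a \<in> set ?r" "b \<in> set W" "c \<in> set W" by auto
    have "v = fval ys (Mul a (Mul b (Inv c)))" by (simp add: v divide_inverse)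
    then show "v \<in> ?A" by (rule image_eqI) (use m in blast)
  qed
  then have "fval ys ` set (quot_list (Suc m) W) = fval ys ` set ?r \<union>
      {u * (x / y) | u x y. u \<in> fval ys ` set ?r \<and> x \<in> fval ys ` set W \<and> y \<in> fval ys ` set W}"
    unfolding r image_Un by (simp only:)
  then show ?case by (simp only: Suc quot_products.simps)
qed

definition alg_N :: "nat \<Rightarrow> fexpr list \<Rightarrow> nat" where
  "alg_N n W = 2 ^ (length W ^ Suc n)"

definition alg_K :: "nat \<Rightarrow> fexpr list \<Rightarrow> nat" where
  "alg_K n W = fact (alg_N n W)"

definition alg_L :: "nat \<Rightarrow> fexpr list \<Rightarrow> nat" where
  "alg_L n W = alg_N n W * alg_K n W + alg_N n W + 1"

definition alg_pre :: "nat \<Rightarrow> nat \<Rightarrow> fexpr list \<Rightarrow> nat \<Rightarrow> nat" where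
  "alg_pre p n W b = p ^ alg_L n W * (b + 1) + alg_L n W"

definition alg_bound :: "nat \<Rightarrow> nat \<Rightarrow> fexpr list \<Rightarrow> nat" where
  "alg_bound p n W = rec_nat (p ^ alg_L n W) (\<lambda>_ r. alg_pre p n W (alg_pre p n W r)) n"

text \<open>\<open>Z\<close> is the zero test for expressions. As a parameter it allows the
  algorithm to be defined and shown computable without reference to a field.\<close>

definition alg_roots :: "(fexpr \<Rightarrow> bool) \<Rightarrow> nat \<Rightarrow> nat \<Rightarrow> fexpr list \<Rightarrow> fexpr list \<Rightarrow> fexpr list" where
  "alg_roots Z p n W gs = filter (\<lambda>u. list_ex (\<lambda>d. Z (Add (fpow u (p ^ alg_K n W - 1)) (Neg (fmon gs d))))
     (List.n_lists (length gs) [0..<Suc (p ^ alg_N n W * p ^ alg_K n W)])) (quot_list n (elim_list (Suc n) W))"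

definition alg_twists :: "(fexpr \<Rightarrow> bool) \<Rightarrow> nat \<Rightarrow> nat \<Rightarrow> fexpr list \<Rightarrow> fexpr list \<Rightarrow> fexpr list" where
  "alg_twists Z p n W gs = concat (map (\<lambda>u. concat (map (\<lambda>s. map (\<lambda>d. Mul (fpow u (p ^ s)) (Inv (fmon gs d)))
     (List.n_lists (length gs) [0..<Suc (alg_bound p n W)])) [0..<Suc (alg_bound p n W)])) (alg_roots Z p n W gs))"

definition alg_points :: "nat \<Rightarrow> nat \<Rightarrow> fexpr list \<Rightarrow> fexpr list \<Rightarrow> fexpr list" where
  "alg_points p n W gs = map (fmon gs) (List.n_lists (length gs) [0..<Suc (alg_bound p n W)])"

definition alg_orbit :: "nat \<Rightarrow> nat \<Rightarrow> fexpr list list \<Rightarrow> nat list \<Rightarrow> fexpr list \<Rightarrow> fexpr list" where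
  "alg_orbit n q \<psi>s es \<tau> = foldr (\<lambda>j t. map (\<lambda>i. Mul (Inv (nth_default One (nth_default [] \<psi>s j) i))
     (fpow (Mul (nth_default One (nth_default [] \<psi>s j) i) (nth_default One t i)) (q ^ nth_default 0 es j)))
     [0..<Suc n]) [0..<length \<psi>s] \<tau>"

definition alg_check :: "(fexpr \<Rightarrow> bool) \<Rightarrow> nat \<Rightarrow> nat \<Rightarrow> fexpr list \<Rightarrow> fexpr list list \<times> fexpr list \<Rightarrow> bool" where
  "alg_check Z n q as c = list_all (\<lambda>es. Z (fsum (map (\<lambda>i. Mul (nth_default One as i)
     (nth_default One (alg_orbit n q (fst c) es (snd c)) i)) [0..<Suc n])))
     (List.n_lists (length (fst c)) [0..<Suc n])"

definition alg_cands :: "nat \<Rightarrow> fexpr list \<Rightarrow> fexpr list \<Rightarrow> (fexpr list list \<times> fexpr list) list" where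
  "alg_cands n tw pts = concat (map (\<lambda>h. concat (map (\<lambda>\<psi>s. map (\<lambda>\<tau>. (\<psi>s, \<tau>)) (List.n_lists (Suc n) pts))
     (List.n_lists h (List.n_lists (Suc n) tw)))) [0..<n])"

definition alg_product :: "nat \<Rightarrow> fexpr list list \<times> fexpr list \<Rightarrow> fexpr list \<times> fexpr list list" where
  "alg_product n c = foldr (\<lambda>\<psi> r. (map (\<lambda>i. Inv (nth_default One \<psi> i)) [0..<Suc n],
     map (\<lambda>i. Mul (nth_default One \<psi> i) (nth_default One (fst r) i)) [0..<Suc n] # snd r)) (fst c) (snd c, [])"

text \<open>The condition of the unbounded search. For a given \<open>W\<close> it is a finite
  verification, and \<open>bs\<close> lists expressions for a basis that is fixed in
  advance.\<close>

definition alg_closed :: "(fexpr \<Rightarrow> bool) \<Rightarrow> nat \<Rightarrow> fexpr list \<Rightarrow> fexpr list \<Rightarrow> fexpr list \<Rightarrow> bool" where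
  "alg_closed Z p bs W gs = list_all (\<lambda>w. list_all (\<lambda>d. list_ex (\<lambda>us.
     Z (Add (Mul w (fmon gs d)) (Neg (fsum (map (\<lambda>j. Mul (fpow (nth_default One us j) p) (nth_default One bs j))
       [0..<length bs]))))) (List.n_lists (length bs) W)) (List.n_lists (length gs) [0..<p])) W"

definition alg_U :: "(fexpr \<Rightarrow> bool) \<Rightarrow> nat \<Rightarrow> nat \<Rightarrow> fexpr list \<Rightarrow> fexpr list \<Rightarrow> fexpr list \<Rightarrow>
    (fexpr list list \<times> fexpr list) list" where
  "alg_U Z p n as W gs = filter (alg_check Z n (p ^ alg_K n W) as)
     (alg_cands n (alg_twists Z p n W gs) (alg_points p n W gs))"

definition alg_V :: "(fexpr \<Rightarrow> bool) \<Rightarrow> nat \<Rightarrow> nat \<Rightarrow> fexpr list \<Rightarrow> fexpr list \<Rightarrow> fexpr list \<Rightarrow>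
    (fexpr list \<times> fexpr list list) list" where
  "alg_V Z p n as W gs = map (alg_product n) (alg_U Z p n as W gs)"

section \<open>Computability of the algorithm\<close>

lemma computable_fprod [comp_intro]: "computable l \<Longrightarrow> computable (\<lambda>x. fprod (l x))"
  unfolding fprod_def by (intro comp_intro)

lemma computable_fsum [comp_intro]: "computable l \<Longrightarrow> computable (\<lambda>x. fsum (l x))"
  unfolding fsum_def by (intro comp_intro)

lemma computable_fpow [comp_intro]:
  "computable s \<Longrightarrow> computable k \<Longrightarrow> computable (\<lambda>x. fpow (s x) (k x))"
  unfolding fpow_def by (intro comp_intro)

lemma computable_fmon [comp_intro]:
  assumes "computable gs" "computable d" shows "computable (\<lambda>x. fmon (gs x) (d x))"
  unfolding fmon_def by (intro comp_intro assms assms[THEN computable_comp])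

lemma computable_elim_list [comp_intro]:
  assumes "computable k" "computable W" shows "computable (\<lambda>x. elim_list (k x) (W x))"
  unfolding elim_list_def by (intro comp_intro assms assms[THEN computable_comp])

lemma computable_quot_list [comp_intro]:
  assumes "computable k" "computable W" shows "computable (\<lambda>x. quot_list (k x) (W x))"
  unfolding quot_list_def by (intro comp_intro assms assms[THEN computable_comp])

lemma computable_alg_N [comp_intro]:
  "computable n \<Longrightarrow> computable W \<Longrightarrow> computable (\<lambda>x. alg_N (n x) (W x))"
  unfolding alg_N_def by (intro comp_intro)

lemma computable_alg_K [comp_intro]:
  "computable n \<Longrightarrow> computable W \<Longrightarrow> computable (\<lambda>x. alg_K (n x) (W x))"
  unfolding alg_K_def by (intro comp_intro)

lemma computable_alg_L [comp_intro]:
  "computable n \<Longrightarrow> computable W \<Longrightarrow> computable (\<lambda>x. alg_L (n x) (W x))"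
  unfolding alg_L_def by (intro comp_intro)

lemma computable_alg_bound [comp_intro]:
  assumes "computable n" "computable W" shows "computable (\<lambda>x. alg_bound p (n x) (W x))"
  unfolding alg_bound_def alg_pre_def by (intro comp_intro assms assms[THEN computable_comp])

lemma computable_alg_roots [comp_intro]:
  assumes Z: "computable Z" and "computable n" "computable W" "computable gs"
  shows "computable (\<lambda>x. alg_roots Z p (n x) (W x) (gs x))"
  unfolding alg_roots_def by (intro comp_intro assms assms[THEN computable_comp])

lemma computable_alg_twists [comp_intro]:
  assumes Z: "computable Z" and "computable n" "computable W" "computable gs"
  shows "computable (\<lambda>x. alg_twists Z p (n x) (W x) (gs x))"
  unfolding alg_twists_def by (intro comp_intro assms assms[THEN computable_comp])

lemma computable_alg_points [comp_intro]:
  assumes "computable n" "computable W" "computable gs"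
  shows "computable (\<lambda>x. alg_points p (n x) (W x) (gs x))"
  unfolding alg_points_def by (intro comp_intro assms assms[THEN computable_comp])

lemma computable_alg_orbit [comp_intro]:
  assumes "computable n" "computable q" "computable \<psi>s" "computable es" "computable \<tau>"
  shows "computable (\<lambda>x. alg_orbit (n x) (q x) (\<psi>s x) (es x) (\<tau> x))"
  unfolding alg_orbit_def by (intro comp_intro assms assms[THEN computable_comp])

lemma computable_alg_check [comp_intro]:
  assumes Z: "computable Z" and "computable n" "computable q" "computable as" "computable c"
  shows "computable (\<lambda>x. alg_check Z (n x) (q x) (as x) (c x))"
  unfolding alg_check_def by (intro comp_intro assms assms[THEN computable_comp])

lemma computable_alg_cands [comp_intro]:
  assumes "computable n" "computable tw" "computable pts"
  shows "computable (\<lambda>x. alg_cands (n x) (tw x) (pts x))"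
  unfolding alg_cands_def by (intro comp_intro assms assms[THEN computable_comp])

lemma computable_alg_product [comp_intro]:
  assumes "computable n" "computable c" shows "computable (\<lambda>x. alg_product (n x) (c x))"
  unfolding alg_product_def by (intro comp_intro assms assms[THEN computable_comp])

lemma computable_alg_closed [comp_intro]:
  assumes Z: "computable Z" and "computable W" "computable gs"
  shows "computable (\<lambda>x. alg_closed Z p bs (W x) (gs x))"
  unfolding alg_closed_def by (intro comp_intro assms assms[THEN computable_comp])

lemma computable_alg_U [comp_intro]:
  assumes Z: "computable Z" and "computable n" "computable as" "computable W" "computable gs"
  shows "computable (\<lambda>x. alg_U Z p (n x) (as x) (W x) (gs x))"
  unfolding alg_U_def by (intro comp_intro assms assms[THEN computable_comp])

lemma computable_alg_V [comp_intro]: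
  assumes Z: "computable Z" and "computable n" "computable as" "computable W" "computable gs"
  shows "computable (\<lambda>x. alg_V Z p (n x) (as x) (W x) (gs x))"
  unfolding alg_V_def by (intro comp_intro assms assms[THEN computable_comp])

lemma output_code_enc: "output_code k U V = list_encode [k, enc U, enc V]"
proof -
  have ef: "(enc :: fexpr \<Rightarrow> nat) = fcode" by (simp add: fun_eq_iff enc_fexpr_def)
  have v: "vec_code = enc" by (simp add: fun_eq_iff list_code_def enc_list_def ef)
  have vv: "list_code (enc :: fexpr list \<Rightarrow> nat) = enc" by (auto simp: fun_eq_iff list_code_def enc_list_def)
  have "pair_code (enc :: fexpr list list \<Rightarrow> nat) (enc :: fexpr list \<Rightarrow> nat) = enc"
    "pair_code (enc :: fexpr list \<Rightarrow> nat) (enc :: fexpr list list \<Rightarrow> nat) = enc"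
    by (auto simp: fun_eq_iff pair_code_def enc_prod_def)
  then show ?thesis unfolding output_code_def v vv by (simp add: list_code_def enc_list_def)
qed

subsection \<open>Values of the algorithm\<close>

lemma vec_val_orbit:
  assumes "length es = length \<psi>s" "\<forall>\<psi>\<in>set \<psi>s. length \<psi> = Suc n" "length \<tau> = Suc n" "i \<le> n"
  shows "pt_fun (vec_val ys (alg_orbit n q \<psi>s es \<tau>)) i
    = orbit_pt q (map (\<lambda>\<psi>. pt_fun (vec_val ys \<psi>)) \<psi>s) es (pt_fun (vec_val ys \<tau>)) i"
  using assms(1,2)
proof (induction \<psi>s arbitrary: es)
  case Nil
  then show ?case by (simp add: alg_orbit_def)
next
  case (Cons \<psi> \<psi>s)
  then obtain e es' where es: "es = e # es'" "length es' = length \<psi>s" by (cases es) auto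
  have [simp]: "nth_default d (x # xs) (Suc j) = nth_default d xs j" "nth_default d (x # xs) 0 = x"
    for d x j and xs :: "'z list" by (simp_all add: nth_default_def)
  have upt: "[0..<Suc (length \<psi>s)] = 0 # map Suc [0..<length \<psi>s]"
    by (simp add: upt_conv_Cons map_Suc_upt del: upt_Suc)
  have "alg_orbit n q (\<psi> # \<psi>s) es \<tau> = map (\<lambda>i. Mul (Inv (nth_default One \<psi> i))
     (fpow (Mul (nth_default One \<psi> i) (nth_default One (alg_orbit n q \<psi>s es' \<tau>) i)) (q ^ e))) [0..<Suc n]"
    unfolding alg_orbit_def es(1) list.size(4) add_0_right add_Suc_right One_nat_def upt foldr.simps o_apply foldr_map
    by (simp add: o_def del: upt_Suc)
  then have "pt_fun (vec_val ys (alg_orbit n q (\<psi> # \<psi>s) es \<tau>)) i =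
     inverse (pt_fun (vec_val ys \<psi>) i) * (pt_fun (vec_val ys \<psi>) i * pt_fun (vec_val ys (alg_orbit n q \<psi>s es' \<tau>)) i) ^ (q ^ e)"
    using assms(4) by (simp add: nth_default_map_upt o_def fval_nth_default del: upt_Suc)
  also have "pt_fun (vec_val ys (alg_orbit n q \<psi>s es' \<tau>)) i
    = orbit_pt q (map (\<lambda>\<psi>. pt_fun (vec_val ys \<psi>)) \<psi>s) es' (pt_fun (vec_val ys \<tau>)) i"
    by (rule Cons.IH) (use Cons.prems es(2) in simp_all)
  finally show ?case by (simp add: es(1))
qed

lemma vec_val_product:
  assumes "length \<tau> = Suc n" "i \<le> n"
  shows "pt_fun (vec_val ys (fst (alg_product n (\<psi>s, \<tau>)))) i
      = fst (to_product (map (\<lambda>\<psi>. pt_fun (vec_val ys \<psi>)) \<psi>s) (pt_fun (vec_val ys \<tau>))) i \<and>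
    length (snd (alg_product n (\<psi>s, \<tau>))) = length \<psi>s \<and>
    length (fst (alg_product n (\<psi>s, \<tau>))) = Suc n \<and>
    (\<forall>y\<in>set (snd (alg_product n (\<psi>s, \<tau>))). length y = Suc n) \<and>
    (\<forall>k<length \<psi>s. pt_fun (vec_val ys (snd (alg_product n (\<psi>s, \<tau>)) ! k)) i
      = (snd (to_product (map (\<lambda>\<psi>. pt_fun (vec_val ys \<psi>)) \<psi>s) (pt_fun (vec_val ys \<tau>))) ! k) i)"
proof (induction \<psi>s)
  case Nil
  show ?case using assms by (simp add: alg_product_def)
next
  case (Cons \<psi> \<psi>s)
  have "alg_product n (\<psi> # \<psi>s, \<tau>) = (map (\<lambda>i. Inv (nth_default One \<psi> i)) [0..<Suc n],
     map (\<lambda>i. Mul (nth_default One \<psi> i) (nth_default One (fst (alg_product n (\<psi>s, \<tau>))) i)) [0..<Suc n]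
       # snd (alg_product n (\<psi>s, \<tau>)))"
    by (simp add: alg_product_def del: upt_Suc)
  then show ?case using Cons assms(2)
    by (auto simp add: nth_default_map_upt o_def fval_nth_default nth_Cons simp del: upt_Suc split: nat.split)
qed

lemma multi_power_cong:
  assumes "length xs = length zs" "\<And>k. k < length xs \<Longrightarrow> (xs ! k) i = (zs ! k) i"
  shows "multi_power q xs ls i = multi_power q zs ls i"
  using assms
proof (induction xs zs arbitrary: ls rule: list_induct2)
  case (Cons x xs z zs)
  have "x i = z i" using Cons.prems[of 0] by simp
  moreover have "multi_power q xs ls' i = multi_power q zs ls' i" for ls'
    by (rule Cons.IH) (use Cons.prems[of "Suc _"] in simp)
  ultimately show ?case by (cases ls) simp_all
qed simp

subsection \<open>Correctness\<close>

lemma vec_val_choose: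
  assumes "\<And>i. i \<le> n \<Longrightarrow> \<exists>s\<in>S. fval ys s = f i"
  shows "\<exists>l. length l = Suc n \<and> set l \<subseteq> S \<and> (\<forall>i\<le>n. pt_fun (vec_val ys l) i = f i)"
proof -
  have "\<forall>i. \<exists>s. i \<le> n \<longrightarrow> s \<in> S \<and> fval ys s = f i" using assms by auto
  then have "\<exists>g. \<forall>i. i \<le> n \<longrightarrow> g i \<in> S \<and> fval ys (g i) = f i" by (rule choice)
  then obtain g where g: "\<forall>i. i \<le> n \<longrightarrow> g i \<in> S \<and> fval ys (g i) = f i" ..
  show ?thesis
  proof (intro exI conjI)
    show "length (map g [0..<Suc n]) = Suc n" by simp
    show "set (map g [0..<Suc n]) \<subseteq> S" using g by (auto simp del: upt_Suc)
    show "\<forall>i\<le>n. pt_fun (vec_val ys (map g [0..<Suc n])) i = f i"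
      using g by (simp add: o_def nth_default_map_upt del: upt_Suc)
  qed
qed

lemma pt_fun_nth_vec_val: "i < length l \<Longrightarrow> pt_fun (vec_val ys l) i = fval ys (l ! i)"
  by (simp add: nth_default_def)

lemma pt_fun_vec_val_image:
  "i < length l \<Longrightarrow> set l \<subseteq> S \<Longrightarrow> pt_fun (vec_val ys l) i \<in> fval ys ` S"
  by (metis imageI nth_mem pt_fun_nth_vec_val subsetD)

lemma pt_fun_gen_field: "pt_fun (vec_val ys l) i \<in> gen_field ys"
  by (simp add: nth_default_def gen_field_one)

context char_p_basis
begin

lemma alg_closed_iff:
  assumes Z: "\<And>s. Z s \<longleftrightarrow> fval ys s = 0" and be: "vec_val ys be = bs"
  shows "alg_closed Z p be W gs \<longleftrightarrow> (\<forall>w\<in>fval ys ` set W. \<forall>d. length d = length gs \<longrightarrow> set d \<subseteq> {..<p} \<longrightarrow>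
    (\<exists>u. (\<forall>j<length bs. u j \<in> fval ys ` set W) \<and> w * mon (vec_val ys gs) d = (\<Sum>j<length bs. u j ^ p * bs ! j)))"
proof -
  have len: "length be = length bs" using be by (metis length_map)
  have bj: "fval ys (nth_default One be j) = bs ! j" if "j < length bs" for j
    using that be len by (metis nth_default_eq nth_map)
  have inner: "(\<exists>us\<in>set (List.n_lists (length be) W). Z (Add (Mul w (fmon gs d))
      (Neg (fsum (map (\<lambda>j. Mul (fpow (nth_default One us j) p) (nth_default One be j)) [0..<length be])))))
    \<longleftrightarrow> (\<exists>u. (\<forall>j<length bs. u j \<in> fval ys ` set W) \<and>
      fval ys w * mon (vec_val ys gs) d = (\<Sum>j<length bs. u j ^ p * bs ! j))" (is "?L \<longleftrightarrow> ?R") for w d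
  proof -
    have zi: "Z (Add (Mul w (fmon gs d))
        (Neg (fsum (map (\<lambda>j. Mul (fpow (nth_default One us j) p) (nth_default One be j)) [0..<length be]))))
      \<longleftrightarrow> fval ys w * mon (vec_val ys gs) d = (\<Sum>j<length bs. pt_fun (vec_val ys us) j ^ p * bs ! j)" for us
    proof -
      have "sum_list (map (\<lambda>j. fval ys (nth_default One us j) ^ p * fval ys (nth_default One be j)) [0..<length bs])
        = (\<Sum>j<length bs. pt_fun (vec_val ys us) j ^ p * bs ! j)"
        unfolding sum_list_upt by (intro sum.cong refl) (simp add: bj fval_nth_default[symmetric])
      then show ?thesis by (simp add: Z o_def len)
    qed
    show ?thesis
    proof
      assume ?L
      then obtain us where m: "us \<in> set (List.n_lists (length be) W)"
        and z: "Z (Add (Mul w (fmon gs d)) (Neg (fsum (map (\<lambda>j. Mul (fpow (nth_default One us j) p)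
          (nth_default One be j)) [0..<length be]))))" by blast
      have us: "length us = length bs" "set us \<subseteq> set W" using m by (simp_all add: set_n_lists len)
      note z' = z[unfolded zi]
      have "\<forall>j<length bs. pt_fun (vec_val ys us) j \<in> fval ys ` set W"
        using us by (auto intro: pt_fun_vec_val_image)
      then show ?R using z' by (intro exI[of _ "pt_fun (vec_val ys us)"]) simp
    next
      assume ?R
      then obtain u where u: "\<forall>j<length bs. u j \<in> fval ys ` set W"
        "fval ys w * mon (vec_val ys gs) d = (\<Sum>j<length bs. u j ^ p * bs ! j)" by blast
      have "\<forall>j. \<exists>s. j < length bs \<longrightarrow> s \<in> set W \<and> fval ys s = u j" using u(1) unfolding image_iff by metis
      then have "\<exists>g. \<forall>j. j < length bs \<longrightarrow> g j \<in> set W \<and> fval ys (g j) = u j" by (rule choice)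
      then obtain g where g: "\<forall>j. j < length bs \<longrightarrow> g j \<in> set W \<and> fval ys (g j) = u j" ..
      let ?us = "map g [0..<length bs]"
      have "pt_fun (vec_val ys ?us) j = u j" if "j < length bs" for j
        using g that by (simp add: o_def nth_default_map_upt)
      then have "Z (Add (Mul w (fmon gs d)) (Neg (fsum (map (\<lambda>j. Mul (fpow (nth_default One ?us j) p)
          (nth_default One be j)) [0..<length be]))))"
        unfolding zi using u(2) by simp
      moreover have "?us \<in> set (List.n_lists (length be) W)" using g by (auto simp: set_n_lists len)
      ultimately show ?L by blast
    qed
  qed
  have "d \<in> set (List.n_lists (length gs) [0..<p]) \<longleftrightarrow> length d = length gs \<and> set d \<subseteq> {..<p}" for d
    by (auto simp: set_n_lists)
  then show ?thesis
    unfolding alg_closed_def list_all_iff list_ex_iff inner by auto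
qed

text \<open>The orbits that are kept lie on the hyperplane by the test itself, and in
  \<open>G\<close> by the choice of the candidates. Conversely \<open>cover\<close> gives for each
  nondegenerate point an orbit with data below \<open>bnd\<close>, which is among the candidates and
  passes the test because the whole orbit consists of solutions.\<close>

lemma alg_correct:
  assumes Z: "\<And>s. Z s \<longleftrightarrow> fval ys s = 0" and be: "vec_val ys be = bs"
    and n: "n \<ge> 1" "length as = Suc n" "0 \<notin> set (vec_val ys as)"
    and G: "mult_subgroup G" "G = mult_subgroup hull set (vec_val ys gs)"
    and W: "set as \<subseteq> set W" "alg_closed Z p be W (gs @ map Inv gs)"
  shows "orbit_cover n (vec_val ys as) G (p ^ alg_K n W)
      (map (map_prod (map (vec_val ys)) (vec_val ys)) (alg_U Z p n as W (gs @ map Inv gs)))"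
    and "product_cover n (vec_val ys as) G (p ^ alg_K n W)
      (map (map_prod (vec_val ys) (map (vec_val ys))) (alg_V Z p n as W (gs @ map Inv gs)))"
proof -
  let ?gf = "gs @ map Inv gs"
  define gv where "gv = vec_val ys ?gf"
  define WW where "WW = fval ys ` set W"
  have gv_eq: "gv = vec_val ys gs @ map inverse (vec_val ys gs)" by (simp add: gv_def o_def)
  have G_range: "G = range (mon gv)" unfolding gv_eq by (rule mon_hull(2)[OF G])
  have monG: "mon gv d \<in> G" for d unfolding G_range by simp
  have G0: "0 \<notin> G" using G(1) by (simp add: mult_subgroup_def)
  interpret cover_system ys p bs n gv WW "alg_N n W"
  proof
    show "set gv \<subseteq> F" by (auto simp: gv_def intro: gen_field_inverse)
    show "0 \<notin> set gv" using mon_hull(1)[OF G] by (auto simp: gv_eq)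
    show "finite WW" "WW \<subseteq> F" by (auto simp: WW_def)
    show "\<exists>u. (\<forall>j<length bs. u j \<in> WW) \<and> w * mon gv d = (\<Sum>j<length bs. u j ^ p * bs ! j)"
      if "w \<in> WW" "length d = length gv" "set d \<subseteq> {..<p}" for w d
      using W(2)[unfolded alg_closed_iff[OF Z be]] that unfolding WW_def gv_def length_map by blast
    have "card WW \<le> length W" unfolding WW_def by (metis card_image_le card_length finite_set le_trans)
    then have "card WW ^ Suc n \<le> length W ^ Suc n" by (rule power_mono) simp
    then show "2 ^ (card WW ^ Suc n) \<le> alg_N n W" unfolding alg_N_def by (rule power_increasing) simp
  qed
  have K_eq: "alg_K n W = K" by (simp add: alg_K_def K_def)
  have L_eq: "alg_L n W = L" by (simp add: alg_L_def L_def K_eq)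
  have pre_eq: "alg_pre p n W b = pre b" for b by (simp add: alg_pre_def pre_def L_eq)
  have "rec_nat (p ^ L) (\<lambda>_ r. pre (pre r)) h = bnd h" for h by (induction h) simp_all
  then have bound_eq: "alg_bound p n W = bnd n" by (simp add: alg_bound_def L_eq pre_eq)
  let ?q = "p ^ K" let ?M = "bnd n" let ?as = "vec_val ys as"
  let ?tw = "alg_twists Z p n W ?gf" let ?pts = "alg_points p n W ?gf" let ?ro = "alg_roots Z p n W ?gf"
  have q: "?q > 0" using p_pos by simp
  \<comment> \<open>A positive exponent is required for \<open>v ^ (?q - 1) \<in> G\<close> to
    witness membership in \<open>radical G\<close>, and to exclude \<open>v = 0\<close>.\<close>
  have q1: "?q - 1 > 0"
    using one_less_power[of p K] p_ge2 K_pos by simp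
  have len_gv: "length gs + length gs = length gv" by (simp add: gv_def)
  have monnz: "mon gv d \<noteq> 0" for d using monG[of d] G0 by auto
  have pts: "x \<in> fval ys ` set ?pts \<longleftrightarrow> (\<exists>d. length d = length gv \<and> set d \<subseteq> {..?M} \<and> x = mon gv d)" for x
  proof -
    have "fval ys ` set ?pts = mon gv ` {d. length d = length gv \<and> set d \<subseteq> {..?M}}"
      unfolding alg_points_def bound_eq
      by (simp add: image_image set_n_lists len_gv gv_def[symmetric] atLeast0LessThan lessThan_Suc_atMost del: upt_Suc map_append)
    then show ?thesis by auto
  qed
  have ro: "u \<in> set ?ro \<longleftrightarrow> u \<in> set (quot_list n (elim_list (Suc n) W)) \<and>
    (\<exists>d. length d = length gv \<and> set d \<subseteq> {..p ^ alg_N n W * ?q} \<and> fval ys u ^ (?q - 1) = mon gv d)" for u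
    unfolding alg_roots_def K_eq
    by (simp add: list_ex_iff set_n_lists Z len_gv gv_def[symmetric] atLeast0LessThan lessThan_Suc_atMost
        del: upt_Suc map_append)
  have tw: "v \<in> fval ys ` set ?tw \<longleftrightarrow> (\<exists>u s d. u \<in> set ?ro \<and> s \<le> ?M \<and> length d = length gv \<and> set d \<subseteq> {..?M} \<and>
      v = fval ys u ^ (p ^ s) * inverse (mon gv d))" for v
  proof -
    have "set ?tw = {Mul (fpow u (p ^ s)) (Inv (fmon ?gf d)) | u s d. u \<in> set ?ro \<and> s \<le> ?M \<and>
        length d = length gv \<and> set d \<subseteq> {..?M}}"
      unfolding alg_twists_def bound_eq
      by (auto simp add: set_n_lists len_gv atLeast0LessThan lessThan_Suc_atMost simp del: upt_Suc map_append)
    moreover have "fval ys ` {h u s d | u s d. Q u s d} = {fval ys (h u s d) | u s d. Q u s d}"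
      for h :: "fexpr \<Rightarrow> nat \<Rightarrow> nat list \<Rightarrow> fexpr" and Q by auto
    ultimately have "fval ys ` set ?tw = {fval ys (Mul (fpow u (p ^ s)) (Inv (fmon ?gf d))) | u s d. u \<in> set ?ro \<and> s \<le> ?M \<and>
        length d = length gv \<and> set d \<subseteq> {..?M}}" by (simp only:)
    also have "\<dots> = {fval ys u ^ (p ^ s) * inverse (mon gv d) | u s d. u \<in> set ?ro \<and> s \<le> ?M \<and>
        length d = length gv \<and> set d \<subseteq> {..?M}}" by (simp add: gv_def del: map_append)
    finally have e: "fval ys ` set ?tw = {fval ys u ^ (p ^ s) * inverse (mon gv d) | u s d. u \<in> set ?ro \<and> s \<le> ?M \<and>
        length d = length gv \<and> set d \<subseteq> {..?M}}" .
    show ?thesis unfolding e mem_Collect_eq by (intro iff_exI) auto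
  qed
  have tw_G: "v ^ (?q - 1) \<in> G \<and> v \<noteq> 0" if v: "v \<in> fval ys ` set ?tw" for v
  proof -
    obtain u s d where u: "u \<in> set ?ro" "v = fval ys u ^ (p ^ s) * inverse (mon gv d)"
      using v[unfolded tw] by blast
    obtain d' where d': "fval ys u ^ (?q - 1) = mon gv d'" using u(1)[unfolded ro] by blast
    have "v ^ (?q - 1) = (fval ys u ^ (?q - 1)) ^ (p ^ s) * inverse (mon gv d) ^ (?q - 1)"
      unfolding u(2) power_mult_distrib by (simp only: power_mult[symmetric] mult.commute)
    then have "v ^ (?q - 1) \<in> G" unfolding d'
      using mult_subgroup_closed[OF G(1)] monG by simp
    moreover have "fval ys u \<noteq> 0" using d' monnz[of d'] q1 by (intro notI) (simp add: power_0_left)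
    ultimately show ?thesis using monnz[of d] by (simp add: u(2))
  qed
  have as_nth: "?as ! i = pt_fun ?as i" if "i \<le> n" for i using that n(2) by (simp add: nth_default_def)
  have sum_as: "(\<Sum>i\<le>n. ?as ! i * f i) = (\<Sum>i\<le>n. pt_fun ?as i * f i)" for f
    by (intro sum.cong) (auto simp: as_nth)
  have U: "c \<in> set (alg_U Z p n as W ?gf) \<longleftrightarrow> length (fst c) < n \<and>
      (\<forall>\<psi>\<in>set (fst c). length \<psi> = Suc n \<and> set \<psi> \<subseteq> set ?tw) \<and> length (snd c) = Suc n \<and>
      set (snd c) \<subseteq> set ?pts \<and> alg_check Z n ?q as c" for c
  proof -
    have "c \<in> set (alg_cands n ?tw ?pts) \<longleftrightarrow> length (fst c) < n \<and>
      (\<forall>\<psi>\<in>set (fst c). length \<psi> = Suc n \<and> set \<psi> \<subseteq> set ?tw) \<and> length (snd c) = Suc n \<and> set (snd c) \<subseteq> set ?pts"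
    proof (cases c)
      case (Pair \<psi>s \<tau>)
      have X: "(\<exists>h\<in>{0..<n}. \<exists>a\<in>A h. (\<psi>s, \<tau>) \<in> Pair a ` B) \<longleftrightarrow> (\<exists>h<n. \<psi>s \<in> A h \<and> \<tau> \<in> B)" for A B
        by (auto simp: image_iff Bex_def)
      have "c \<in> set (alg_cands n ?tw ?pts) \<longleftrightarrow> (\<exists>h<n. \<psi>s \<in> set (List.n_lists h (List.n_lists (Suc n) ?tw)) \<and>
          \<tau> \<in> set (List.n_lists (Suc n) ?pts))"
        unfolding alg_cands_def Pair by (simp add: X del: List.n_lists.simps)
      then show ?thesis unfolding Pair set_n_lists fst_conv snd_conv mem_Collect_eq subset_iff by blast
    qed
    then show ?thesis unfolding alg_U_def K_eq by simp
  qed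
  let ?fs = "\<lambda>\<psi>s. map (\<lambda>\<psi>. pt_fun (vec_val ys \<psi>)) \<psi>s" let ?f = "\<lambda>\<tau>. pt_fun (vec_val ys \<tau>)"
  have check: "alg_check Z n ?q as (\<psi>s, \<tau>) \<longleftrightarrow> (\<forall>es. length es = length \<psi>s \<longrightarrow> set es \<subseteq> {..n} \<longrightarrow>
      (\<Sum>i\<le>n. pt_fun ?as i * orbit_pt ?q (?fs \<psi>s) es (?f \<tau>) i) = 0)"
    if c: "\<forall>\<psi>\<in>set \<psi>s. length \<psi> = Suc n" "length \<tau> = Suc n" for \<psi>s \<tau>
  proof -
    have s: "fval ys (fsum (map (\<lambda>i. Mul (nth_default One as i) (nth_default One (alg_orbit n ?q \<psi>s es \<tau>) i)) [0..<Suc n]))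
      = (\<Sum>i\<le>n. pt_fun ?as i * orbit_pt ?q (?fs \<psi>s) es (?f \<tau>) i)" if es: "length es = length \<psi>s" for es
    proof -
      have "fval ys (fsum (map (\<lambda>i. Mul (nth_default One as i) (nth_default One (alg_orbit n ?q \<psi>s es \<tau>) i)) [0..<Suc n]))
        = (\<Sum>i<Suc n. pt_fun ?as i * pt_fun (vec_val ys (alg_orbit n ?q \<psi>s es \<tau>)) i)"
        by (simp only: fval_fsum map_map o_def fval.simps fval_nth_default sum_list_upt)
      also have "\<dots> = (\<Sum>i\<le>n. pt_fun ?as i * orbit_pt ?q (?fs \<psi>s) es (?f \<tau>) i)"
        unfolding lessThan_Suc_atMost by (intro sum.cong refl) (simp add: vec_val_orbit[OF es c])
      finally show ?thesis .
    qed
    have m: "es \<in> set (List.n_lists (length \<psi>s) [0..<Suc n]) \<longleftrightarrow> length es = length \<psi>s \<and> set es \<subseteq> {..n}" for es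
      by (auto simp add: set_n_lists subset_iff less_Suc_eq_le simp del: upt_Suc)
    show ?thesis unfolding alg_check_def list_all_iff fst_conv snd_conv Z using s m by auto
  qed
  have U_vanish: "(\<Sum>i\<le>n. pt_fun ?as i * orbit_pt ?q (?fs \<psi>s) es (?f \<tau>) i) = 0"
    if c: "(\<psi>s, \<tau>) \<in> set (alg_U Z p n as W ?gf)" and es: "length es = length \<psi>s" for \<psi>s \<tau> es
  proof (rule orbit_check)
    have c': "\<forall>\<psi>\<in>set \<psi>s. length \<psi> = Suc n" "length \<tau> = Suc n" "alg_check Z n ?q as (\<psi>s, \<tau>)"
      using c[unfolded U] by simp_all
    show "\<psi> i \<in> F" if "\<psi> \<in> set (?fs \<psi>s)" for \<psi> i using that by (auto simp: pt_fun_gen_field)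
    show "(\<Sum>i\<le>n. pt_fun ?as i * orbit_pt ?q (?fs \<psi>s) es (?f \<tau>) i) = 0"
      if "length es = length (?fs \<psi>s)" "set es \<subseteq> {..n}" for es
      using c'(3)[unfolded check[OF c'(1,2)]] that by simp
  qed (simp_all add: pt_fun_gen_field es)
  have U_group: "(\<forall>\<psi>\<in>set (?fs \<psi>s). \<psi> i ^ (?q - 1) \<in> G \<and> \<psi> i \<noteq> 0) \<and> ?f \<tau> i \<in> G"
    if c: "(\<psi>s, \<tau>) \<in> set (alg_U Z p n as W ?gf)" and i: "i \<le> n" for \<psi>s \<tau> i
  proof
    have c': "\<forall>\<psi>\<in>set \<psi>s. length \<psi> = Suc n \<and> set \<psi> \<subseteq> set ?tw" "length \<tau> = Suc n" "set \<tau> \<subseteq> set ?pts"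
      using c[unfolded U] by simp_all
    show "\<forall>\<psi>\<in>set (?fs \<psi>s). \<psi> i ^ (?q - 1) \<in> G \<and> \<psi> i \<noteq> 0"
    proof
      fix \<psi> assume "\<psi> \<in> set (?fs \<psi>s)"
      then obtain \<phi> where \<phi>: "\<phi> \<in> set \<psi>s" "\<psi> = pt_fun (vec_val ys \<phi>)" by auto
      then have "length \<phi> = Suc n" "set \<phi> \<subseteq> set ?tw" using c'(1) by auto
      then have "\<psi> i \<in> fval ys ` set ?tw" using i unfolding \<phi>(2) by (intro pt_fun_vec_val_image) simp_all
      then show "\<psi> i ^ (?q - 1) \<in> G \<and> \<psi> i \<noteq> 0" by (rule tw_G)
    qed
    have "?f \<tau> i \<in> fval ys ` set ?pts" using c'(2,3) i by (intro pt_fun_vec_val_image) simp_all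
    then show "?f \<tau> i \<in> G" using monG unfolding pts by auto
  qed
  have lens: "\<forall>g\<in>set (map (vec_val ys) \<psi>s). length g = Suc n" "length (vec_val ys \<tau>) = Suc n"
    if "(\<psi>s, \<tau>) \<in> set (alg_U Z p n as W ?gf)" for \<psi>s \<tau>
    using that[unfolded U] by auto
  have exists: "\<exists>\<psi>s \<tau> es x. (\<psi>s, \<tau>) \<in> set (alg_U Z p n as W ?gf) \<and> length es = length \<psi>s \<and>
      P = hpoint (pt_list n x) \<and> (\<forall>i\<le>n. x i = orbit_pt ?q (?fs \<psi>s) es (?f \<tau>) i)"
    if P: "P \<in> nondegenerate_over n ?as G" for P
  proof -
    obtain x0 where x0: "P = hpoint (pt_list n x0)" "x0 0 = 1" "\<forall>i\<le>n. x0 i \<in> G" "(\<Sum>i\<le>n. ?as ! i * x0 i) = 0"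
      "\<forall>I. I \<noteq> {} \<longrightarrow> I \<subset> {..n} \<longrightarrow> (\<Sum>i\<in>I. ?as ! i * x0 i) \<noteq> 0"
      using nondegenerate_overE[OF G(1) P] by blast
    have "\<forall>i. \<exists>d. i \<le> n \<longrightarrow> x0 i = mon gv d" using x0(3) by (auto simp: G_range)
    then have "\<exists>m0. \<forall>i. i \<le> n \<longrightarrow> x0 i = mon gv (m0 i)" by (rule choice)
    then obtain m0 where m0: "\<forall>i. i \<le> n \<longrightarrow> x0 i = mon gv (m0 i)" ..
    \<comment> \<open>The empty exponent vector at index 0 and beyond \<open>n\<close> gives the
      value 1 there, as \<open>Gv\<close> demands.\<close>
    define m where "m i = (if i = 0 \<or> i > n then [] else m0 i)" for i
    define x where "x i = mon gv (m i)" for i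
    have xi: "x i = x0 i" if "i \<le> n" for i using m0 that x0(2) by (auto simp: x_def m_def)
    obtain B where B: "\<forall>i\<in>{..n}. pbound B [m i]" using pbound_family[of "{..n}" "\<lambda>i. [m i]"] by auto
    have xG: "x \<in> Gv B"
    proof (rule GvI[where m = m])
      show "x = (\<lambda>i. mon gv (m i))" by (simp add: x_def fun_eq_iff)
      show "nth_default 0 (m i) j \<le> B" for i j using B by (cases "i \<le> n") (auto simp: m_def)
      show "nth_default 0 (m i) j = 0" if "i = 0 \<or> i > n" for i j using that by (simp add: m_def)
    qed
    define a where "a i = (if i \<le> n then ?as ! i else 0)" for i
    \<comment> \<open>The walk starts with the given equation alone. That its span has dimension 1
      accounts for the bound \<open>n - 1\<close> on the number of twists.\<close>
    let ?V = "fvec.span {a}"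
    have "a \<in> vecs n WW" using n(2) subsetD[OF W(1) nth_mem] by (auto simp: vecs_def a_def WW_def)
    then have V: "?V \<in> states" by (auto simp: states_def)
    have "(\<Sum>i\<le>n. a i * x i) = 0" using x0(4) xi by (simp add: a_def)
    then have perp: "perp n ?V x" unfolding perp_span by (simp add: perp_def)
    have nd: "nondeg n ?V x"
      unfolding nondeg_def
    proof (intro allI impI)
      fix A assume A: "A \<noteq> {}" "A \<subset> {..n}"
      have "(\<Sum>i\<in>A. a i * x i) = (\<Sum>i\<in>A. ?as ! i * x0 i)"
        using A(2) xi by (intro sum.cong) (auto simp: a_def)
      then have "(\<Sum>i\<in>A. a i * x i) \<noteq> 0" using x0(5) A by simp
      then show "\<exists>f\<in>?V. (\<Sum>i\<in>A. f i * x i) \<noteq> 0" by (intro bexI[of _ a] fvec.span_base) simp_all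
    qed
    have "?as ! 0 \<in> set ?as" using n(2) by (intro nth_mem) simp
    then have "a 0 \<noteq> 0" using n(3) by (metis a_def le0)
    then have "fvec.independent {a}" by (intro fvec.independent_insertI fvec.independent_empty) (auto simp: fun_eq_iff)
    from fvec.dim_span_eq_card_independent[OF this] have "fvec.dim ?V = 1" by simp
    then have "cov (bnd (n - 1)) (n - 1) ?V x" using cover[OF V xG perp nd] by simp
    moreover have "bnd (n - 1) \<le> ?M" by (rule bnd_mono) simp
    ultimately have "cov ?M (n - 1) ?V x" by (rule cov_mono) simp
    then obtain \<psi>s \<tau> es where o: "length \<psi>s \<le> n - 1" "set \<psi>s \<subseteq> twists ?M" "\<tau> \<in> Gv ?M"
      "length es = length \<psi>s" "x = orbit_pt ?q \<psi>s es \<tau>"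
      "\<forall>es'. length es' = length \<psi>s \<longrightarrow> perp n ?V (orbit_pt ?q \<psi>s es' \<tau>)"
      by (rule covE)
    \<comment> \<open>The enumerations contain exponent vectors of exact length only, so vectors of
      other lengths are replaced by equivalent ones.\<close>
    have norm: "\<exists>d'. length d' = length gv \<and> set d' \<subseteq> {..C} \<and> mon gv d = mon gv d'"
      if "\<forall>j. nth_default 0 d j \<le> C" for d C
      by (rule exI[of _ "map (nth_default 0 d) [0..<length gv]"])
        (use that in \<open>auto simp: mon_def nth_default_map_upt\<close>)
    have Gv_norm': "\<exists>d'. length d' = length gv \<and> set d' \<subseteq> {..C} \<and> g i = mon gv d'" if g: "g \<in> Gv C" for g C i
    proof -
      obtain k where k: "g = (\<lambda>i. mon gv (k i))" "\<forall>i j. nth_default 0 (k i) j \<le> C"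
        "\<forall>i j. i = 0 \<or> i > n \<longrightarrow> nth_default 0 (k i) j = 0" using g by (rule GvE)
      show ?thesis using norm[of "k i" C] k(1,2) by simp
    qed
    have "\<exists>s\<in>set ?pts. fval ys s = \<tau> i" for i
    proof -
      have "\<tau> i \<in> fval ys ` set ?pts" unfolding pts using Gv_norm'[OF o(3), of i] by simp
      then show ?thesis by auto
    qed
    then obtain \<tau>l where \<tau>l: "length \<tau>l = Suc n" "set \<tau>l \<subseteq> set ?pts" "\<forall>i\<le>n. ?f \<tau>l i = \<tau> i"
      using vec_val_choose[of n "set ?pts" ys \<tau>] by blast
    have "\<exists>l. length l = Suc n \<and> set l \<subseteq> set ?tw \<and> (\<forall>i\<le>n. ?f l i = \<psi> i)" if \<psi>: "\<psi> \<in> set \<psi>s" for \<psi>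
    proof (rule vec_val_choose)
      fix i assume i: "i \<le> n"
      have "\<psi> \<in> twists ?M" using \<psi> o(2) by blast
      then obtain u g s where u: "u \<in> roots" "g \<in> Gv ?M" "s \<le> ?M" "\<psi> = frv s u * vinv g" by (rule twistsE)
      have "u i \<in> quot_products n (elim_closure (Suc n) WW)" using u(1) i unfolding roots_def by blast
      then have "u i \<in> fval ys ` set (quot_list n (elim_list (Suc n) W))"
        unfolding fval_quot_list fval_elim_list WW_def .
      then obtain s0 where s0: "s0 \<in> set (quot_list n (elim_list (Suc n) W))" "fval ys s0 = u i" by auto
      have "(\<lambda>i. u i ^ (?q - 1)) \<in> Gv (p ^ alg_N n W * ?q)" using u(1) unfolding roots_def by blast
      from Gv_norm'[OF this, of i] have "s0 \<in> set ?ro" unfolding ro using s0 by simp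
      moreover obtain d' where d': "length d' = length gv" "set d' \<subseteq> {..?M}" "g i = mon gv d'"
        using Gv_norm'[OF u(2), of i] by blast
      have "\<psi> i = fval ys s0 ^ (p ^ s) * inverse (mon gv d')"
        by (simp add: u(4) frv_apply vinv_apply s0(2) d'(3))
      ultimately have "\<psi> i \<in> fval ys ` set ?tw" unfolding tw using u(3) d'(1,2) by blast
      then show "\<exists>s\<in>set ?tw. fval ys s = \<psi> i" by auto
    qed
    then have "\<forall>\<psi>. \<exists>l. \<psi> \<in> set \<psi>s \<longrightarrow> length l = Suc n \<and> set l \<subseteq> set ?tw \<and> (\<forall>i\<le>n. ?f l i = \<psi> i)"
      by auto
    then have "\<exists>lf. \<forall>\<psi>. \<psi> \<in> set \<psi>s \<longrightarrow> length (lf \<psi>) = Suc n \<and> set (lf \<psi>) \<subseteq> set ?tw \<and>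
      (\<forall>i\<le>n. ?f (lf \<psi>) i = \<psi> i)" by (rule choice)
    then obtain lf where lf: "\<forall>\<psi>. \<psi> \<in> set \<psi>s \<longrightarrow> length (lf \<psi>) = Suc n \<and> set (lf \<psi>) \<subseteq> set ?tw \<and>
      (\<forall>i\<le>n. ?f (lf \<psi>) i = \<psi> i)" ..
    let ?l = "map lf \<psi>s"
    have same: "orbit_pt ?q (?fs ?l) es' (?f \<tau>l) i = orbit_pt ?q \<psi>s es' \<tau> i" if i: "i \<le> n" for es' i
      by (rule orbit_pt_cong) (use lf \<tau>l(3) i in auto)
    have "alg_check Z n ?q as (?l, \<tau>l)"
    proof (subst check)
      show "\<forall>\<psi>\<in>set ?l. length \<psi> = Suc n" using lf by auto
      show "length \<tau>l = Suc n" by (rule \<tau>l(1))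
      show "\<forall>es. length es = length ?l \<longrightarrow> set es \<subseteq> {..n} \<longrightarrow>
        (\<Sum>i\<le>n. pt_fun ?as i * orbit_pt ?q (?fs ?l) es (?f \<tau>l) i) = 0"
      proof (intro allI impI)
        fix es' :: "nat list" assume "length es' = length ?l"
        then have "perp n {a} (orbit_pt ?q \<psi>s es' \<tau>)" using o(6) by (simp add: perp_span)
        then have "(\<Sum>i\<le>n. a i * orbit_pt ?q \<psi>s es' \<tau> i) = 0" by (simp add: perp_def)
        moreover have "(\<Sum>i\<le>n. pt_fun ?as i * orbit_pt ?q (?fs ?l) es' (?f \<tau>l) i)
          = (\<Sum>i\<le>n. a i * orbit_pt ?q \<psi>s es' \<tau> i)"
        proof (rule sum.cong[OF refl])
          fix i assume "i \<in> {..n}"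
          then have i: "i \<le> n" by simp
          show "pt_fun ?as i * orbit_pt ?q (?fs ?l) es' (?f \<tau>l) i = a i * orbit_pt ?q \<psi>s es' \<tau> i"
            unfolding same[OF i] a_def using as_nth[OF i] i by simp
        qed
        ultimately show "(\<Sum>i\<le>n. pt_fun ?as i * orbit_pt ?q (?fs ?l) es' (?f \<tau>l) i) = 0" by simp
      qed
    qed
    then have mem: "(?l, \<tau>l) \<in> set (alg_U Z p n as W ?gf)"
      unfolding U using o(1) n(1) lf \<tau>l by auto
    have x: "pt_list n x0 = pt_list n x" using xi by simp
    show ?thesis
    proof (intro exI conjI)
      show "(?l, \<tau>l) \<in> set (alg_U Z p n as W ?gf)" by (rule mem)
      show "length es = length ?l" using o(4) by simp
      show "P = hpoint (pt_list n x)" unfolding x0(1) x ..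
      show "\<forall>i\<le>n. x i = orbit_pt ?q (?fs ?l) es (?f \<tau>l) i" using same o(5) by metis
    qed
  qed
  have sub: "frob_orbit ?q (map (vec_val ys) \<psi>s) {hpoint (vec_val ys \<tau>)} =
      {hpoint (pt_list n (orbit_pt ?q (?fs \<psi>s) es (?f \<tau>))) | es. length es = length \<psi>s}"
    if c: "(\<psi>s, \<tau>) \<in> set (alg_U Z p n as W ?gf)" for \<psi>s \<tau>
    using frob_orbit_hpoint[OF lens[OF c], of ?q] by (simp only: map_map o_def length_map)
  show "orbit_cover n ?as G (p ^ alg_K n W) (map (map_prod (map (vec_val ys)) (vec_val ys)) (alg_U Z p n as W ?gf))"
    unfolding orbit_cover_def K_eq
  proof (intro conjI)
    have each: "length (map (vec_val ys) \<psi>s) \<le> n - 1 \<and>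
        (\<forall>g\<in>set (map (vec_val ys) \<psi>s). length g = Suc n \<and> set g \<subseteq> radical G) \<and>
        hpoint (vec_val ys \<tau>) \<in> proj_space n \<and>
        frob_orbit ?q (map (vec_val ys) \<psi>s) {hpoint (vec_val ys \<tau>)} \<subseteq> hyperplane_over n ?as G"
      if c: "(\<psi>s, \<tau>) \<in> set (alg_U Z p n as W ?gf)" for \<psi>s \<tau>
    proof (intro conjI)
      have c': "length \<psi>s < n" "\<forall>\<psi>\<in>set \<psi>s. length \<psi> = Suc n \<and> set \<psi> \<subseteq> set ?tw" "length \<tau> = Suc n"
        using c[unfolded U] by simp_all
      show "length (map (vec_val ys) \<psi>s) \<le> n - 1" using c'(1) by simp
      have "fval ys s \<in> radical G" if "s \<in> set ?tw" for s
        using tw_G[of "fval ys s"] that q1 unfolding radical_def by blast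
      then show "\<forall>g\<in>set (map (vec_val ys) \<psi>s). length g = Suc n \<and> set g \<subseteq> radical G" using c'(2) by auto
      have "vec_val ys \<tau> = pt_list n (?f \<tau>)" using c'(3) by (intro pt_list_eqI) (simp_all add: nth_default_def)
      moreover have "?f \<tau> i \<noteq> 0" if "i \<le> n" for i using U_group[OF c that] G0 by auto
      ultimately show "hpoint (vec_val ys \<tau>) \<in> proj_space n" using hpoint_proj_space[of n "?f \<tau>"] by simp
      show "frob_orbit ?q (map (vec_val ys) \<psi>s) {hpoint (vec_val ys \<tau>)} \<subseteq> hyperplane_over n ?as G"
        unfolding sub[OF c]
      proof safe
        fix es :: "nat list" assume es: "length es = length \<psi>s"
        show "hpoint (pt_list n (orbit_pt ?q (?fs \<psi>s) es (?f \<tau>))) \<in> hyperplane_over n ?as G"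
          by (rule hpoint_hyperplane_over[OF _ G0])
            (use U_group[OF c] orbit_pt_group[OF G(1) _ q] U_vanish[OF c es] sum_as in simp_all)
      qed
    qed
    show "\<forall>(gs, t)\<in>set (map (map_prod (map (vec_val ys)) (vec_val ys)) (alg_U Z p n as W ?gf)).
        length gs \<le> n - 1 \<and> (\<forall>g\<in>set gs. length g = Suc n \<and> set g \<subseteq> radical G) \<and>
        hpoint t \<in> proj_space n \<and> frob_orbit ?q gs {hpoint t} \<subseteq> hyperplane_over n ?as G"
    proof
      fix c assume "c \<in> set (map (map_prod (map (vec_val ys)) (vec_val ys)) (alg_U Z p n as W ?gf))"
      then obtain \<psi>s \<tau> where c: "(\<psi>s, \<tau>) \<in> set (alg_U Z p n as W ?gf)"
        "c = (map (vec_val ys) \<psi>s, vec_val ys \<tau>)" by auto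
      show "case c of (gs, t) \<Rightarrow> length gs \<le> n - 1 \<and> (\<forall>g\<in>set gs. length g = Suc n \<and> set g \<subseteq> radical G) \<and>
        hpoint t \<in> proj_space n \<and> frob_orbit ?q gs {hpoint t} \<subseteq> hyperplane_over n ?as G"
        unfolding c(2) prod.case by (rule each[OF c(1)])
    qed
    show "nondegenerate_over n ?as G \<subseteq> (\<Union>(gs, t)\<in>set (map (map_prod (map (vec_val ys)) (vec_val ys)) (alg_U Z p n as W ?gf)).
        frob_orbit ?q gs {hpoint t})"
    proof
      fix P assume "P \<in> nondegenerate_over n ?as G"
      then obtain \<psi>s \<tau> es x where o: "(\<psi>s, \<tau>) \<in> set (alg_U Z p n as W ?gf)" "length es = length \<psi>s"
        "P = hpoint (pt_list n x)" "\<forall>i\<le>n. x i = orbit_pt ?q (?fs \<psi>s) es (?f \<tau>) i" using exists by blast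
      have x: "pt_list n x = pt_list n (orbit_pt ?q (?fs \<psi>s) es (?f \<tau>))" using o(4) by simp
      have "P \<in> frob_orbit ?q (map (vec_val ys) \<psi>s) {hpoint (vec_val ys \<tau>)}"
        unfolding sub[OF o(1)] o(3) x using o(2) by (intro CollectI exI[of _ es] conjI refl)
      then show "P \<in> (\<Union>(gs, t)\<in>set (map (map_prod (map (vec_val ys)) (vec_val ys)) (alg_U Z p n as W ?gf)).
        frob_orbit ?q gs {hpoint t})" using o(1) by force
    qed
  qed
  have prod_sub: "frob_product ?q (hpoint (vec_val ys (fst c))) (map hpoint (map (vec_val ys) (snd c))) =
      {hpoint (pt_list n (\<lambda>i. fst (to_product (?fs \<psi>s) (?f \<tau>)) i * multi_power ?q (snd (to_product (?fs \<psi>s) (?f \<tau>))) ls i))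
        | ls. length ls = length \<psi>s}"
    if c: "(\<psi>s, \<tau>) \<in> set (alg_U Z p n as W ?gf)" "c = alg_product n (\<psi>s, \<tau>)" for \<psi>s \<tau> c
  proof -
    have \<tau>: "length \<tau> = Suc n" using c(1)[unfolded U] by simp
    note v = vec_val_product[OF \<tau>, where ys = ys and \<psi>s = \<psi>s, folded c(2)]
    have l: "\<forall>g\<in>set (map (vec_val ys) (snd c)). length g = Suc n" "length (vec_val ys (fst c)) = Suc n"
      "length (snd c) = length \<psi>s" using v[of 0] by auto
    have "pt_list n (\<lambda>i. pt_fun (vec_val ys (fst c)) i * multi_power ?q (map pt_fun (map (vec_val ys) (snd c))) ls i)
      = pt_list n (\<lambda>i. fst (to_product (?fs \<psi>s) (?f \<tau>)) i * multi_power ?q (snd (to_product (?fs \<psi>s) (?f \<tau>))) ls i)" for ls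
    proof (rule map_cong[OF refl])
      fix i assume "i \<in> set [0..<Suc n]"
      then have i: "i \<le> n" by (simp add: less_Suc_eq_le del: upt_Suc)
      have "multi_power ?q (map pt_fun (map (vec_val ys) (snd c))) ls i = multi_power ?q (snd (to_product (?fs \<psi>s) (?f \<tau>))) ls i"
        by (rule multi_power_cong) (use v[OF i] l(3) in simp_all)
      then show "pt_fun (vec_val ys (fst c)) i * multi_power ?q (map pt_fun (map (vec_val ys) (snd c))) ls i
        = fst (to_product (?fs \<psi>s) (?f \<tau>)) i * multi_power ?q (snd (to_product (?fs \<psi>s) (?f \<tau>))) ls i"
        using v[OF i] by simp
    qed
    then show ?thesis unfolding frob_product_hpoint[OF l(1,2), of ?q] by (simp only: length_map l(3))
  qed
  show "product_cover n ?as G (p ^ alg_K n W) (map (map_prod (vec_val ys) (map (vec_val ys))) (alg_V Z p n as W ?gf))"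
    unfolding product_cover_def K_eq
  proof (intro conjI)
    have "length (map (vec_val ys) (snd c)) \<le> n - 1 \<and>
        (\<forall>y\<in>set (vec_val ys (fst c) # map (vec_val ys) (snd c)). length y = Suc n \<and> 0 \<notin> set y) \<and>
        frob_product ?q (hpoint (vec_val ys (fst c))) (map hpoint (map (vec_val ys) (snd c))) \<subseteq> hyperplane_over n ?as G"
      if cV: "c \<in> set (alg_V Z p n as W ?gf)" for c
    proof -
      obtain \<psi>s \<tau> where c: "(\<psi>s, \<tau>) \<in> set (alg_U Z p n as W ?gf)" "c = alg_product n (\<psi>s, \<tau>)"
        using cV unfolding alg_V_def by auto
      have \<tau>: "length \<tau> = Suc n" and h: "length \<psi>s < n" using c(1)[unfolded U] by simp_all
      note v = vec_val_product[OF \<tau>, where ys = ys and \<psi>s = \<psi>s, folded c(2)]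
      have l: "\<forall>y\<in>set (snd c). length y = Suc n" "length (fst c) = Suc n" "length (snd c) = length \<psi>s"
        using v[of 0] by auto
      have grp: "fst (to_product (?fs \<psi>s) (?f \<tau>)) i ^ (?q - 1) \<in> G \<and> fst (to_product (?fs \<psi>s) (?f \<tau>)) i \<noteq> 0 \<and>
          (\<forall>y\<in>set (snd (to_product (?fs \<psi>s) (?f \<tau>))). y i \<noteq> 0) \<and>
          fst (to_product (?fs \<psi>s) (?f \<tau>)) i * multi_power ?q (snd (to_product (?fs \<psi>s) (?f \<tau>))) ls i \<in> G"
        if "i \<le> n" "length ls = length \<psi>s" for i ls
        by (rule to_product_group[OF G(1) _ q]) (use U_group[OF c(1) that(1)] that(2) in simp_all)
      have nzl: "0 \<notin> set (vec_val ys y)" if y: "length y = Suc n" "\<And>i. i \<le> n \<Longrightarrow> ?f y i \<noteq> 0" for y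
      proof
        assume "0 \<in> set (vec_val ys y)"
        then obtain i where "i < length y" "fval ys (y ! i) = 0" by (auto simp: in_set_conv_nth)
        then show False using y(2)[of i] y(1) by (simp add: pt_fun_nth_vec_val)
      qed
      \<comment> \<open>The zero exponents merely meet the length condition of \<open>grp\<close>;
        that the coordinates do not vanish has nothing to do with their choice.\<close>
      have "0 \<notin> set (vec_val ys (fst c))"
        by (rule nzl[OF l(2)]) (use v grp[of _ "replicate (length \<psi>s) 0"] in simp)
      moreover have "0 \<notin> set (vec_val ys y)" if y: "y \<in> set (snd c)" for y
      proof -
        obtain k where k: "k < length \<psi>s" "y = snd c ! k" using y l(3) by (auto simp: in_set_conv_nth)
        show ?thesis
        proof (rule nzl)
          show "length y = Suc n" using l(1) y by blast
          fix i assume i: "i \<le> n"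
          have "?f y i = (snd (to_product (?fs \<psi>s) (?f \<tau>)) ! k) i" using v[OF i] k by simp
          moreover have "snd (to_product (?fs \<psi>s) (?f \<tau>)) ! k \<in> set (snd (to_product (?fs \<psi>s) (?f \<tau>)))"
            using k(1) by (intro nth_mem) simp
          ultimately show "?f y i \<noteq> 0" using grp[OF i, of "replicate (length \<psi>s) 0"] by auto
        qed
      qed
      moreover have "frob_product ?q (hpoint (vec_val ys (fst c))) (map hpoint (map (vec_val ys) (snd c))) \<subseteq> hyperplane_over n ?as G"
        unfolding prod_sub[OF c]
      proof safe
        fix ls :: "nat list" assume ls: "length ls = length \<psi>s"
        have "(\<Sum>i\<le>n. pt_fun ?as i * (fst (to_product (?fs \<psi>s) (?f \<tau>)) i * multi_power ?q (snd (to_product (?fs \<psi>s) (?f \<tau>))) ls i)) = 0"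
        proof (rule product_vanish)
          show "\<psi> i \<in> F" if "\<psi> \<in> set (?fs \<psi>s)" for \<psi> i using that by (auto simp: pt_fun_gen_field)
        qed (use U_vanish[OF c(1)] ls in \<open>simp_all add: pt_fun_gen_field\<close>)
        then show "hpoint (pt_list n (\<lambda>i. fst (to_product (?fs \<psi>s) (?f \<tau>)) i * multi_power ?q (snd (to_product (?fs \<psi>s) (?f \<tau>))) ls i))
            \<in> hyperplane_over n ?as G"
          by (intro hpoint_hyperplane_over[OF _ G0]) (use grp ls sum_as in simp_all)
      qed
      ultimately show ?thesis using l h by auto
    qed
    then show "\<forall>(x, xs)\<in>set (map (map_prod (vec_val ys) (map (vec_val ys))) (alg_V Z p n as W ?gf)).
        length xs \<le> n - 1 \<and> (\<forall>y\<in>set (x # xs). length y = Suc n \<and> 0 \<notin> set y) \<and>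
        frob_product ?q (hpoint x) (map hpoint xs) \<subseteq> hyperplane_over n ?as G"
      by fastforce
    show "nondegenerate_over n ?as G \<subseteq> (\<Union>(x, xs)\<in>set (map (map_prod (vec_val ys) (map (vec_val ys))) (alg_V Z p n as W ?gf)).
        frob_product ?q (hpoint x) (map hpoint xs))"
    proof
      fix P assume "P \<in> nondegenerate_over n ?as G"
      then obtain \<psi>s \<tau> es x where o: "(\<psi>s, \<tau>) \<in> set (alg_U Z p n as W ?gf)" "length es = length \<psi>s"
        "P = hpoint (pt_list n x)" "\<forall>i\<le>n. x i = orbit_pt ?q (?fs \<psi>s) es (?f \<tau>) i" using exists by blast
      let ?c = "alg_product n (\<psi>s, \<tau>)"
      have x: "pt_list n x = pt_list n (\<lambda>i. fst (to_product (?fs \<psi>s) (?f \<tau>)) i *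
          multi_power ?q (snd (to_product (?fs \<psi>s) (?f \<tau>))) (partial_sums es) i)"
        using o(2,4) by (simp add: orbit_pt_to_product)
      have P: "P \<in> frob_product ?q (hpoint (vec_val ys (fst ?c))) (map hpoint (map (vec_val ys) (snd ?c)))"
        unfolding prod_sub[OF o(1) refl] o(3) x
        by (intro CollectI exI[of _ "partial_sums es"] conjI refl) (simp add: o(2))
      have m: "map_prod (vec_val ys) (map (vec_val ys)) ?c \<in> set (map (map_prod (vec_val ys) (map (vec_val ys))) (alg_V Z p n as W ?gf))"
        unfolding alg_V_def set_map using o(1) by (intro imageI)
      obtain u v where c: "?c = (u, v)" by (cases ?c)
      show "P \<in> (\<Union>(x, xs)\<in>set (map (map_prod (vec_val ys) (map (vec_val ys))) (alg_V Z p n as W ?gf)).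
        frob_product ?q (hpoint x) (map hpoint xs))"
        by (rule UN_I[OF m]) (use P in \<open>unfold c map_prod_simp prod.case fst_conv snd_conv\<close>)
    qed
  qed
qed

end

lemma list_encode_enc: "list_encode l = enc l"
  by (simp add: enc_list_def)

lemma vec_code_enc: "vec_code = enc"
  by (simp add: fun_eq_iff list_code_def enc_list_def enc_fexpr_def cong: map_cong)

text \<open>This makes the search halt: the finite closed set from
  \<open>digit_closed_exists\<close> has representing expressions, and they may be listed after the
  coefficients of the equation.\<close>

lemma (in char_p_basis) alg_closed_exists:
  assumes Z: "\<And>s. Z s \<longleftrightarrow> fval ys s = 0" and be: "vec_val ys be = bs"
  shows "\<exists>l. alg_closed Z p be (as @ l) gs"
proof -
  let ?M = "mon (vec_val ys gs) ` {d. length d = length gs \<and> set d \<subseteq> {..<p}}"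
  have "finite {d :: nat list. set d \<subseteq> {..<p} \<and> length d = length gs}" by (rule finite_lists_length_eq) simp
  then have M: "finite ?M" by (simp add: conj_commute)
  have MF: "?M \<subseteq> F" by (auto intro!: mon_gen_field)
  have A: "finite (fval ys ` set as)" "fval ys ` set as \<subseteq> F" by auto
  obtain W where W: "finite W" "fval ys ` set as \<subseteq> W" "W \<subseteq> F"
    "\<forall>w\<in>W. \<forall>g\<in>?M. \<exists>u. (\<forall>j<length bs. u j \<in> W) \<and> w * g = (\<Sum>j<length bs. u j ^ p * bs ! j)"
    using digit_closed_exists[OF A M MF] by blast
  obtain S where S: "finite S" "W = fval ys ` S"
    using finite_subset_image[of W "fval ys" UNIV] W(1,3) unfolding gen_field_def by auto
  obtain l where l: "set l = S" using finite_list[OF S(1)] by blast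
  have "fval ys ` set (as @ l) = W" using W(2) l S(2) by auto
  then have "alg_closed Z p be (as @ l) gs"
    unfolding alg_closed_iff[OF Z be] using W(4) by auto
  then show ?thesis ..
qed

theorem theorem3:
  fixes ys :: "'a::field list"
  assumes "CHAR('a) > 0"
  shows "\<exists>alg. \<forall>n as gs rs. \<forall>G :: 'a set.
    n \<ge> 2 \<longrightarrow>
    length as = Suc n \<longrightarrow> 0 \<notin> set (vec_val ys as) \<longrightarrow>
    mult_subgroup G \<longrightarrow>
    G = mult_subgroup hull set (vec_val ys gs) \<longrightarrow>
    radical G = mult_subgroup hull set (vec_val ys rs) \<longrightarrow>
    (\<exists>k U V. computes alg [vec_code as, vec_code gs, vec_code rs] (output_code k U V) \<and>
       k > 0 \<and>
       orbit_cover n (vec_val ys as) G (CHAR('a) ^ k)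
         (map (map_prod (map (vec_val ys)) (vec_val ys)) U) \<and>
       product_cover n (vec_val ys as) G (CHAR('a) ^ k)
         (map (map_prod (vec_val ys) (map (vec_val ys))) V))"
proof -
  define p where "p = CHAR('a)"
  interpret char_p_field ys p by unfold_locales (simp_all add: p_def assms)
  \<comment> \<open>Basis and zero test depend on \<open>ys\<close> only and are chosen before the
    input is given, so their existence suffices: they are constants of the program.\<close>
  obtain bs where bs: "q_basis p bs" using q_basis_exists[of 1] by auto
  interpret char_p_basis ys p bs by unfold_locales (rule bs)
  have "set bs \<subseteq> range (fval ys)" using bs by (simp add: q_basis_def gen_field_def)
  then obtain be where be: "vec_val ys be = bs"
    by (metis ex_map_conv subset_iff imageE)
  define Z where "Z s \<longleftrightarrow> fval ys s = 0" for s
  have Z: "computable Z" unfolding Z_def by (rule computable_fval_zero)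
  obtain dec where dec: "computable dec" "\<And>s :: fexpr. dec (enc s) = s"
    using computable_fexpr_decode by blast
  \<comment> \<open>The coefficients are placed in front so that they always belong to
    \<open>W\<close>; the number \<open>m\<close> codes the further elements.\<close>
  define W where "W x m = fst x @ map dec (list_decode m)"
    for x :: "fexpr list \<times> fexpr list \<times> fexpr list" and m
  define gf where "gf x = fst (snd x) @ map Inv (fst (snd x))"
    for x :: "fexpr list \<times> fexpr list \<times> fexpr list"
  define N where "N x = length (fst x) - 1" for x :: "fexpr list \<times> fexpr list \<times> fexpr list"
  let ?P = "\<lambda>x m. alg_closed Z p be (W x m) (gf x)"
  let ?f = "\<lambda>x m. [alg_K (N x) (W x m), enc (alg_U Z p (N x) (fst x) (W x m) (gf x)),
    enc (alg_V Z p (N x) (fst x) (W x m) (gf x))]"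
  have cP: "computable (\<lambda>a. ?P (fst a) (snd a))"
    unfolding W_def gf_def by (intro comp_intro Z dec(1) dec(1)[THEN computable_comp])
  have cf: "computable (\<lambda>a. ?f (fst a) (snd a))"
    unfolding W_def gf_def N_def by (intro comp_intro Z dec(1) dec(1)[THEN computable_comp])
  obtain r where r: "\<And>x. (\<exists>m. ?P x m) \<Longrightarrow> \<exists>m. ?P x m \<and> computes r [enc x] (enc (?f x m))"
    using computable_search[OF cP cf] by blast
  obtain alg where alg: "\<And>(a::fexpr list) (b::fexpr list) (c::fexpr list) y.
      computes r [enc (a, b, c)] y \<Longrightarrow> computes alg [enc a, enc b, enc c] y"
    using computes_triple[of r] by blast
  show ?thesis
  proof (intro exI[of _ alg] allI impI)
    fix n and as gs rs :: "fexpr list" and G :: "'a set"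
    assume n: "2 \<le> n" "length as = Suc n" "0 \<notin> set (vec_val ys as)"
      and G: "mult_subgroup G" "G = mult_subgroup hull set (vec_val ys gs)"
    let ?x = "(as, gs, rs)"
    obtain l where "alg_closed Z p be (as @ l) (gf ?x)"
      using alg_closed_exists[OF Z_def be] by blast
    then have "?P ?x (list_encode (map enc l))" by (simp add: W_def o_def dec(2))
    then obtain m where m: "?P ?x m" "computes r [enc ?x] (enc (?f ?x m))" using r by blast
    have N: "N ?x = n" by (simp add: N_def n(2))
    let ?W = "W ?x m"
    let ?k = "alg_K n ?W" let ?U = "alg_U Z p n as ?W (gs @ map Inv gs)"
    let ?V = "alg_V Z p n as ?W (gs @ map Inv gs)"
    have W: "set as \<subseteq> set ?W" by (auto simp: W_def)
    have "computes alg [vec_code as, vec_code gs, vec_code rs] (output_code ?k ?U ?V)"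
      using alg[OF m(2)] by (simp add: vec_code_enc output_code_enc list_encode_enc N gf_def)
    moreover have "?k > 0" by (simp add: alg_K_def)
    moreover have "1 \<le> n" "alg_closed Z p be ?W (gs @ map Inv gs)" using n(1) m(1) by (simp_all add: gf_def)
    note c = alg_correct[OF Z_def be this(1) n(2,3) G W this(2), unfolded p_def]
    ultimately show "\<exists>k U V. computes alg [vec_code as, vec_code gs, vec_code rs] (output_code k U V) \<and> k > 0 \<and>
       orbit_cover n (vec_val ys as) G (CHAR('a) ^ k)
         (map (map_prod (map (vec_val ys)) (vec_val ys)) U) \<and>
       product_cover n (vec_val ys as) G (CHAR('a) ^ k)
         (map (map_prod (vec_val ys) (map (vec_val ys))) V)"
      using c unfolding p_def by blast
  qed
qed

end
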